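(* Let $G$ be a connected graph, and let $G'$ be a graph resulting from $G$ by a flossing move. Then $\gamma(\mathcal{B}(G'))\le\gamma(\mathcal{B}(G))$.
   Context: Graphs are finite, with no loops or multiple edges; the vertices of a graph with $n$ vertices are labelled distinctly by $[n]=\{1,\dots,n\}$. A leaf of a graph is a vertex of degree one. Graphical building set: $\mathcal{B}(G)$ is the set of all non-empty subsets $I\subseteq[n]$ such that the induced subgraph of $G$ on $I$ is connected. Graph-associahedron: let $e_1,\dots,e_n$ be the endpoints of the coordinate vectors in $\mathbb{R}^n$, and for $I\subseteq[n]$ let $\Delta_I=\mathrm{ConvexHull}(e_i \mid i\in I)$. The graph-associahedron of $G$ is the Minkowski sum $P_{\mathcal{B}(G)}=\sum_{I\in\mathcal{B}(G)}\Delta_I$. It is a simple polytope of dimension $n$ minus the number of connected components of $G$. $\gamma$-polynomial: for a simple $d$-dimensional polytope $P$, let $f(P)(t)=f_0+f_1t+\cdots+f_dt^d$, where $f_i$ is the number of $i$-dimensional faces of $P$. Define $h(P)(t)=\sum_{i=0}^d h_it^i$ by $h(P)(t+1)=f(P)(t)$. This polynomial is symmetric, so it can be written uniquely as $\sum_{i=0}^{d}h_it^i=\sum_{i=0}^{\lfloor d/2\rfloor}\gamma_i t^i(1+t)^{d-2i}$ with $\gamma_i\in\mathbb{Z}$. Set $\gamma(P)(t)=\gamma_0+\gamma_1t+\cdots+\gamma_{\lfloor d/2\rfloor}t^{\lfloor d/2\rfloor}$ and $\gamma(\mathcal{B}(G))=\gamma(P_{\mathcal{B}(G)})$. The notation $\gamma(\mathcal{B})\le\gamma(\mathcal{B}')$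 means that for all $i$ the coefficient of $t^i$ in $\gamma(\mathcal{B})$ is at most the coefficient of $t^i$ in $\gamma(\mathcal{B}')$. Flossing move: $\mathrm{dist}_G(v_1,v_2)$ denotes the number of edges in a minimal path in $G$ between vertices $v_1$ and $v_2$. A pair of leaves $l,\hat l$ of $G$ floss a vertex $v$ of $G$ if there is a unique path in $G$ from $l$ to $\hat l$ of minimal length, and $v$ is the unique vertex of degree $\ge 3$ (in $G$) on this path. Given such a triple $(l,\hat l,v)$, labelled so that $\mathrm{dist}_G(l,v)\le\mathrm{dist}_G(\hat l,v)$, let $w$ be the vertex adjacent to $l$ (possibly $w=v$). A flossing move on $G$ is the operation of removing the edge $(l,w)$ and adding the edge $(\hat l,l)$. *)

theory Defs
  imports "HOL-Analysis.Analysis" "HOL-Computational_Algebra.Computational_Algebra"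
begin

section \<open>Graphs\<close>

text \<open>
  A graph with \<open>n\<close> vertices is a set \<open>E\<close> of two-element subsets of a finite type \<open>'n\<close> with
  \<open>CARD('n) = n\<close>. The elements of \<open>'n\<close> play the role of the labels \<open>1, \<dots>, n\<close>, and
  \<open>real ^ 'n\<close> the role of \<open>n\<close>-dimensional space.
\<close>

definition simple_graph :: "'n set set \<Rightarrow> bool" where
  "simple_graph E \<longleftrightarrow> (\<forall>e\<in>E. card e = 2)"

definition vdegree :: "'n set set \<Rightarrow> 'n \<Rightarrow> nat" where
  "vdegree E v = card {e \<in> E. v \<in> e}"

definition leaf :: "'n set set \<Rightarrow> 'n \<Rightarrow> bool" where
  "leaf E v \<longleftrightarrow> vdegree E v = 1"

text \<open>A path is given by its list of vertices; it has \<open>length p - 1\<close> edges.\<close>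

definition path_between :: "'n set set \<Rightarrow> 'n \<Rightarrow> 'n list \<Rightarrow> 'n \<Rightarrow> bool" where
  "path_between E u p v \<longleftrightarrow>
     p \<noteq> [] \<and> hd p = u \<and> last p = v \<and> distinct p \<and> successively (\<lambda>x y. {x, y} \<in> E) p"

definition graph_connected :: "'n set \<Rightarrow> 'n set set \<Rightarrow> bool" where
  "graph_connected V E \<longleftrightarrow> (\<forall>u\<in>V. \<forall>v\<in>V. \<exists>p. path_between E u p v)"

definition induced_edges :: "'n set set \<Rightarrow> 'n set \<Rightarrow> 'n set set" where
  "induced_edges E I = {e \<in> E. e \<subseteq> I}"

definition graph_dist :: "'n set set \<Rightarrow> 'n \<Rightarrow> 'n \<Rightarrow> nat" where
  "graph_dist E u v = (LEAST k. \<exists>p. path_between E u p v \<and> length p = Suc k)"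

definition shortest_path :: "'n set set \<Rightarrow> 'n \<Rightarrow> 'n list \<Rightarrow> 'n \<Rightarrow> bool" where
  "shortest_path E u p v \<longleftrightarrow> path_between E u p v \<and> length p = Suc (graph_dist E u v)"

section \<open>Flossing moves\<close>

definition floss :: "'n set set \<Rightarrow> 'n \<Rightarrow> 'n \<Rightarrow> 'n \<Rightarrow> bool" where
  "floss E l l' v \<longleftrightarrow>
     leaf E l \<and> leaf E l' \<and> l \<noteq> l' \<and>
     (\<exists>!p. shortest_path E l p l') \<and>
     (\<forall>p. shortest_path E l p l' \<longrightarrow> {x \<in> set p. vdegree E x \<ge> 3} = {v})"

definition flossing_move :: "'n set set \<Rightarrow> 'n set set \<Rightarrow> bool" where
  "flossing_move E E' \<longleftrightarrow>
     (\<exists>l l' v w. floss E l l' v \<and> graph_dist E l v \<le> graph_dist E l' v \<and> {l, w} \<in> E \<and>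
        E' = insert {l', l} (E - {{l, w}}))"

section \<open>Graph-associahedra\<close>

definition building_set :: "'n set set \<Rightarrow> 'n set set" where
  "building_set E = {I. I \<noteq> {} \<and> graph_connected I (induced_edges E I)}"

definition std_simplex :: "'n::finite set \<Rightarrow> (real ^ 'n) set" where
  "std_simplex I = convex hull ((\<lambda>i. axis i 1) ` I)"

text \<open>
  Addition of sets, and hence the sum below, is the Minkowski one of
  \<^theory>\<open>HOL-Library.Set_Algebras\<close>.
\<close>

definition nestohedron :: "'n::finite set set \<Rightarrow> (real ^ 'n) set" where
  "nestohedron B = (\<Sum>I\<in>B. std_simplex I)"

abbreviation graph_associahedron :: "'n::finite set set \<Rightarrow> (real ^ 'n) set" where
  "graph_associahedron E \<equiv> nestohedron (building_set E)"

section \<open>Face polynomials\<close>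

definition pdim :: "'a::euclidean_space set \<Rightarrow> nat" where
  "pdim P = nat (aff_dim P)"

definition face_number :: "'a::euclidean_space set \<Rightarrow> nat \<Rightarrow> nat" where
  "face_number P i = card {F. F face_of P \<and> aff_dim F = int i}"

definition f_polynomial :: "'a::euclidean_space set \<Rightarrow> int poly" where
  "f_polynomial P = (\<Sum>i\<le>pdim P. monom (int (face_number P i)) i)"

definition h_polynomial :: "'a::euclidean_space set \<Rightarrow> int poly" where
  "h_polynomial P = (THE h. pcompose h [:1, 1:] = f_polynomial P)"

definition gamma_expansion :: "nat \<Rightarrow> int poly \<Rightarrow> int poly" where
  "gamma_expansion d g = (\<Sum>i\<le>d div 2. smult (coeff g i) (monom 1 i * [:1, 1:] ^ (d - 2 * i)))"

definition gamma_polynomial :: "'a::euclidean_space set \<Rightarrow> int poly" where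
  "gamma_polynomial P =
     (THE g. degree g \<le> pdim P div 2 \<and> h_polynomial P = gamma_expansion (pdim P) g)"

text \<open>
  The \<open>h\<close>-polynomial always exists and is unique; the \<open>\<gamma>\<close>-polynomial is unique, and its
  existence amounts to the symmetry of the \<open>h\<close>-polynomial.
\<close>

lemma pcompose_shift_iff:
  fixes h f :: "int poly"
  shows "pcompose h [:1, 1:] = f \<longleftrightarrow> h = pcompose f [:-1, 1:]"
proof -
  have "pcompose [:1, 1:] [:-1, 1:] = [:0, 1 :: int:]" "pcompose [:-1, 1:] [:1, 1:] = [:0, 1 :: int:]"
    by (simp_all add: pcompose_pCons)
  then show ?thesis
    by (metis pcompose_assoc pcompose_idR)
qed

lemma h_polynomial: "pcompose (h_polynomial P) [:1, 1:] = f_polynomial P"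
  unfolding h_polynomial_def by (simp add: pcompose_shift_iff)

lemma gamma_expansion_inject:
  assumes "degree g \<le> d div 2" "degree g' \<le> d div 2"
    and eq: "gamma_expansion d g = gamma_expansion d g'"
  shows "g = g'"
proof -
  have coeff_exp: "coeff (gamma_expansion d q) k =
      (\<Sum>i<k. coeff q i * coeff (monom 1 i * [:1, 1:] ^ (d - 2 * i)) k) + coeff q k"
    if "k \<le> d div 2" for q k
  proof -
    have "coeff (gamma_expansion d q) k =
        (\<Sum>i\<le>d div 2. coeff q i * coeff (monom 1 i * [:1, 1:] ^ (d - 2 * i)) k)"
      by (simp add: gamma_expansion_def coeff_sum)
    also have "\<dots> = (\<Sum>i\<le>k. coeff q i * coeff (monom 1 i * [:1, 1:] ^ (d - 2 * i)) k)"
      using that by (intro sum.mono_neutral_right) (auto simp: coeff_monom_mult)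
    also have "\<dots> = (\<Sum>i<k. coeff q i * coeff (monom 1 i * [:1, 1:] ^ (d - 2 * i)) k) + coeff q k"
      by (simp add: lessThan_Suc_atMost[symmetric] coeff_monom_mult coeff_0_power)
    finally show ?thesis .
  qed
  have "coeff g k = coeff g' k" if "k \<le> d div 2" for k
    using that
  proof (induction k rule: less_induct)
    case (less k)
    then have "(\<Sum>i<k. coeff g i * coeff (monom 1 i * [:1, 1:] ^ (d - 2 * i)) k) =
        (\<Sum>i<k. coeff g' i * coeff (monom 1 i * [:1, 1:] ^ (d - 2 * i)) k)"
      by (intro sum.cong) auto
    then show ?case
      using coeff_exp[OF less.prems, of g] coeff_exp[OF less.prems, of g'] eq by simp
  qed
  then show ?thesis
    using assms(1,2) by (metis coeff_eq_0 le_less_trans not_le poly_eqI)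
qed

lemma gamma_polynomial_eqI:
  assumes "degree g \<le> pdim P div 2" "h_polynomial P = gamma_expansion (pdim P) g"
  shows "gamma_polynomial P = g"
  unfolding gamma_polynomial_def
  using assms by (intro the_equality) (auto intro: gamma_expansion_inject)

end

theory Submission
  imports Defs
begin

text \<open>
  The face of a graph associahedron on which a linear functional \<open>y\<close> is largest is determined by
  the following data: in each connected component the set of vertices at which \<open>y\<close> is largest, and
  the same data for the graph that remains when these vertices are removed. For the polynomial
  \<open>f\<^bsub>G\<^esub>(t)\<close> that counts faces by dimension this means, for a graph with vertex set \<open>V\<close> and \<open>c\<close>
  components,
  \<open>\<Sum>\<^bsub>T \<subseteq> V\<^esub> t\<^bsup>card T\<^esup> f\<^bsub>G - T\<^esub> = (1 + t)\<^bsup>c\<^esup> f\<^bsub>G\<^esub>\<close>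
  (lemma \<open>fpoly_Pow_sum\<close>; the geometry is in \<open>f_polynomial_nestohedron\<close>).

  Since deletion of vertices commutes with the other operations involved, induction on the number
  of vertices turns this identity into an edge deletion formula \<open>fpoly_del_edge\<close>: for an edge \<open>e\<close>,
  \<open>f\<^bsub>G\<^esub> = f\<^bsub>G - e\<^esub> + (1 + t) \<Sum>\<^bsub>I\<^esub> f\<^bsub>(G - e)[I]\<^esub> f\<^bsub>G/I\<^esub>\<close>,
  where \<open>I\<close> runs over the sets that are connected in \<open>G\<close> but not in \<open>G - e\<close>, and \<open>G/I\<close> arises from
  \<open>G\<close> by removing \<open>I\<close> and joining the neighbours of \<open>I\<close> to each other. Geometrically, unless \<open>e\<close> is a
  bridge, the associahedron of \<open>G\<close> is obtained from that of \<open>G - e\<close> by cutting off one codimension two face for each \<open>I\<close>. In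
  terms of \<open>\<gamma>\<close>-polynomials, for connected \<open>G\<close> (\<open>graph_gamma_del_edge\<close>),
  \<open>\<gamma>\<^bsub>G\<^esub> = \<gamma>\<^bsub>G - e\<^esub> + t \<Sum>\<^bsub>I \<noteq> V\<^esub> \<gamma>\<^bsub>(G - e)[I]\<^esub> \<gamma>\<^bsub>G/I\<^esub>\<close>.
  Removing edges one by one proves that \<open>\<gamma>\<^bsub>G\<^esub>\<close> exists and has nonnegative coefficients.

  Now let \<open>G\<close> admit a flossing move. Then \<open>G\<close> is a line of vertices \<open>0, \<dots>, L\<close> together with a graph
  that is attached only to the position \<open>m\<close> of the line, the hub, where \<open>2 m \<le> L\<close>; up to isomorphism
  the move shifts the hub to position \<open>m - 1\<close> (\<open>flossing_move_hub\<close>). So the claim is that the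
  \<open>\<gamma>\<close>-polynomial grows while the hub moves towards the middle (\<open>line_gamma_mono\<close>). Apply the edge
  deletion formula to the first edge of the line for the hub at \<open>m\<close>, and to the last edge for the hub
  at \<open>m - 1\<close>; without the isolated end vertex, the two graphs \<open>G - e\<close> are isomorphic. The sets \<open>I\<close> that
  are segments of the line in one graph cancel against the sets that contain the whole attached graph
  in the other one. What remains can be compared term by term: one factor is equal and nonnegative,
  and the other one belongs to a shorter line, on which the hub of the second graph is again farther
  from the middle than that of the first.
\<close>

section \<open>Connected vertex sets and components\<close>

definition reach :: "('a \<Rightarrow> 'a \<Rightarrow> bool) \<Rightarrow> 'a set \<Rightarrow> 'a \<Rightarrow> 'a \<Rightarrow> bool" where
  "reach r V = (\<lambda>x y. r x y \<and> x \<in> V \<and> y \<in> V)\<^sup>*\<^sup>*"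

definition component :: "('a \<Rightarrow> 'a \<Rightarrow> bool) \<Rightarrow> 'a set \<Rightarrow> 'a \<Rightarrow> 'a set" where
  "component r V a = {b \<in> V. reach r V a b}"

definition comps :: "('a \<Rightarrow> 'a \<Rightarrow> bool) \<Rightarrow> 'a set \<Rightarrow> 'a set set" where
  "comps r V = component r V ` V"

definition conn :: "('a \<Rightarrow> 'a \<Rightarrow> bool) \<Rightarrow> 'a set \<Rightarrow> bool" where
  "conn r I \<longleftrightarrow> I \<noteq> {} \<and> (\<forall>a\<in>I. \<forall>b\<in>I. reach r I a b)"

definition closed_in :: "('a \<Rightarrow> 'a \<Rightarrow> bool) \<Rightarrow> 'a set \<Rightarrow> 'a set \<Rightarrow> bool" where
  "closed_in r V K \<longleftrightarrow> K \<subseteq> V \<and> (\<forall>x\<in>K. \<forall>y\<in>V. r x y \<longrightarrow> y \<in> K)"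

lemma reach_refl [simp]: "reach r V a a"
  by (simp add: reach_def)

lemma reach_trans: "reach r V a b \<Longrightarrow> reach r V b c \<Longrightarrow> reach r V a c"
  unfolding reach_def by (rule rtranclp_trans)

lemma reach_step: "reach r V a b \<Longrightarrow> r b c \<Longrightarrow> b \<in> V \<Longrightarrow> c \<in> V \<Longrightarrow> reach r V a c"
  unfolding reach_def by (rule rtranclp.rtrancl_into_rtrancl) auto

lemma reach_edge: "r b c \<Longrightarrow> b \<in> V \<Longrightarrow> c \<in> V \<Longrightarrow> reach r V b c"
  by (rule reach_step[OF reach_refl])

lemma reach_induct [consumes 1, case_names refl step]:
  assumes "reach r V a b" "P a"
    and "\<And>x y. reach r V a x \<Longrightarrow> P x \<Longrightarrow> r x y \<Longrightarrow> x \<in> V \<Longrightarrow> y \<in> V \<Longrightarrow> P y"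
  shows "P b"
  using assms(1) unfolding reach_def
  by (induction rule: rtranclp_induct) (use assms(2,3) in \<open>auto simp: reach_def\<close>)

lemma reach_sym:
  assumes "symp r" "reach r V a b"
  shows "reach r V b a"
  using assms(2)
proof (induction rule: reach_induct)
  case (step x y)
  then have "reach r V y x"
    using assms(1) by (intro reach_edge) (auto dest: sympD)
  then show ?case using step by (blast intro: reach_trans)
qed simp

lemma reach_mono:
  assumes "reach r V a b" "\<And>x y. r x y \<Longrightarrow> x \<in> V \<Longrightarrow> y \<in> V \<Longrightarrow> x \<noteq> y \<Longrightarrow> r' x y \<and> x \<in> W \<and> y \<in> W"
  shows "reach r' W a b"
  using assms(1)
proof (induction rule: reach_induct)
  case (step x y)
  then show ?case using assms(2)[of x y] by (cases "x = y") (auto intro: reach_step)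
qed simp

text \<open>
  Loops never matter for connectivity. They have to be tolerated here because joining all neighbours
  of a set to each other also joins every neighbour to itself.
\<close>

lemma reach_cong:
  assumes "\<And>x y. x \<in> V \<Longrightarrow> y \<in> V \<Longrightarrow> x \<noteq> y \<Longrightarrow> r x y \<longleftrightarrow> r' x y"
  shows "reach r V = reach r' V"
  using assms by (intro ext iffI) (erule reach_mono; blast)+

lemma reach_closed:
  assumes "reach r V a b" "closed_in r V K" "a \<in> K"
  shows "reach r K a b" "b \<in> K"
proof -
  have "reach r K a b \<and> b \<in> K"
    using assms(1)
    by (induction rule: reach_induct)
      (use assms(2,3) in \<open>auto simp: closed_in_def intro: reach_step\<close>)
  then show "reach r K a b" "b \<in> K" by auto
qed

lemma component_closed:
  assumes "closed_in r V K" "a \<in> K"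
  shows "component r V a = component r K a"
proof -
  have "reach r V a b" if "reach r K a b" for b
    using that by (rule reach_mono) (use assms in \<open>auto simp: closed_in_def\<close>)
  then show ?thesis using reach_closed[OF _ assms] assms(1)
    by (auto simp: component_def closed_in_def)
qed

lemma conn_component:
  assumes "symp r" "conn r K" "closed_in r V K" "a \<in> K"
  shows "component r V a = K"
  using assms by (subst component_closed[OF assms(3,4)]) (auto simp: component_def conn_def)

lemma closed_component: "closed_in r V (component r V a)"
  by (auto simp: closed_in_def component_def intro: reach_step)

lemma conn_component_self:
  assumes "symp r" "a \<in> V"
  shows "conn r (component r V a)"
proof -
  have a: "a \<in> component r V a" using assms by (simp add: component_def)
  have "reach r (component r V a) a b" if "b \<in> component r V a" for b
    using that by (intro reach_closed[OF _ closed_component a]) (auto simp: component_def)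
  then show ?thesis
    using a reach_sym[OF assms(1)] unfolding conn_def by (blast intro: reach_trans)
qed

text \<open>
  This description, with no base point, makes it easy to see that a component survives changes of the
  graph that happen elsewhere.
\<close>

lemma comps_iff:
  assumes "symp r"
  shows "K \<in> comps r V \<longleftrightarrow> conn r K \<and> closed_in r V K"
proof
  assume "conn r K \<and> closed_in r V K"
  moreover then obtain a where "a \<in> K" by (auto simp: conn_def)
  ultimately show "K \<in> comps r V"
    unfolding comps_def using conn_component[OF assms, of K V a]
    by (auto simp: closed_in_def intro!: image_eqI[of _ _ a])
qed (auto simp: comps_def conn_component_self[OF assms] closed_component)

lemma conn_subset_closed:
  assumes "conn r I" "I \<subseteq> V" "closed_in r V K" "a \<in> I" "a \<in> K"
  shows "I \<subseteq> K"
proof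
  fix b assume "b \<in> I"
  then have "reach r I a b" using assms by (auto simp: conn_def)
  then have "reach r V a b" by (rule reach_mono) (use assms in auto)
  then show "b \<in> K" by (rule reach_closed(2)) (use assms in auto)
qed

lemma comps_eqI:
  assumes "symp r" "K \<in> comps r V" "K' \<in> comps r V" "a \<in> K" "a \<in> K'"
  shows "K = K'"
  using assms by (metis comps_iff conn_component)

lemma comps_subset: "K \<in> comps r V \<Longrightarrow> K \<subseteq> V"
  by (auto simp: comps_def component_def)

lemma comps_nonempty: "K \<in> comps r V \<Longrightarrow> K \<noteq> {}"
  by (auto simp: comps_def component_def)

lemma Union_comps: "\<Union>(comps r V) = V"
  by (auto simp: comps_def component_def)

lemma comps_Diff:
  assumes "symp r" "K \<in> comps r V" "T \<inter> K = {}"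
  shows "K \<in> comps r (V - T)"
  using assms by (auto simp: comps_iff closed_in_def)

lemma closed_Diff:
  assumes "symp r" "closed_in r V K"
  shows "closed_in r V (V - K)"
  using assms by (auto simp: closed_in_def dest: sympD)

lemma finite_comps: "finite V \<Longrightarrow> finite (comps r V)"
  by (simp add: comps_def)

lemma conn_comps:
  assumes "symp r" "conn r V"
  shows "comps r V = {V}"
proof -
  have "V \<in> comps r V" using assms by (simp add: comps_iff closed_in_def)
  moreover have "K = V" if "K \<in> comps r V" for K
    using comps_eqI[OF assms(1) that calculation] comps_nonempty[OF that]
      comps_subset[OF that] by blast
  ultimately show ?thesis by blast
qed

section \<open>The face polynomial of a graph\<close>

text \<open>
  The sets \<open>nest r V y a\<close> form the tubing determined by \<open>y\<close>: the face of the graph associahedron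
  in direction \<open>y\<close> depends only on this function. The value \<open>{}\<close> outside \<open>V\<close> lets equality of functions
  mean equality on \<open>V\<close>.
\<close>

definition nest :: "('a \<Rightarrow> 'a \<Rightarrow> bool) \<Rightarrow> 'a set \<Rightarrow> ('a \<Rightarrow> real) \<Rightarrow> 'a \<Rightarrow> 'a set" where
  "nest r V y a = (if a \<in> V then component r {b \<in> V. y b \<le> y a} a else {})"

text \<open>
  The face in direction \<open>y\<close> has one degree of freedom less for every member of the tubing, hence the
  exponent. Disconnected \<open>V\<close> is allowed, since removing vertices disconnects the graph.
\<close>

definition fpoly :: "('a \<Rightarrow> 'a \<Rightarrow> bool) \<Rightarrow> 'a set \<Rightarrow> int poly" where
  "fpoly r V = (\<Sum>N\<in>range (nest r V). monom 1 (card V - card (N ` V)))"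

lemma nest_subset: "nest r V y a \<subseteq> V"
  by (auto simp: nest_def component_def)

lemma nest_refl: "a \<in> V \<Longrightarrow> a \<in> nest r V y a"
  by (auto simp: nest_def component_def)

lemma finite_nests:
  assumes "finite V" shows "finite (range (nest r V))"
proof (rule finite_subset)
  show "range (nest r V) \<subseteq> {f. \<forall>x. (x \<in> V \<longrightarrow> f x \<in> Pow V) \<and> (x \<notin> V \<longrightarrow> f x = {})}"
    using nest_subset by (fastforce simp: nest_def)
  show "finite \<dots>"
    using assms by (intro finite_set_of_finite_funs) auto
qed

text \<open>
  If the maximum \<open>M\<close> of \<open>y\<close> over a component \<open>K\<close> is attained on \<open>T\<close>, the level set at height \<open>M\<close> contains
  all of \<open>K\<close>, whereas the vertices of \<open>T\<close> are missing from all lower level sets.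
\<close>

lemma nest_top:
  assumes r: "symp r" and K: "K \<in> comps r V" and T: "T \<subseteq> K" "T \<noteq> {}"
    and y: "\<And>a. a \<in> T \<Longrightarrow> y a = M" "\<And>a. a \<in> K - T \<Longrightarrow> y a < M" and a: "a \<in> V"
  shows "nest r V y a = (if a \<in> T then K else nest r (V - T) y a)"
proof (cases "a \<in> T")
  case True
  have K': "conn r K" "closed_in r V K" using K r by (auto simp: comps_iff)
  have "closed_in r {b \<in> V. y b \<le> y a} K"
    using K' y True by (fastforce simp: closed_in_def)
  then have "component r {b \<in> V. y b \<le> y a} a = K"
    using conn_component[OF r K'(1)] True T by blast
  then show ?thesis using True a by (simp add: nest_def)
next
  case False
  let ?L = "{b \<in> V. y b \<le> y a}"
  have L: "{b \<in> V - T. y b \<le> y a} = ?L - T" by auto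
  have "component r ?L a = component r (?L - T) a"
  proof (cases "a \<in> K")
    case True
    then have "?L - T = ?L" using y False by fastforce
    then show ?thesis by simp
  next
    case nK: False
    have "closed_in r V K" using K r by (auto simp: comps_iff)
    then have "closed_in r ?L (?L - K)" "closed_in r (?L - T) (?L - K)"
      using T r by (auto simp: closed_in_def dest: sympD)
    note cl = this
    have "a \<in> ?L - K" using nK a by simp
    from component_closed[OF cl(1) this] component_closed[OF cl(2) this] show ?thesis by simp
  qed
  then show ?thesis using False a L by (simp add: nest_def)
qed

text \<open>
  A direction \<open>y\<close> amounts to the set \<open>T\<close> where it is largest on \<open>K\<close> and a direction on the remaining
  vertices. The vertices of \<open>T\<close> share the single tube \<open>K\<close>, which explains the exponent \<open>card T - 1\<close>.
\<close>

lemma fpoly_component: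
  assumes r: "symp r" and fin: "finite V" and K: "K \<in> comps r V"
  shows "fpoly r V = (\<Sum>T\<in>Pow K - {{}}. monom 1 (card T - 1) * fpoly r (V - T))"
proof -
  have KV: "K \<subseteq> V" "K \<noteq> {}" by (rule comps_subset[OF K], rule comps_nonempty[OF K])
  have finK: "finite K" using KV fin finite_subset by blast
  define top where "top N = {a \<in> K. N a = K}" for N :: "'a \<Rightarrow> 'a set"
  define low where "low N = (\<lambda>a. if a \<in> V - top N then N a else {})" for N :: "'a \<Rightarrow> 'a set"
  define glue where "glue = (\<lambda>(T, N). \<lambda>a. if a \<in> T then K else (N :: 'a \<Rightarrow> 'a set) a)"
  have topI: "top (nest r V y) = T" "low (nest r V y) = nest r (V - T) y"
      "nest r V y = glue (T, nest r (V - T) y)"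
    if T: "T \<subseteq> K" "T \<noteq> {}" and y: "\<And>a. a \<in> T \<Longrightarrow> y a = M" "\<And>a. a \<in> K - T \<Longrightarrow> y a < M" for T y M
  proof -
    have nt: "nest r V y a = (if a \<in> T then K else nest r (V - T) y a)" if "a \<in> V" for a
      using nest_top[OF r K T, of y M a] y that by blast
    have nK: "nest r (V - T) y a \<noteq> K" for a using nest_subset[of r "V - T" y a] T by blast
    have "a \<in> K \<and> nest r V y a = K \<longleftrightarrow> a \<in> T" for a
      using nt nK T(1) KV(1) by (metis subsetD)
    then show t: "top (nest r V y) = T"
      unfolding top_def by blast
    show "low (nest r V y) = nest r (V - T) y"
      unfolding low_def t
    proof
      fix a show "(if a \<in> V - T then nest r V y a else {}) = nest r (V - T) y a"
        using nt[of a] by (cases "a \<in> V - T") (auto simp: nest_def[of r "V - T"])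
    qed
    show "nest r V y = glue (T, nest r (V - T) y)"
    proof
      fix a show "nest r V y a = glue (T, nest r (V - T) y) a"
        using nt[of a] T KV by (cases "a \<in> V") (auto simp: glue_def nest_def)
    qed
  qed
  have A: "\<exists>T. T \<subseteq> K \<and> T \<noteq> {} \<and> top (nest r V y) = T \<and> low (nest r V y) = nest r (V - T) y \<and>
      nest r V y = glue (T, nest r (V - T) y)" for y
  proof -
    let ?T = "{a \<in> K. y a = Max (y ` K)}"
    have "Max (y ` K) \<in> y ` K" using finK KV by (intro Max_in) auto
    then have "?T \<noteq> {}" by auto
    moreover have "y a < Max (y ` K)" if "a \<in> K - ?T" for a
    proof -
      have "y a \<le> Max (y ` K)" using that finK by auto
      then show ?thesis using that by auto
    qed
    ultimately show ?thesis using topI[of ?T y "Max (y ` K)"] by blast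
  qed
  have B: "\<exists>y. nest r (V - T) z = nest r (V - T) y \<and> top (nest r V y) = T \<and>
      low (nest r V y) = nest r (V - T) y \<and> nest r V y = glue (T, nest r (V - T) y)"
    if T: "T \<subseteq> K" "T \<noteq> {}" for T z
  proof -
    \<comment> \<open>raising \<open>z\<close> on \<open>T\<close> above all its values makes \<open>T\<close> the place of the maximum\<close>
    define M where "M = Max (z ` V) + 1"
    define y where "y a = (if a \<in> T then M else z a)" for a
    have "y a < M" if "a \<in> K - T" for a
    proof -
      have "z a \<le> Max (z ` V)" using that fin KV by (intro Max_ge) auto
      then show ?thesis using that by (simp add: y_def M_def)
    qed
    then have *: "top (nest r V y) = T" "low (nest r V y) = nest r (V - T) y"
      "nest r V y = glue (T, nest r (V - T) y)" by (intro topI[OF T, of y M]; simp add: y_def)+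
    have "{b \<in> V - T. z b \<le> z a} = {b \<in> V - T. y b \<le> y a}" if "a \<in> V - T" for a
      using that by (auto simp: y_def)
    then have "nest r (V - T) z = nest r (V - T) y"
      by (auto simp: fun_eq_iff nest_def simp del: Diff_iff)
    with * show ?thesis by blast
  qed
  have weight: "monom (1::int) (card T - 1) * monom 1 (card (V - T) - card (N ` (V - T))) =
      monom 1 (card V - card (glue (T, N) ` V))"
    if T: "T \<subseteq> K" "T \<noteq> {}" and N: "N = nest r (V - T) y" for T N y
  proof -
    have "V = T \<union> (V - T)" using T KV by auto
    then have "glue (T, N) ` V = glue (T, N) ` T \<union> glue (T, N) ` (V - T)" by blast
    also have "glue (T, N) ` T = {K}" using T by (auto simp: glue_def)
    also have "glue (T, N) ` (V - T) = N ` (V - T)" by (auto simp: glue_def)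
    finally have im: "glue (T, N) ` V = insert K (N ` (V - T))" by simp
    have "K \<notin> N ` (V - T)"
      using T N nest_subset[of r "V - T" y] by blast
    then have c: "card (glue (T, N) ` V) = Suc (card (N ` (V - T)))"
      unfolding im using fin by simp
    have "card V = card T + card (V - T)"
      using T KV fin by (metis card_Diff_subset card_mono finite_subset le_add_diff_inverse subset_trans)
    moreover have "card (N ` (V - T)) \<le> card (V - T)" using fin by (intro card_image_le) auto
    moreover have "card T \<ge> 1" using T finK by (metis One_nat_def Suc_leI card_gt_0_iff finite_subset)
    ultimately show ?thesis unfolding c mult_monom by simp
  qed
  have "(\<Sum>T\<in>Pow K - {{}}. monom 1 (card T - 1) * fpoly r (V - T)) =
    (\<Sum>T\<in>Pow K - {{}}. \<Sum>N\<in>range (nest r (V - T)).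
       monom 1 (card T - 1) * monom 1 (card (V - T) - card (N ` (V - T))))"
    by (simp add: fpoly_def sum_distrib_left)
  also have "\<dots> = (\<Sum>(T, N)\<in>Sigma (Pow K - {{}}) (\<lambda>T. range (nest r (V - T))).
       monom 1 (card T - 1) * monom 1 (card (V - T) - card (N ` (V - T))))"
    using finK fin by (intro sum.Sigma) (auto intro: finite_nests)
  also have "\<dots> = fpoly r V" unfolding fpoly_def
  proof (rule sum.reindex_bij_witness[where i = "\<lambda>N. (top N, low N)" and j = glue])
    fix p assume "p \<in> Sigma (Pow K - {{}}) (\<lambda>T. range (nest r (V - T)))"
    then obtain T z where p: "p = (T, nest r (V - T) z)" and T: "T \<subseteq> K" "T \<noteq> {}" by auto
    obtain y where y: "nest r (V - T) z = nest r (V - T) y" "top (nest r V y) = T"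
      "low (nest r V y) = nest r (V - T) y" "nest r V y = glue (T, nest r (V - T) y)"
      using B[OF T] by blast
    show "(top (glue p), low (glue p)) = p" "glue p \<in> range (nest r V)"
      using y p by (metis rangeI)+
    show "monom 1 (card V - card (glue p ` V)) =
         (case p of (T, N) \<Rightarrow> monom (1::int) (card T - 1) * monom 1 (card (V - T) - card (N ` (V - T))))"
      using weight[OF T] p by simp
  next
    fix N assume "N \<in> range (nest r V)"
    then obtain y where N: "N = nest r V y" by auto
    show "glue (top N, low N) = N"
      "(top N, low N) \<in> (SIGMA T:Pow K - {{}}. range (nest r (V - T)))"
      using A[of y] N by auto
  qed
  finally show ?thesis by simp
qed

lemma fpoly_empty [simp]: "fpoly r {} = 1"
proof -
  have "range (nest r {}) = {\<lambda>_. {}}" by (auto simp: nest_def fun_eq_iff image_def)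
  then show ?thesis by (simp add: fpoly_def)
qed

lemma conn_cong:
  assumes "\<And>x y. x \<in> V \<Longrightarrow> y \<in> V \<Longrightarrow> x \<noteq> y \<Longrightarrow> r x y \<longleftrightarrow> r' x y" "I \<subseteq> V"
  shows "conn r I \<longleftrightarrow> conn r' I"
proof -
  have "reach r I = reach r' I" using assms by (intro reach_cong) auto
  then show ?thesis by (simp add: conn_def)
qed

lemma component_cong:
  assumes "\<And>x y. x \<in> V \<Longrightarrow> y \<in> V \<Longrightarrow> x \<noteq> y \<Longrightarrow> r x y \<longleftrightarrow> r' x y" "I \<subseteq> V"
  shows "component r I = component r' I"
proof -
  have "reach r I = reach r' I" using assms by (intro reach_cong) auto
  then show ?thesis by (auto simp: component_def)
qed

lemma comps_cong:
  assumes "\<And>x y. x \<in> V \<Longrightarrow> y \<in> V \<Longrightarrow> x \<noteq> y \<Longrightarrow> r x y \<longleftrightarrow> r' x y"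
  shows "comps r V = comps r' V"
proof -
  have "component r V = component r' V" by (rule component_cong[OF _ subset_refl]) (rule assms)
  then show ?thesis by (simp add: comps_def)
qed

lemma fpoly_cong:
  assumes "\<And>x y. x \<in> V \<Longrightarrow> y \<in> V \<Longrightarrow> x \<noteq> y \<Longrightarrow> r x y \<longleftrightarrow> r' x y"
  shows "fpoly r V = fpoly r' V"
proof -
  have "component r I = component r' I" if "I \<subseteq> V" for I
    by (rule component_cong[OF _ that]) (rule assms)
  then have "nest r V = nest r' V" by (intro ext) (simp add: nest_def)
  then show ?thesis by (simp add: fpoly_def)
qed

abbreviation xp :: "nat \<Rightarrow> int poly" where "xp k \<equiv> monom 1 k"

lemma fpoly_component_sum:
  assumes r: "symp r" and fin: "finite V" and K: "K \<in> comps r V"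
  shows "(\<Sum>T\<in>Pow K. xp (card T) * fpoly r (V - T)) = [:1, 1:] * fpoly r V"
proof -
  have "finite K" using comps_subset[OF K] fin finite_subset by blast
  have "(\<Sum>T\<in>Pow K. xp (card T) * fpoly r (V - T)) =
      fpoly r V + (\<Sum>T\<in>Pow K - {{}}. xp (card T) * fpoly r (V - T))"
    using \<open>finite K\<close> by (subst sum.remove[of _ "{}"]) auto
  also have "(\<Sum>T\<in>Pow K - {{}}. xp (card T) * fpoly r (V - T)) =
      (\<Sum>T\<in>Pow K - {{}}. xp 1 * (xp (card T - 1) * fpoly r (V - T)))"
  proof (rule sum.cong[OF refl])
    fix T assume "T \<in> Pow K - {{}}"
    then have "card T \<ge> 1" using \<open>finite K\<close> by (metis DiffE One_nat_def PowD Suc_leI card_gt_0_iff finite_subset singletonI)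
    then have "xp (card T) = xp 1 * xp (card T - 1)" by (simp add: mult_monom)
    then show "xp (card T) * fpoly r (V - T) = xp 1 * (xp (card T - 1) * fpoly r (V - T))"
      by (simp only: mult.assoc)
  qed
  also have "\<dots> = xp 1 * fpoly r V"
    by (subst fpoly_component[OF assms], subst sum_distrib_left) simp
  also have "fpoly r V + xp 1 * fpoly r V = (1 + xp 1) * fpoly r V" by (simp add: algebra_simps)
  also have "1 + xp 1 = [:1, 1:]" by (simp add: monom_altdef one_pCons)
  finally show ?thesis .
qed

text \<open>
  A subset of \<open>\<Union>\<K>\<close> is a choice of one subset in each member of \<open>\<K>\<close>, and each member contributes a factor
  \<open>1 + t\<close>: the term \<open>1\<close> is the empty choice, and \<open>t\<close> comes from the recursion along that component.
\<close>

lemma fpoly_comps_sum: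
  assumes r: "symp r" and fin: "finite V" and "finite \<K>" "\<K> \<subseteq> comps r V"
  shows "(\<Sum>T\<in>Pow (\<Union>\<K>). xp (card T) * fpoly r (V - T)) = [:1, 1:] ^ card \<K> * fpoly r V"
  using assms(3,4)
proof (induction rule: finite_induct)
  case (insert K \<K>)
  let ?U = "\<Union>\<K>"
  have K: "K \<in> comps r V" using insert by simp
  have dj: "K \<inter> ?U = {}"
  proof (rule ccontr)
    assume "K \<inter> ?U \<noteq> {}"
    then obtain a K' where "a \<in> K" "a \<in> K'" "K' \<in> \<K>" by auto
    then have "K = K'" using comps_eqI[OF r K, of K' a] insert.prems by auto
    then show False using \<open>K' \<in> \<K>\<close> insert.hyps by simp
  qed
  have fins: "finite K" "finite ?U"
    using fin insert.prems comps_subset finite_subset K by (metis, metis Union_comps Union_mono insert_subset)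
  have "(\<Sum>T\<in>Pow (\<Union>(insert K \<K>)). xp (card T) * fpoly r (V - T)) =
     (\<Sum>(A, B)\<in>Pow ?U \<times> Pow K. xp (card A) * (xp (card B) * fpoly r ((V - A) - B)))"
  proof (rule sum.reindex_bij_witness[where i = "\<lambda>(A, B). A \<union> B" and j = "\<lambda>T. (T \<inter> ?U, T \<inter> K)"])
    fix T assume T: "T \<in> Pow (\<Union>(insert K \<K>))"
    then have eq: "T = (T \<inter> ?U) \<union> (T \<inter> K)" by auto
    then show "(case (T \<inter> ?U, T \<inter> K) of (A, B) \<Rightarrow> A \<union> B) = T" by simp
    have "card T = card (T \<inter> ?U) + card (T \<inter> K)"
      by (subst eq, rule card_Un_disjoint) (use fins dj in auto)
    moreover have "V - T = V - (T \<inter> ?U) - (T \<inter> K)" using eq by blast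
    ultimately show "(case (T \<inter> ?U, T \<inter> K) of (A, B) \<Rightarrow> xp (card A) * (xp (card B) * fpoly r (V - A - B))) =
         xp (card T) * fpoly r (V - T)"
      by (simp only: prod.case mult.assoc[symmetric] mult_monom mult_1)
  qed (use dj in auto)
  also have "\<dots> = (\<Sum>A\<in>Pow ?U. \<Sum>B\<in>Pow K. xp (card A) * (xp (card B) * fpoly r ((V - A) - B)))"
    by (rule sum.cartesian_product[symmetric])
  also have "\<dots> = (\<Sum>A\<in>Pow ?U. xp (card A) * ([:1, 1:] * fpoly r (V - A)))"
  proof (rule sum.cong[OF refl])
    fix A assume "A \<in> Pow ?U"
    then have "K \<in> comps r (V - A)" using dj K r by (intro comps_Diff) auto
    then have "(\<Sum>B\<in>Pow K. xp (card B) * fpoly r ((V - A) - B)) = [:1, 1:] * fpoly r (V - A)"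
      using fin by (intro fpoly_component_sum[OF r]) auto
    then show "(\<Sum>B\<in>Pow K. xp (card A) * (xp (card B) * fpoly r ((V - A) - B))) =
        xp (card A) * ([:1, 1:] * fpoly r (V - A))"
      by (simp only: sum_distrib_left[symmetric])
  qed
  also have "\<dots> = [:1, 1:] * (\<Sum>A\<in>Pow ?U. xp (card A) * fpoly r (V - A))"
    by (simp only: sum_distrib_left mult.left_commute)
  also have "\<dots> = [:1, 1:] ^ card (insert K \<K>) * fpoly r V"
    using insert.IH insert.prems insert.hyps
    by (simp only: card_insert_disjoint[OF insert.hyps] power_Suc mult.assoc insert_subset simp_thms)
  finally show ?case .
qed simp

lemma fpoly_Pow_sum:
  assumes r: "symp r" and fin: "finite V"
  shows "(\<Sum>T\<in>Pow V. xp (card T) * fpoly r (V - T)) = [:1, 1:] ^ card (comps r V) * fpoly r V"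
  using fpoly_comps_sum[OF r fin finite_comps[OF fin] subset_refl] by (simp only: Union_comps)

lemma fpoly_nonempty_sum:
  assumes r: "symp r" and fin: "finite V"
  shows "(\<Sum>T\<in>Pow V - {{}}. xp (card T) * fpoly r (V - T)) = ([:1, 1:] ^ card (comps r V) - 1) * fpoly r V"
proof -
  have "(\<Sum>T\<in>Pow V. xp (card T) * fpoly r (V - T)) =
      fpoly r V + (\<Sum>T\<in>Pow V - {{}}. xp (card T) * fpoly r (V - T))"
    using \<open>finite V\<close> by (subst sum.remove[of _ "{}"]) auto
  then show ?thesis using fpoly_Pow_sum[OF assms] by (simp add: algebra_simps)
qed

lemma comps_Un_left:
  assumes "symp r" "K \<in> comps r A" "\<And>a b. a \<in> A \<Longrightarrow> b \<in> B \<Longrightarrow> \<not> r a b"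
  shows "K \<in> comps r (A \<union> B)"
  using assms by (auto simp: comps_iff closed_in_def)

text \<open>
  The recursion along a component of \<open>A\<close> never touches \<open>B\<close>.
\<close>

lemma fpoly_Un:
  assumes r: "symp r" and "finite A" "finite B" "A \<inter> B = {}" "\<And>a b. a \<in> A \<Longrightarrow> b \<in> B \<Longrightarrow> \<not> r a b"
  shows "fpoly r (A \<union> B) = fpoly r A * fpoly r B"
  using assms(2,4,5)
proof (induction "card A" arbitrary: A rule: less_induct)
  case less
  show ?case
  proof (cases "A = {}")
    case False
    then obtain K where K: "K \<in> comps r A" using Union_comps[of r A] by blast
    note KA = comps_subset[OF K]
    have "fpoly r (A \<union> B) = (\<Sum>T\<in>Pow K - {{}}. xp (card T - 1) * fpoly r (A \<union> B - T))"
      using comps_Un_left[OF r K] less.prems assms(3) by (intro fpoly_component[OF r]) auto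
    also have "\<dots> = (\<Sum>T\<in>Pow K - {{}}. xp (card T - 1) * (fpoly r (A - T) * fpoly r B))"
    proof (rule sum.cong[OF refl])
      fix T assume T: "T \<in> Pow K - {{}}"
      then have "A \<union> B - T = (A - T) \<union> B" using KA less.prems by auto
      moreover have "card (A - T) < card A"
        using T KA less.prems by (intro psubset_card_mono) auto
      ultimately show "xp (card T - 1) * fpoly r (A \<union> B - T) = xp (card T - 1) * (fpoly r (A - T) * fpoly r B)"
        using less.hyps[of "A - T"] less.prems by auto
    qed
    also have "\<dots> = fpoly r A * fpoly r B"
      using fpoly_component[OF r \<open>finite A\<close> K] by (simp add: sum_distrib_right mult.assoc)
    finally show ?thesis .
  qed simp
qed

text \<open>
  Distinctness of \<open>x\<close> and \<open>y\<close> is what allows loops on one side only.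
\<close>

definition embeds :: "('a \<Rightarrow> 'a \<Rightarrow> bool) \<Rightarrow> 'a set \<Rightarrow> ('b \<Rightarrow> 'b \<Rightarrow> bool) \<Rightarrow> ('a \<Rightarrow> 'b) \<Rightarrow> bool" where
  "embeds r V r' \<phi> \<longleftrightarrow> inj_on \<phi> V \<and> (\<forall>x\<in>V. \<forall>y\<in>V. x \<noteq> y \<longrightarrow> (r' (\<phi> x) (\<phi> y) \<longleftrightarrow> r x y))"

lemma embeds_subset: "embeds r V r' \<phi> \<Longrightarrow> W \<subseteq> V \<Longrightarrow> embeds r W r' \<phi>"
  unfolding embeds_def by (meson inj_on_subset subsetD)

lemma reach_image:
  assumes "\<And>x y. x \<in> V \<Longrightarrow> y \<in> V \<Longrightarrow> x \<noteq> y \<Longrightarrow> r x y \<Longrightarrow> r' (\<phi> x) (\<phi> y)" "reach r V a b"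
  shows "reach r' (\<phi> ` V) (\<phi> a) (\<phi> b)"
  using assms(2)
proof (induction rule: reach_induct)
  case (step x y)
  then show ?case using assms(1)[of x y] by (cases "x = y") (auto intro: reach_step)
qed simp

lemma conn_image:
  assumes "embeds r V r' \<phi>" "I \<subseteq> V"
  shows "conn r' (\<phi> ` I) \<longleftrightarrow> conn r I"
proof
  assume "conn r I"
  then show "conn r' (\<phi> ` I)"
    unfolding conn_def using assms by (auto intro!: reach_image[of I r r' \<phi>] simp: embeds_def subset_iff)
next
  assume c: "conn r' (\<phi> ` I)"
  have inj: "inj_on \<phi> I" and e: "\<And>x y. x \<in> I \<Longrightarrow> y \<in> I \<Longrightarrow> x \<noteq> y \<Longrightarrow> r' (\<phi> x) (\<phi> y) \<longleftrightarrow> r x y"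
    using embeds_subset[OF assms] by (auto simp: embeds_def)
  let ?\<psi> = "the_inv_into I \<phi>"
  have \<psi>: "?\<psi> (\<phi> x) = x" if "x \<in> I" for x using that inj by (simp add: the_inv_into_f_f)
  have im: "?\<psi> ` \<phi> ` I = I" using \<psi> by (auto simp: image_image)
  have "reach r I a b" if "a \<in> I" "b \<in> I" for a b
  proof -
    have "reach r' (\<phi> ` I) (\<phi> a) (\<phi> b)" using c that by (auto simp: conn_def)
    then have "reach r (?\<psi> ` \<phi> ` I) (?\<psi> (\<phi> a)) (?\<psi> (\<phi> b))"
      by (rule reach_image[rotated]) (use e \<psi> in force)
    then show ?thesis using that \<psi> im by simp
  qed
  then show "conn r I" using c by (auto simp: conn_def)
qed

lemma comps_image:
  assumes "symp r" "symp r'" "embeds r V r' \<phi>"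
  shows "comps r' (\<phi> ` V) = (`) \<phi> ` comps r V"
proof -
  have *: "\<phi> ` K \<in> comps r' (\<phi> ` V) \<longleftrightarrow> K \<in> comps r V" if K: "K \<subseteq> V" for K
  proof -
    have "conn r' (\<phi> ` K) \<longleftrightarrow> conn r K" by (rule conn_image[OF assms(3) K])
    moreover have "closed_in r' (\<phi> ` V) (\<phi> ` K) \<longleftrightarrow> closed_in r V K"
    proof -
      have "(r' (\<phi> x) (\<phi> y) \<longrightarrow> \<phi> y \<in> \<phi> ` K) \<longleftrightarrow> (r x y \<longrightarrow> y \<in> K)" if "x \<in> K" "y \<in> V" for x y
      proof -
        have "\<phi> y \<in> \<phi> ` K \<longleftrightarrow> y \<in> K"
          using assms(3) that K by (intro inj_on_image_mem_iff[of _ V]) (auto simp: embeds_def)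
        then show ?thesis using that K assms(3) by (cases "x = y") (auto simp: embeds_def)
      qed
      then show ?thesis using K by (auto simp: closed_in_def)
    qed
    ultimately show ?thesis using assms(1,2) by (simp add: comps_iff)
  qed
  show ?thesis
  proof (intro equalityI subsetI)
    fix K' assume K': "K' \<in> comps r' (\<phi> ` V)"
    then obtain K where "K \<subseteq> V" "K' = \<phi> ` K" using comps_subset subset_imageE by metis
    then show "K' \<in> (`) \<phi> ` comps r V" using * K' by auto
  qed (use * comps_subset in blast)
qed

lemma card_comps_image:
  assumes "symp r" "symp r'" "embeds r V r' \<phi>"
  shows "card (comps r' (\<phi> ` V)) = card (comps r V)"
proof -
  have "comps r V \<subseteq> Pow V" using comps_subset by blast
  then have "inj_on ((`) \<phi>) (comps r V)"
    using assms(3) by (intro inj_on_subset[OF inj_on_image_Pow[of \<phi> V]]) (auto simp: embeds_def)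
  then show ?thesis by (simp only: comps_image[OF assms] card_image)
qed

text \<open>
  The recursion along a component is invariant under relabelling.
\<close>

lemma fpoly_image:
  assumes r: "symp r" and r': "symp r'" and "finite V" "embeds r V r' \<phi>"
  shows "fpoly r' (\<phi> ` V) = fpoly r V"
  using assms(3,4)
proof (induction "card V" arbitrary: V rule: less_induct)
  case less
  show ?case
  proof (cases "V = {}")
    case False
    then obtain K where K: "K \<in> comps r V" using Union_comps[of r V] by blast
    have K': "\<phi> ` K \<in> comps r' (\<phi> ` V)"
      using comps_image[OF r r' less.prems(2)] K by blast
    note KV = comps_subset[OF K]
    have injV: "inj_on \<phi> V" and inj: "inj_on \<phi> K"
      using less.prems(2) embeds_subset[OF less.prems(2) KV] by (auto simp: embeds_def)
    have "fpoly r' (\<phi> ` V) = (\<Sum>T\<in>Pow (\<phi> ` K) - {{}}. xp (card T - 1) * fpoly r' (\<phi> ` V - T))"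
      using less.prems K' by (intro fpoly_component[OF r']) auto
    also have "Pow (\<phi> ` K) - {{}} = (`) \<phi> ` (Pow K - {{}})"
      using image_Pow_surj[OF refl, of \<phi> K]
      by (subst inj_on_image_set_diff[OF inj_on_image_Pow[OF inj]]) auto
    also have "(\<Sum>T\<in>(`) \<phi> ` (Pow K - {{}}). xp (card T - 1) * fpoly r' (\<phi> ` V - T)) =
        (\<Sum>T\<in>Pow K - {{}}. xp (card T - 1) * fpoly r (V - T))"
    proof (subst sum.reindex, goal_cases)
      case 1 show ?case by (intro inj_on_subset[OF inj_on_image_Pow[OF inj]]) auto
    next
      case 2
      show ?case
      proof (rule sum.cong[OF refl], simp only: o_def)
        fix T assume T: "T \<in> Pow K - {{}}"
        then have TV: "T \<subseteq> V" "T \<noteq> {}" using KV by auto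
        have "card (\<phi> ` T) = card T"
          using inj_on_subset[OF injV TV(1)] by (rule card_image)
        moreover have "\<phi> ` V - \<phi> ` T = \<phi> ` (V - T)"
          using inj_on_image_set_diff[OF injV, of V T] TV by simp
        moreover have "fpoly r' (\<phi> ` (V - T)) = fpoly r (V - T)"
        proof (rule less.hyps)
          show "card (V - T) < card V" using TV less.prems(1) by (intro psubset_card_mono) auto
          show "embeds r (V - T) r' \<phi>" by (rule embeds_subset[OF less.prems(2)]) auto
        qed (use less.prems in auto)
        ultimately show "xp (card (\<phi> ` T) - 1) * fpoly r' (\<phi> ` V - \<phi> ` T) = xp (card T - 1) * fpoly r (V - T)"
          by simp
      qed
    qed
    also have "\<dots> = fpoly r V" using less.prems by (intro fpoly_component[OF r, symmetric] K)
    finally show ?thesis .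
  qed simp
qed

section \<open>Deleting an edge and contracting a set\<close>

definition del_edge :: "('a \<Rightarrow> 'a \<Rightarrow> bool) \<Rightarrow> 'a \<Rightarrow> 'a \<Rightarrow> 'a \<Rightarrow> 'a \<Rightarrow> bool" where
  "del_edge r a b = (\<lambda>x y. r x y \<and> {x, y} \<noteq> {a, b})"

text \<open>
  This is the reconnected complement of \<open>I\<close>. The vertices of \<open>I\<close> are not removed by the relation itself;
  that is left to the vertex set, so that the same relation serves every subset of the complement.
\<close>

definition reconnect :: "('a \<Rightarrow> 'a \<Rightarrow> bool) \<Rightarrow> 'a set \<Rightarrow> 'a \<Rightarrow> 'a \<Rightarrow> bool" where
  "reconnect r I = (\<lambda>u v. r u v \<or> ((\<exists>i\<in>I. r u i) \<and> (\<exists>j\<in>I. r v j)))"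

text \<open>
  The sets that are connected only thanks to the edge \<open>{a, b}\<close>.
\<close>

definition splits :: "('a \<Rightarrow> 'a \<Rightarrow> bool) \<Rightarrow> 'a \<Rightarrow> 'a \<Rightarrow> 'a set \<Rightarrow> 'a set set" where
  "splits r a b V = {I. I \<subseteq> V \<and> a \<in> I \<and> b \<in> I \<and> conn r I \<and> \<not> conn (del_edge r a b) I}"

lemma symp_del_edge: "symp r \<Longrightarrow> symp (del_edge r a b)"
  by (auto simp: symp_def del_edge_def insert_commute)

lemma symp_reconnect: "symp r \<Longrightarrow> symp (reconnect r I)"
  by (auto simp: symp_def reconnect_def)

lemma finite_splits: "finite V \<Longrightarrow> finite (splits r a b V)"
  by (rule finite_subset[of _ "Pow V"]) (auto simp: splits_def)

lemma comps_closed_split: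
  assumes "symp r" "closed_in r V K"
  shows "comps r V = comps r K \<union> comps r (V - K)" "comps r K \<inter> comps r (V - K) = {}"
proof -
  have KV: "K \<subseteq> V" using assms by (auto simp: closed_in_def)
  note cl = closed_Diff[OF assms]
  have sym: "r x y \<longleftrightarrow> r y x" for x y using assms by (auto simp: symp_def)
  show "comps r V = comps r K \<union> comps r (V - K)"
  proof (intro equalityI subsetI)
    fix K' assume K': "K' \<in> comps r V"
    then have "conn r K'" "closed_in r V K'" using assms(1) by (auto simp: comps_iff)
    then obtain a where a: "a \<in> K'" "a \<in> V" by (auto simp: conn_def closed_in_def)
    have "K' \<subseteq> K \<or> K' \<subseteq> V - K"
      using conn_subset_closed[OF \<open>conn r K'\<close> comps_subset[OF K'] assms(2) a(1)]
        conn_subset_closed[OF \<open>conn r K'\<close> comps_subset[OF K'] cl a(1)] a by blast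
    then have "closed_in r K K' \<or> closed_in r (V - K) K'"
      using \<open>closed_in r V K'\<close> KV unfolding closed_in_def by blast
    then show "K' \<in> comps r K \<union> comps r (V - K)"
      using \<open>conn r K'\<close> assms(1) by (auto simp: comps_iff)
  next
    fix K' assume "K' \<in> comps r K \<union> comps r (V - K)"
    then have "conn r K'" "closed_in r K K' \<or> closed_in r (V - K) K'"
      using assms(1) by (auto simp: comps_iff)
    moreover from this have "closed_in r V K'"
      using assms(2) cl unfolding closed_in_def by blast
    ultimately show "K' \<in> comps r V" using assms(1) by (simp add: comps_iff)
  qed
  have False if "K' \<in> comps r K" "K' \<in> comps r (V - K)" for K'
    using comps_subset[OF that(1)] comps_subset[OF that(2)] comps_nonempty[OF that(1)] by blast
  then show "comps r K \<inter> comps r (V - K) = {}" by blast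
qed

lemma card_comps_closed_split:
  assumes "symp r" "closed_in r V K" "finite V"
  shows "card (comps r V) = card (comps r K) + card (comps r (V - K))"
proof -
  have "finite K" using assms by (auto simp: closed_in_def intro: finite_subset)
  then show ?thesis unfolding comps_closed_split(1)[OF assms(1,2)]
    using comps_closed_split(2)[OF assms(1,2)] assms(3) by (intro card_Un_disjoint finite_comps) auto
qed

lemma card_comps_conn: "symp r \<Longrightarrow> conn r V \<Longrightarrow> card (comps r V) = 1"
  by (simp add: conn_comps)

text \<open>
  Following a path from \<open>a\<close> to \<open>x\<close> after its last use of the edge \<open>{a, b}\<close> shows that \<open>x\<close> can be reached from
  \<open>a\<close> or from \<open>b\<close> without that edge.
\<close>

lemma card_comps_split:
  assumes r: "symp r" and I: "I \<in> splits r a b V"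
  shows "card (comps (del_edge r a b) I) = 2"
proof -
  let ?r = "del_edge r a b"
  have ab: "a \<in> I" "b \<in> I" "conn r I" "\<not> conn ?r I" using I by (auto simp: splits_def)
  note r' = symp_del_edge[OF r, of a b]
  have ex: "reach ?r I a x \<or> reach ?r I b x" if "x \<in> I" for x
  proof -
    have "reach r I a x" using ab that by (auto simp: conn_def)
    then show ?thesis
    proof (induction rule: reach_induct)
      case (step x y)
      show ?case
      proof (cases "{x, y} = {a, b}")
        case True then show ?thesis by (auto simp: doubleton_eq_iff)
      next
        case False
        then have "reach ?r I x y" using step by (intro reach_edge) (auto simp: del_edge_def)
        from reach_trans[OF _ this] show ?thesis using step.IH by blast
      qed
    qed simp
  qed
  have "comps ?r I = {component ?r I a, component ?r I b}"
  proof (intro equalityI subsetI)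
    fix K assume K: "K \<in> comps ?r I"
    then obtain x where x: "x \<in> I" "K = component ?r I x" by (auto simp: comps_def)
    have "K = component ?r I c" if "reach ?r I c x" "c \<in> I" for c
      unfolding x(2) component_def using reach_trans[OF that(1)] reach_trans[OF reach_sym[OF r' that(1)]] by blast
    from ex[OF x(1)] this[of a] this[of b] ab(1,2)
    show "K \<in> {component ?r I a, component ?r I b}" by auto
  qed (use ab in \<open>auto simp: comps_def\<close>)
  moreover have "component ?r I a \<noteq> component ?r I b"
  proof
    assume eq: "component ?r I a = component ?r I b"
    then have "reach ?r I a x" if "x \<in> I" for x
      using ex[OF that] that by (auto simp: component_def set_eq_iff)
    then have "conn ?r I" using ab reach_trans[OF reach_sym[OF r'], of I a] by (auto simp: conn_def)
    then show False using ab by simp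
  qed
  ultimately show ?thesis by simp
qed

lemma closed_del_edge: "closed_in r V K \<Longrightarrow> closed_in (del_edge r a b) V K"
  by (auto simp: closed_in_def del_edge_def)

lemma component_self: "a \<in> V \<Longrightarrow> a \<in> component r V a"
  by (simp add: component_def)

lemma comps_del_edge_outside:
  assumes "a \<in> K \<or> b \<in> K"
  shows "comps (del_edge r a b) (V - K) = comps r (V - K)" "fpoly (del_edge r a b) (V - K) = fpoly r (V - K)"
  using assms by (auto intro!: comps_cong fpoly_cong simp: del_edge_def doubleton_eq_iff)

text \<open>
  Only the component of \<open>a\<close> can change, and it either stays connected or falls into two parts.
\<close>

lemma card_comps_del_edge:
  assumes r: "symp r" and "finite V" "a \<in> V" "b \<in> V" "r a b" and K: "K = component r V a"
  shows "card (comps (del_edge r a b) V) = card (comps r V) + (if K \<in> splits r a b V then 1 else 0)"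
proof -
  have cl: "closed_in r V K" unfolding K by (rule closed_component)
  have a: "a \<in> K" using assms(3) K by (simp add: component_def)
  have b: "b \<in> K" using assms K by (auto simp: component_def intro: reach_edge)
  have cK: "conn r K" unfolding K by (rule conn_component_self[OF r assms(3)])
  have "card (comps (del_edge r a b) K) = 1 + (if K \<in> splits r a b V then 1 else 0)"
  proof (cases "conn (del_edge r a b) K")
    case True
    then show ?thesis using card_comps_conn[OF symp_del_edge[OF r] True] by (simp add: splits_def)
  next
    case False
    then have K: "K \<in> splits r a b V" using a b cK cl by (simp add: splits_def closed_in_def)
    then show ?thesis using card_comps_split[OF r K] by simp
  qed
  then show ?thesis
    using card_comps_closed_split[OF r cl \<open>finite V\<close>]
      card_comps_closed_split[OF symp_del_edge[OF r] closed_del_edge[OF cl] \<open>finite V\<close>, of a b]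
      card_comps_conn[OF r cK] comps_del_edge_outside(1)[of a K b r V] a
    by simp
qed

text \<open>
  A path through \<open>I\<close> enters and leaves \<open>I\<close> at neighbours of \<open>I\<close>, which are adjacent in the reconnected
  complement; conversely a new edge can be replaced by a detour through the connected set \<open>I\<close>.
\<close>

lemma reach_reconnect:
  assumes r: "symp r" and I: "conn r I" "I \<subseteq> V" and xy: "x \<in> V - I" "y \<in> V - I"
  shows "reach (reconnect r I) (V - I) x y \<longleftrightarrow> reach r V x y"
proof
  assume "reach (reconnect r I) (V - I) x y"
  then show "reach r V x y"
  proof (induction rule: reach_induct)
    case (step u v)
    have "reach r V u v"
    proof (cases "r u v")
      case True then show ?thesis using step by (intro reach_edge) auto
    next
      case False
      then obtain i j where ij: "i \<in> I" "j \<in> I" "r u i" "r v j"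
        using step by (auto simp: reconnect_def)
      have "reach r V u i" "reach r V v j" using ij step I by (auto intro!: reach_edge)
      moreover have "reach r I i j" using I ij by (auto simp: conn_def)
      then have "reach r V i j" by (rule reach_mono) (use I in auto)
      ultimately show ?thesis using reach_sym[OF r, of V v j] by (blast intro: reach_trans)
    qed
    with step.IH show ?case by (rule reach_trans)
  qed simp
next
  assume "reach r V x y"
  \<comment> \<open>inside \<open>I\<close> the induction remembers the vertex from which the path entered\<close>
  then have "(y \<notin> I \<longrightarrow> reach (reconnect r I) (V - I) x y) \<and>
    (y \<in> I \<longrightarrow> (\<exists>u\<in>V - I. (\<exists>i\<in>I. r u i) \<and> reach (reconnect r I) (V - I) x u))"
  proof (induction rule: reach_induct)
    case refl then show ?case using xy by auto
  next
    case (step u v)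
    have sym: "r u v \<longleftrightarrow> r v u" for u v using r by (auto simp: symp_def)
    show ?case
    proof (cases "u \<in> I")
      case True
      then obtain w where w: "w \<in> V - I" "\<exists>i\<in>I. r w i" "reach (reconnect r I) (V - I) x w"
        using step by auto
      show ?thesis
      proof (cases "v \<in> I")
        case False
        then have "reconnect r I w v" using w True step sym unfolding reconnect_def by blast
        then have "reach (reconnect r I) (V - I) x v" using w step False by (intro reach_step[OF w(3)]) auto
        then show ?thesis using False by simp
      qed (use w in auto)
    next
      case False
      then have *: "reach (reconnect r I) (V - I) x u" using step by auto
      show ?thesis
      proof (cases "v \<in> I")
        case True then show ?thesis using False step * by auto
      next
        case vI: False
        then have "reach (reconnect r I) (V - I) x v"
          using False step by (intro reach_step[OF *]) (auto simp: reconnect_def)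
        then show ?thesis using vI by simp
      qed
    qed
  qed
  then show "reach (reconnect r I) (V - I) x y" using xy by auto
qed

lemma comps_reconnect:
  assumes r: "symp r" and I: "conn r I" "I \<subseteq> V"
  shows "comps (reconnect r I) (V - I) = (\<lambda>K. K - I) ` (comps r V - {I})"
proof -
  have c: "component (reconnect r I) (V - I) x = component r V x - I" if "x \<in> V - I" for x
    using reach_reconnect[OF assms that] by (auto simp: component_def)
  have "comps (reconnect r I) (V - I) = (\<lambda>K. K - I) ` component r V ` (V - I)"
    unfolding comps_def image_image using c by (intro image_cong) auto
  also have "component r V ` (V - I) = comps r V - {I}"
  proof (intro equalityI subsetI)
    fix K assume "K \<in> component r V ` (V - I)"
    then show "K \<in> comps r V - {I}" using component_self by (fastforce simp: comps_def)
  next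
    fix K assume K: "K \<in> comps r V - {I}"
    then have K': "conn r K" "closed_in r V K" using r by (auto simp: comps_iff)
    have "\<not> K \<subseteq> I"
    proof
      assume "K \<subseteq> I"
      moreover obtain k where "k \<in> K" using K' by (auto simp: conn_def)
      ultimately have "I \<subseteq> K" using conn_subset_closed[OF I K'(2), of k] by auto
      then show False using \<open>K \<subseteq> I\<close> K by auto
    qed
    then obtain k where k: "k \<in> K" "k \<notin> I" by auto
    then have "component r V k = K" using conn_component[OF r K'] by simp
    then show "K \<in> component r V ` (V - I)"
      using k K' by (intro image_eqI[of _ _ k]) (auto simp: closed_in_def)
  qed
  finally show ?thesis .
qed

text \<open>
  A component meets the complement of \<open>I\<close> unless it is equal to \<open>I\<close>.
\<close>

lemma card_comps_reconnect:
  assumes r: "symp r" and I: "conn r I" "I \<subseteq> V" and "finite V"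
  shows "card (comps (reconnect r I) (V - I)) = card (comps r V) - (if I \<in> comps r V then 1 else 0)"
proof -
  have "inj_on (\<lambda>K. K - I) (comps r V - {I})"
  proof (rule inj_onI)
    fix K K' assume K: "K \<in> comps r V - {I}" "K' \<in> comps r V - {I}" "K - I = K' - I"
    then have "K - I \<in> comps (reconnect r I) (V - I)" using comps_reconnect[OF r I] by auto
    then obtain k where "k \<in> K - I" using comps_nonempty by blast
    then show "K = K'" using K comps_eqI[OF r, of K V K' k] by blast
  qed
  then have "card (comps (reconnect r I) (V - I)) = card (comps r V - {I})"
    unfolding comps_reconnect[OF r I] by (rule card_image)
  then show ?thesis by (simp add: card_Diff_singleton_if)
qed

lemma s_power_neq_1: "k \<noteq> 0 \<Longrightarrow> [:1, 1:] ^ k - 1 \<noteq> (0 :: int poly)"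
proof
  assume k: "k \<noteq> 0" and "[:1, 1:] ^ k - 1 = (0 :: int poly)"
  then have "poly ([:1, 1:] ^ k - 1) 1 = (0 :: int)" by simp
  then have "2 ^ k = (1 :: int)" by (simp add: poly_power)
  then show False using k by simp
qed

text \<open>
  Nothing is adjacent to a component, so nothing is reconnected when it is removed.
\<close>

lemma fpoly_split_component:
  assumes r: "symp r" and fin: "finite V" and cl: "closed_in r V K" and "a \<in> K"
  shows "fpoly (del_edge r a b) K * fpoly (reconnect r K) (V - K) = fpoly (del_edge r a b) V"
proof -
  have KV: "K \<subseteq> V" using cl by (simp add: closed_in_def)
  have "fpoly (reconnect r K) (V - K) = fpoly r (V - K)"
    using cl r by (intro fpoly_cong) (auto simp: reconnect_def closed_in_def dest: sympD)
  also have "\<dots> = fpoly (del_edge r a b) (V - K)"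
    using comps_del_edge_outside(2)[of a K b r V] assms(4) by simp
  also have "fpoly (del_edge r a b) K * \<dots> = fpoly (del_edge r a b) (K \<union> (V - K))"
    using KV fin cl by (intro fpoly_Un[OF symp_del_edge[OF r], symmetric])
      (auto simp: del_edge_def closed_in_def intro: finite_subset)
  also have "K \<union> (V - K) = V" using KV by auto
  finally show ?thesis .
qed

text \<open>
  Induction on the number of vertices. By \<open>fpoly_nonempty_sum\<close>, a nonzero multiple of either side is a sum
  over the nonempty sets \<open>T\<close> of the same expressions for \<open>V - T\<close>, and passing to \<open>V - T\<close> commutes with
  deleting the edge and with forming the reconnected complement. The multiples \<open>(1 + t)\<^bsup>c\<^esup> - 1\<close> involve the
  number of components, which is constant except when the edge is a bridge; then the term of the
  component \<open>K\<close> that it splits compensates for the difference. For \<open>a\<close> or \<open>b\<close> outside \<open>V\<close> the sum is empty;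
  admitting this case is what lets the induction pass to \<open>V - T\<close> for every \<open>T\<close>.
\<close>

theorem fpoly_del_edge:
  assumes r: "symp r" and "finite V" and ab: "a \<noteq> b"
  shows "fpoly r V = fpoly (del_edge r a b) V +
    [:1, 1:] * (\<Sum>I\<in>splits r a b V. fpoly (del_edge r a b) I * fpoly (reconnect r I) (V - I))"
  using \<open>finite V\<close>
proof (induction "card V" arbitrary: V rule: less_induct)
  case less
  note fin = \<open>finite V\<close>
  let ?r = "del_edge r a b" and ?s = "[:1, 1:] :: int poly"
  note r' = symp_del_edge[OF r, of a b]
  show ?case
  proof (cases "a \<in> V \<and> b \<in> V \<and> r a b")
    case False
    then have no: "\<not> (x \<in> V \<and> y \<in> V \<and> r x y \<and> {x, y} = {a, b})" for x y
      using r by (auto simp: doubleton_eq_iff dest: sympD)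
    have eq: "?r x y \<longleftrightarrow> r x y" if "x \<in> V" "y \<in> V" for x y
      using no[of x y] that by (auto simp: del_edge_def)
    have "fpoly r V = fpoly ?r V" by (rule fpoly_cong) (simp add: eq)
    moreover have "conn ?r I \<longleftrightarrow> conn r I" if "I \<subseteq> V" for I
      by (rule conn_cong[OF _ that]) (simp add: eq)
    then have "splits r a b V = {}" by (auto simp: splits_def)
    ultimately show ?thesis by simp
  next
    case True
    define K where "K = component r V a"
    define c where "c = card (comps r V)"
    have cl: "closed_in r V K" unfolding K_def by (rule closed_component)
    have K: "K \<in> comps r V" using True by (auto simp: K_def comps_def)
    have aK: "a \<in> K" using component_self[of a V r] True by (simp add: K_def)
    have cpos: "c \<noteq> 0" using K finite_comps[OF fin] by (auto simp: c_def)
    let ?g = "\<lambda>I. fpoly (reconnect r I) (V - I)"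
    have ci: "card (comps (reconnect r I) (V - I)) = (if I = K then c - 1 else c)"
      if I: "I \<in> splits r a b V" for I
    proof -
      have "I = K" if "I \<in> comps r V"
        using comps_eqI[OF r that K, of a] I aK by (auto simp: splits_def)
      then have "I \<in> comps r V \<longleftrightarrow> I = K" using K by auto
      then show ?thesis using card_comps_reconnect[OF r, of I V] I fin by (auto simp: splits_def c_def)
    qed
    have "(?s ^ c - 1) * fpoly r V = (\<Sum>T\<in>Pow V - {{}}. xp (card T) * fpoly r (V - T))"
      using fpoly_nonempty_sum[OF r fin] by (simp add: c_def)
    also have "\<dots> = (\<Sum>T\<in>Pow V - {{}}. xp (card T) * fpoly ?r (V - T) +
       ?s * (\<Sum>I\<in>splits r a b (V - T). xp (card T) * (fpoly ?r I * fpoly (reconnect r I) (V - T - I))))"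
    proof (rule sum.cong[OF refl])
      fix T assume "T \<in> Pow V - {{}}"
      then have "card (V - T) < card V" using fin by (intro psubset_card_mono) auto
      then have "fpoly r (V - T) = fpoly ?r (V - T) +
          ?s * (\<Sum>I\<in>splits r a b (V - T). fpoly ?r I * fpoly (reconnect r I) (V - T - I))"
        using fin by (intro less.hyps) auto
      then show "xp (card T) * fpoly r (V - T) = xp (card T) * fpoly ?r (V - T) +
       ?s * (\<Sum>I\<in>splits r a b (V - T). xp (card T) * (fpoly ?r I * fpoly (reconnect r I) (V - T - I)))"
        by (simp only: distrib_left sum_distrib_left mult.left_commute)
    qed
    also have "\<dots> = (\<Sum>T\<in>Pow V - {{}}. xp (card T) * fpoly ?r (V - T)) + ?s *
       (\<Sum>T\<in>Pow V - {{}}. \<Sum>I\<in>splits r a b (V - T). xp (card T) * (fpoly ?r I * fpoly (reconnect r I) (V - T - I)))"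
      by (simp only: sum.distrib sum_distrib_left)
    also have "(\<Sum>T\<in>Pow V - {{}}. xp (card T) * fpoly ?r (V - T)) =
        (?s ^ card (comps ?r V) - 1) * fpoly ?r V"
      by (rule fpoly_nonempty_sum[OF r' fin])
    also have "(\<Sum>T\<in>Pow V - {{}}. \<Sum>I\<in>splits r a b (V - T). xp (card T) * (fpoly ?r I * fpoly (reconnect r I) (V - T - I)))
      = (\<Sum>T\<in>Pow V - {{}}. \<Sum>I | I \<in> splits r a b V \<and> I \<inter> T = {}.
            xp (card T) * (fpoly ?r I * fpoly (reconnect r I) (V - T - I)))"
      by (intro sum.cong refl) (auto simp: splits_def)
    also have "\<dots> = (\<Sum>I\<in>splits r a b V. \<Sum>T | T \<in> Pow V - {{}} \<and> I \<inter> T = {}.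
            xp (card T) * (fpoly ?r I * fpoly (reconnect r I) (V - T - I)))"
      using fin by (intro sum.swap_restrict finite_splits) auto
    also have "\<dots> = (\<Sum>I\<in>splits r a b V. (?s ^ (if I = K then c - 1 else c) - 1) * (fpoly ?r I * ?g I))"
    proof (rule sum.cong[OF refl])
      fix I assume I: "I \<in> splits r a b V"
      then have "(\<Sum>T | T \<in> Pow V - {{}} \<and> I \<inter> T = {}.
            xp (card T) * (fpoly ?r I * fpoly (reconnect r I) (V - T - I))) =
        (\<Sum>T\<in>Pow (V - I) - {{}}. fpoly ?r I * (xp (card T) * fpoly (reconnect r I) (V - I - T)))"
        by (intro sum.cong) (auto simp: Diff_eq Int_ac)
      also have "\<dots> = fpoly ?r I * ((?s ^ (if I = K then c - 1 else c) - 1) * ?g I)"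
        using fpoly_nonempty_sum[OF symp_reconnect[OF r], of "V - I" I] fin ci[OF I]
        by (simp only: sum_distrib_left[symmetric] finite_Diff)
      finally show "(\<Sum>T | T \<in> Pow V - {{}} \<and> I \<inter> T = {}.
            xp (card T) * (fpoly ?r I * fpoly (reconnect r I) (V - T - I))) =
          (?s ^ (if I = K then c - 1 else c) - 1) * (fpoly ?r I * ?g I)"
        by (simp only: mult.left_commute)
    qed
    finally have main: "(?s ^ c - 1) * fpoly r V = (?s ^ card (comps ?r V) - 1) * fpoly ?r V +
      ?s * (\<Sum>I\<in>splits r a b V. (?s ^ (if I = K then c - 1 else c) - 1) * (fpoly ?r I * ?g I))" .
    have c': "card (comps ?r V) = c + (if K \<in> splits r a b V then 1 else 0)"
      unfolding c_def using True by (intro card_comps_del_edge[OF r fin]) (auto simp: K_def)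
    have "(?s ^ c - 1) * fpoly r V = (?s ^ c - 1) * (fpoly ?r V + ?s * (\<Sum>I\<in>splits r a b V. fpoly ?r I * ?g I))"
    proof (cases "K \<in> splits r a b V")
      case False
      then have "(\<Sum>I\<in>splits r a b V. (?s ^ (if I = K then c - 1 else c) - 1) * (fpoly ?r I * ?g I)) =
         (\<Sum>I\<in>splits r a b V. (?s ^ c - 1) * (fpoly ?r I * ?g I))"
        by (intro sum.cong) auto
      also have "\<dots> = (?s ^ c - 1) * (\<Sum>I\<in>splits r a b V. fpoly ?r I * ?g I)"
        by (simp only: sum_distrib_left)
      finally show ?thesis unfolding main c' using False
        by (simp only: if_False add_0_right distrib_left mult.left_commute[of ?s])
    next
      case KS: True
      define R where "R = (\<Sum>I\<in>splits r a b V - {K}. fpoly ?r I * ?g I)"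
      have gK: "fpoly ?r K * ?g K = fpoly ?r V"
        by (rule fpoly_split_component[OF r fin cl aK])
      have S1: "(\<Sum>I\<in>splits r a b V. fpoly ?r I * ?g I) = fpoly ?r V + R"
        unfolding R_def using KS fin by (subst sum.remove[of _ K]) (auto simp: finite_splits gK)
      have "(\<Sum>I\<in>splits r a b V. (?s ^ (if I = K then c - 1 else c) - 1) * (fpoly ?r I * ?g I)) =
         (?s ^ (c - 1) - 1) * fpoly ?r V + (\<Sum>I\<in>splits r a b V - {K}. (?s ^ c - 1) * (fpoly ?r I * ?g I))"
        using KS fin by (subst sum.remove[of _ K]) (auto simp: finite_splits gK)
      also have "(\<Sum>I\<in>splits r a b V - {K}. (?s ^ c - 1) * (fpoly ?r I * ?g I)) = (?s ^ c - 1) * R"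
        by (simp only: sum_distrib_left R_def)
      finally have S2: "(\<Sum>I\<in>splits r a b V. (?s ^ (if I = K then c - 1 else c) - 1) * (fpoly ?r I * ?g I)) =
         (?s ^ (c - 1) - 1) * fpoly ?r V + (?s ^ c - 1) * R" .
      obtain k where k: "c = Suc k" using cpos by (cases c) auto
      define s where "s = ?s"
      have "(s ^ c - 1) * fpoly r V = (s ^ Suc c - 1) * fpoly ?r V + s * ((s ^ k - 1) * fpoly ?r V + (s ^ c - 1) * R)"
        using main[unfolded S2 c'] KS k by (simp add: s_def del: mult_pCons_left)
      also have "\<dots> = (s ^ c - 1) * (fpoly ?r V + s * (fpoly ?r V + R))"
        unfolding k by (simp add: algebra_simps)
      finally show ?thesis unfolding S1 s_def .
    qed
    then show ?thesis using s_power_neq_1[OF cpos] by (simp only: mult_cancel_left)  simp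
  qed
qed

section \<open>The gamma polynomial of a graph\<close>

text \<open>
  The substitution of \<open>t - 1\<close> for \<open>t\<close> turns a face polynomial into an \<open>h\<close>-polynomial.
\<close>

definition has_gamma :: "nat \<Rightarrow> int poly \<Rightarrow> int poly \<Rightarrow> bool" where
  "has_gamma d f g \<longleftrightarrow> degree g \<le> d div 2 \<and> pcompose f [:-1, 1:] = gamma_expansion d g"

text \<open>
  The dimension of the graph associahedron.
\<close>

definition graph_rank :: "('a \<Rightarrow> 'a \<Rightarrow> bool) \<Rightarrow> 'a set \<Rightarrow> nat" where
  "graph_rank r V = card V - card (comps r V)"

definition graph_gamma :: "('a \<Rightarrow> 'a \<Rightarrow> bool) \<Rightarrow> 'a set \<Rightarrow> int poly" where
  "graph_gamma r V = (THE g. has_gamma (graph_rank r V) (fpoly r V) g)"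

lemma has_gamma_unique: "has_gamma d f g \<Longrightarrow> has_gamma d f g' \<Longrightarrow> g = g'"
  unfolding has_gamma_def by (metis gamma_expansion_inject)

lemma gamma_expansion_add: "gamma_expansion d (g + g') = gamma_expansion d g + gamma_expansion d g'"
  by (simp add: gamma_expansion_def sum.distrib smult_add_left)

lemma has_gamma_add: "has_gamma d f g \<Longrightarrow> has_gamma d f' g' \<Longrightarrow> has_gamma d (f + f') (g + g')"
  by (simp add: has_gamma_def pcompose_add gamma_expansion_add degree_add_le)

lemma has_gamma_0: "has_gamma d 0 0"
  by (simp add: has_gamma_def gamma_expansion_def)

lemma has_gamma_sum:
  "(\<And>i. i \<in> A \<Longrightarrow> has_gamma d (f i) (g i)) \<Longrightarrow> has_gamma d (\<Sum>i\<in>A. f i) (\<Sum>i\<in>A. g i)"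
  by (induction A rule: infinite_finite_induct) (auto simp: has_gamma_0 intro: has_gamma_add)

lemma gamma_expansion_monom:
  assumes "i \<le> d div 2"
  shows "gamma_expansion d (monom c i) = smult c (monom 1 i * [:1, 1:] ^ (d - 2 * i))"
proof -
  have "gamma_expansion d (monom c i) =
    (\<Sum>j\<le>d div 2. if j = i then smult c (monom 1 i * [:1, 1:] ^ (d - 2 * i)) else 0)"
    unfolding gamma_expansion_def by (intro sum.cong) auto
  then show ?thesis using assms by simp
qed

lemma gamma_expansion_sum: "gamma_expansion d (\<Sum>i\<in>A. g i) = (\<Sum>i\<in>A. gamma_expansion d (g i))"
  by (induction A rule: infinite_finite_induct)
    (auto simp: gamma_expansion_add, auto simp: gamma_expansion_def)

text \<open>
  The products \<open>t\<^sup>i (1 + t)\<^bsup>d - 2 i\<^esup>\<close> multiply by adding \<open>i\<close> and adding \<open>d\<close>. The degree bounds are essential: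
  the expansion ignores coefficients above \<open>d div 2\<close>.
\<close>

lemma gamma_expansion_mult:
  assumes "degree g \<le> d div 2" "degree g' \<le> d' div 2"
  shows "gamma_expansion (d + d') (g * g') = gamma_expansion d g * gamma_expansion d' g'"
proof -
  have e: "g * g' = (\<Sum>i\<le>d div 2. \<Sum>j\<le>d' div 2. monom (coeff g i * coeff g' j) (i + j))"
    by (subst poly_as_sum_of_monoms'[OF assms(1), symmetric], subst poly_as_sum_of_monoms'[OF assms(2), symmetric])
      (simp add: sum_product mult_monom)
  have "gamma_expansion (d + d') (g * g') =
     (\<Sum>i\<le>d div 2. \<Sum>j\<le>d' div 2. smult (coeff g i) (monom 1 i * [:1, 1:] ^ (d - 2 * i)) *
        smult (coeff g' j) (monom 1 j * [:1, 1:] ^ (d' - 2 * j)))"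
    unfolding e gamma_expansion_sum
  proof (intro sum.cong refl)
    fix i j assume ij: "i \<in> {..d div 2}" "j \<in> {..d' div 2}"
    then have "d + d' - 2 * (i + j) = (d - 2 * i) + (d' - 2 * j)" by auto
    moreover have "i + j \<le> (d + d') div 2" using ij by auto
    ultimately show "gamma_expansion (d + d') (monom (coeff g i * coeff g' j) (i + j)) =
       smult (coeff g i) (monom 1 i * [:1, 1:] ^ (d - 2 * i)) * smult (coeff g' j) (monom 1 j * [:1, 1:] ^ (d' - 2 * j))"
      using mult_monom[of "1::int" i 1 j]
      by (simp only: gamma_expansion_monom power_add mult_smult_left mult_smult_right smult_smult mult_1_left mult_ac)
        (simp only: mult.assoc[symmetric])
  qed
  also have "\<dots> = gamma_expansion d g * gamma_expansion d' g'"
    unfolding gamma_expansion_def by (simp only: sum_product)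
  finally show ?thesis .
qed

lemma has_gamma_mult:
  assumes "has_gamma d f g" "has_gamma d' f' g'"
  shows "has_gamma (d + d') (f * f') (g * g')"
  using assms degree_mult_le[of g g'] unfolding has_gamma_def
  by (auto simp: pcompose_mult gamma_expansion_mult)

lemma has_gamma_1: "has_gamma 0 1 1"
proof -
  have "pcompose 1 [:-1, 1:] = (1 :: int poly)" by (metis one_pCons pcompose_const)
  then show ?thesis by (simp add: has_gamma_def gamma_expansion_def)
qed

text \<open>
  The factor \<open>1 + t\<close> of a face polynomial is a factor \<open>t\<close> of the \<open>h\<close>-polynomial, which counts for two
  dimensions.
\<close>

lemma has_gamma_s: "has_gamma 2 [:1, 1:] (xp 1)"
proof -
  have "gamma_expansion 2 (xp 1) = xp 1"
    by (subst gamma_expansion_monom) auto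
  then show ?thesis by (simp add: has_gamma_def pcompose_pCons degree_monom_eq monom_altdef)
qed

text \<open>
  The face polynomial \<open>2 + t\<close> of a segment.
\<close>

lemma has_gamma_interval: "has_gamma 1 ([:1, 1:] + 1) 1"
  by (simp add: has_gamma_def pcompose_pCons gamma_expansion_def pcompose_add one_pCons)

lemma card_comps_le: "finite V \<Longrightarrow> card (comps r V) \<le> card V"
  by (simp add: comps_def card_image_le)

text \<open>
  The two dimensions that are missing on the left are those supplied by the factor \<open>1 + t\<close> in the edge
  deletion formula.
\<close>

lemma graph_rank_reconnect:
  assumes r: "symp r" and fin: "finite V" and ab: "a \<noteq> b" and I: "I \<in> splits r a b V" "I \<notin> comps r V"
  shows "2 + graph_rank (del_edge r a b) I + graph_rank (reconnect r I) (V - I) = graph_rank r V"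
    "card I < card V" "card (V - I) < card V"
proof -
  have I': "I \<subseteq> V" "conn r I" "a \<in> I" "b \<in> I" "I \<noteq> {}" using I by (auto simp: splits_def)
  have "I \<noteq> V" using I I' conn_comps[OF r, of V] by auto
  then show "card I < card V" using I' fin by (intro psubset_card_mono) auto
  have "V - I \<subset> V" using I' by auto
  then show "card (V - I) < card V" using I' fin by (intro psubset_card_mono) auto
  have "card (comps (reconnect r I) (V - I)) = card (comps r V)"
    using card_comps_reconnect[OF r I'(2,1) fin] I by simp
  moreover have "card (comps (reconnect r I) (V - I)) \<le> card (V - I)" using fin by (intro card_comps_le) auto
  moreover have "card {a, b} \<le> card I" using I' fin by (intro card_mono) (auto intro: finite_subset)
  moreover have "card (V - I) = card V - card I" using I' fin by (intro card_Diff_subset) (auto intro: finite_subset)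
  moreover have "card I \<le> card V" using I' fin by (intro card_mono)
  ultimately show "2 + graph_rank (del_edge r a b) I + graph_rank (reconnect r I) (V - I) = graph_rank r V"
    using card_comps_split[OF r I(1)] ab by (simp add: graph_rank_def)
qed

text \<open>
  If the edge is a bridge, the component \<open>K\<close> that it splits contributes \<open>(1 + t) f\<^bsub>G - e\<^esub>\<close>. Together with the
  first summand \<open>f\<^bsub>G - e\<^esub>\<close> of the deletion formula this is \<open>(2 + t) f\<^bsub>G - e\<^esub>\<close>, the face polynomial of a
  product with a segment, which has the same \<open>\<gamma>\<close>-polynomial. That is why components are left out of the
  sum.
\<close>

lemma has_gamma_del_edge:
  assumes r: "symp r" and fin: "finite V" and ab: "a \<noteq> b" "a \<in> V" "b \<in> V" "r a b"
    and g: "has_gamma (graph_rank (del_edge r a b) V) (fpoly (del_edge r a b) V) g"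
    and gI: "\<And>I. I \<in> splits r a b V - comps r V \<Longrightarrow> has_gamma (graph_rank (del_edge r a b) I) (fpoly (del_edge r a b) I) (g1 I)"
    and gC: "\<And>I. I \<in> splits r a b V - comps r V \<Longrightarrow> has_gamma (graph_rank (reconnect r I) (V - I)) (fpoly (reconnect r I) (V - I)) (g2 I)"
  shows "has_gamma (graph_rank r V) (fpoly r V) (g + xp 1 * (\<Sum>I\<in>splits r a b V - comps r V. g1 I * g2 I))"
proof -
  let ?r = "del_edge r a b"
  define S where "S = (\<Sum>I\<in>splits r a b V - comps r V. fpoly ?r I * fpoly (reconnect r I) (V - I))"
  define K where "K = component r V a"
  have K: "K \<in> comps r V" using ab by (auto simp: K_def comps_def)
  have aK: "a \<in> K" using component_self[of a V r] ab by (simp add: K_def)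
  have cl: "closed_in r V K" unfolding K_def by (rule closed_component)
  have uni: "I = K" if "I \<in> splits r a b V" "I \<in> comps r V" for I
    using comps_eqI[OF r that(2) K, of a] that aK by (auto simp: splits_def)
  have c: "card (comps ?r V) = card (comps r V) + (if K \<in> splits r a b V then 1 else 0)"
    by (rule card_comps_del_edge[OF r fin ab(2-4) K_def])
  have "has_gamma (graph_rank r V) ([:1, 1:] * S) (xp 1 * (\<Sum>I\<in>splits r a b V - comps r V. g1 I * g2 I))"
    unfolding S_def sum_distrib_left
  proof (rule has_gamma_sum)
    fix I assume I: "I \<in> splits r a b V - comps r V"
    have "has_gamma (2 + (graph_rank ?r I + graph_rank (reconnect r I) (V - I)))
        ([:1, 1:] * (fpoly ?r I * fpoly (reconnect r I) (V - I))) (xp 1 * (g1 I * g2 I))"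
      by (intro has_gamma_mult has_gamma_s gI gC I)
    then show "has_gamma (graph_rank r V) ([:1, 1:] * (fpoly ?r I * fpoly (reconnect r I) (V - I))) (xp 1 * (g1 I * g2 I))"
      using graph_rank_reconnect(1)[OF r fin ab(1), of I] I by (simp add: add.assoc)
  qed
  moreover have "has_gamma (graph_rank r V) (fpoly r V - [:1, 1:] * S) g"
  proof (cases "K \<in> splits r a b V")
    case False
    then have "splits r a b V - comps r V = splits r a b V" using uni by blast
    then have "fpoly r V - [:1, 1:] * S = fpoly ?r V"
      using fpoly_del_edge[OF r fin ab(1)] by (simp add: S_def)
    then show ?thesis using g c False by (simp add: graph_rank_def)
  next
    case True
    then have "splits r a b V - comps r V = splits r a b V - {K}" using uni K by blast
    then have "(\<Sum>I\<in>splits r a b V. fpoly ?r I * fpoly (reconnect r I) (V - I)) = fpoly ?r V + S"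
      unfolding S_def using True fpoly_split_component[OF r fin cl aK] fin
      by (subst sum.remove[of _ K]) (auto simp: finite_splits)
    then have *: "fpoly r V - [:1, 1:] * S = ([:1, 1:] + 1) * fpoly ?r V"
      using fpoly_del_edge[OF r fin ab(1)] by (simp only: distrib_left distrib_right mult_1_left)
    have "has_gamma (1 + graph_rank ?r V) (([:1, 1:] + 1) * fpoly ?r V) (1 * g)"
      by (intro has_gamma_mult has_gamma_interval g)
    moreover have "1 + graph_rank ?r V = graph_rank r V"
      using c True card_comps_le[OF fin, of ?r] by (simp add: graph_rank_def)
    ultimately show ?thesis unfolding * by (simp only: mult_1_left)
  qed
  ultimately have "has_gamma (graph_rank r V) ((fpoly r V - [:1, 1:] * S) + [:1, 1:] * S)
      (g + xp 1 * (\<Sum>I\<in>splits r a b V - comps r V. g1 I * g2 I))"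
    by (intro has_gamma_add)
  then show ?thesis by (simp only: diff_add_cancel)
qed

lemma no_edges:
  assumes r: "symp r" and "finite V" and no: "\<And>x y. x \<in> V \<Longrightarrow> y \<in> V \<Longrightarrow> x \<noteq> y \<Longrightarrow> \<not> r x y"
  shows "fpoly r V = 1" "graph_rank r V = 0"
proof -
  have comp: "component r W a = {a}" if "W \<subseteq> V" "a \<in> W" for a W
  proof -
    have "y = a" if "y \<in> W" "r a y" for y
      using no[of a y] that \<open>W \<subseteq> V\<close> \<open>a \<in> W\<close> by (metis subsetD)
    then have "closed_in r W {a}" using \<open>a \<in> W\<close> by (auto simp: closed_in_def)
    then have "component r W a = component r {a} a" by (rule component_closed) simp
    also have "\<dots> = {a}" by (auto simp: component_def)
    finally show ?thesis .
  qed
  have "comps r V = (\<lambda>a. {a}) ` V" unfolding comps_def using comp[OF subset_refl] by (intro image_cong) auto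
  then show "graph_rank r V = 0" by (simp add: graph_rank_def card_image)
  have "nest r V y = (\<lambda>a. if a \<in> V then {a} else {})" for y
    using comp[of "{b \<in> V. y b \<le> y _}"] by (auto simp: nest_def fun_eq_iff)
  then have "range (nest r V) = {\<lambda>a. if a \<in> V then {a} else {}}" by auto
  moreover have "card ((\<lambda>a. if a \<in> V then {a} else {}) ` V) = card V"
    by (rule card_image) (auto simp: inj_on_def)
  ultimately show "fpoly r V = 1" by (simp add: fpoly_def)
qed

text \<open>
  Each \<open>\<gamma>\<close>-polynomial on the right of the deletion formula belongs to a graph with fewer vertices, or with
  the same vertices and fewer edges. For a graph without edges the associahedron is a point.
\<close>

theorem gamma_nonneg_exists:
  assumes "symp r" "finite V"
  shows "\<exists>g. has_gamma (graph_rank r V) (fpoly r V) g \<and> (\<forall>i. coeff g i \<ge> 0)"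
  using assms
proof (induction "card V" arbitrary: V r rule: less_induct)
  case (less V r)
  note IH = less.hyps
  show ?case using less.prems(1)
  proof (induction "card {(x, y). x \<in> V \<and> y \<in> V \<and> r x y}" arbitrary: r rule: less_induct)
    case (less r)
    note r = \<open>symp r\<close> and fin = \<open>finite V\<close>
    show ?case
    proof (cases "\<exists>a\<in>V. \<exists>b\<in>V. a \<noteq> b \<and> r a b")
      case False
      then have "fpoly r V = 1" "graph_rank r V = 0" by (intro no_edges[OF r fin]; blast)+
      then show ?thesis using has_gamma_1 by (intro exI[of _ 1]) (auto simp: coeff_1)
    next
      case True
      then obtain a b where ab: "a \<noteq> b" "a \<in> V" "b \<in> V" "r a b" by blast
      let ?r = "del_edge r a b" and ?A = "splits r a b V - comps r V"
      note r' = symp_del_edge[OF r, of a b]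
      have "finite {(x, y). x \<in> V \<and> y \<in> V \<and> r x y}"
        by (rule finite_subset[of _ "V \<times> V"]) (use fin in auto)
      moreover have "{(x, y). x \<in> V \<and> y \<in> V \<and> ?r x y} \<subseteq> {(x, y). x \<in> V \<and> y \<in> V \<and> r x y}"
        by (auto simp: del_edge_def)
      moreover have "\<not> ?r a b" by (simp add: del_edge_def)
      ultimately have "finite {(x, y). x \<in> V \<and> y \<in> V \<and> r x y}"
        "{(x, y). x \<in> V \<and> y \<in> V \<and> ?r x y} \<subset> {(x, y). x \<in> V \<and> y \<in> V \<and> r x y}"
        using ab by blast+
      then have "card {(x, y). x \<in> V \<and> y \<in> V \<and> ?r x y} < card {(x, y). x \<in> V \<and> y \<in> V \<and> r x y}"
        by (rule psubset_card_mono)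
      then obtain g where g: "has_gamma (graph_rank ?r V) (fpoly ?r V) g" "\<forall>i. coeff g i \<ge> 0"
        using less.hyps[OF _ r'] by blast
      have "\<exists>g. has_gamma (graph_rank ?r I) (fpoly ?r I) g \<and> (\<forall>i. coeff g i \<ge> 0)" if "I \<in> ?A" for I
      proof (rule IH[OF _ r'])
        show "card I < card V" using graph_rank_reconnect(2)[OF r fin ab(1)] that by blast
        show "finite I" using that fin by (auto simp: splits_def intro: finite_subset)
      qed
      then obtain g1 where g1: "\<And>I. I \<in> ?A \<Longrightarrow> has_gamma (graph_rank ?r I) (fpoly ?r I) (g1 I) \<and> (\<forall>i. coeff (g1 I) i \<ge> 0)"
        by metis
      have "\<exists>g. has_gamma (graph_rank (reconnect r I) (V - I)) (fpoly (reconnect r I) (V - I)) g \<and> (\<forall>i. coeff g i \<ge> 0)" if "I \<in> ?A" for I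
      proof (rule IH[OF _ symp_reconnect[OF r]])
        show "card (V - I) < card V" using graph_rank_reconnect(3)[OF r fin ab(1)] that by blast
      qed (use fin in simp)
      then obtain g2 where g2: "\<And>I. I \<in> ?A \<Longrightarrow> has_gamma (graph_rank (reconnect r I) (V - I)) (fpoly (reconnect r I) (V - I)) (g2 I)
          \<and> (\<forall>i. coeff (g2 I) i \<ge> 0)" by metis
      have "has_gamma (graph_rank r V) (fpoly r V) (g + xp 1 * (\<Sum>I\<in>?A. g1 I * g2 I))"
        using g1 g2 by (intro has_gamma_del_edge[OF r fin ab g(1)]) auto
      moreover have "coeff (g + xp 1 * (\<Sum>I\<in>?A. g1 I * g2 I)) i \<ge> 0" for i
        using g(2) g1 g2 by (auto simp: coeff_monom_mult coeff_sum coeff_mult intro!: add_nonneg_nonneg sum_nonneg mult_nonneg_nonneg)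
      ultimately show ?thesis by blast
    qed
  qed
qed

lemma has_gamma_graph_gamma:
  assumes "symp r" "finite V"
  shows "has_gamma (graph_rank r V) (fpoly r V) (graph_gamma r V)"
proof -
  obtain g where g: "has_gamma (graph_rank r V) (fpoly r V) g" using gamma_nonneg_exists[OF assms] by blast
  show ?thesis unfolding graph_gamma_def
    by (rule theI[of _ g], rule g, erule has_gamma_unique[OF _ g])
qed

lemma graph_gamma_eqI:
  assumes "symp r" "finite V" "has_gamma (graph_rank r V) (fpoly r V) g"
  shows "graph_gamma r V = g"
  using has_gamma_unique[OF has_gamma_graph_gamma[OF assms(1,2)] assms(3)] .

lemma graph_gamma_nonneg:
  assumes "symp r" "finite V"
  shows "coeff (graph_gamma r V) i \<ge> 0"
  using gamma_nonneg_exists[OF assms] graph_gamma_eqI[OF assms] by blast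

theorem graph_gamma_del_edge:
  assumes r: "symp r" and fin: "finite V" and ab: "a \<noteq> b" "a \<in> V" "b \<in> V" "r a b"
  shows "graph_gamma r V = graph_gamma (del_edge r a b) V +
    xp 1 * (\<Sum>I\<in>splits r a b V - comps r V. graph_gamma (del_edge r a b) I * graph_gamma (reconnect r I) (V - I))"
proof (rule graph_gamma_eqI[OF r fin], rule has_gamma_del_edge[OF r fin ab])
  fix I assume I: "I \<in> splits r a b V - comps r V"
  then have "finite I" using fin by (auto simp: splits_def intro: finite_subset)
  then show "has_gamma (graph_rank (del_edge r a b) I) (fpoly (del_edge r a b) I) (graph_gamma (del_edge r a b) I)"
    using has_gamma_graph_gamma[OF symp_del_edge[OF r]] by blast
qed (use fin in \<open>auto intro!: has_gamma_graph_gamma symp_del_edge symp_reconnect r\<close>)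

lemma graph_gamma_image:
  assumes r: "symp r" and r': "symp r'" and "finite V" "embeds r V r' \<phi>"
  shows "graph_gamma r' (\<phi> ` V) = graph_gamma r V"
proof -
  have "card (\<phi> ` V) = card V" using assms(4) by (auto simp: embeds_def card_image)
  then show ?thesis
    using fpoly_image[OF assms] card_comps_image[OF r r' assms(4)] by (simp add: graph_gamma_def graph_rank_def)
qed

lemma graph_gamma_isolated:
  assumes r: "symp r" and "finite V" "z \<notin> V" "\<And>x. x \<in> V \<Longrightarrow> \<not> r z x"
  shows "graph_gamma r (insert z V) = graph_gamma r V"
proof -
  have 1: "fpoly r {z} = 1" "graph_rank r {z} = 0" using no_edges[OF r, of "{z}"] by auto
  have cl: "closed_in r (insert z V) {z}" using assms by (auto simp: closed_in_def)
  have "fpoly r (insert z V) = fpoly r V"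
    using fpoly_Un[OF r, of "{z}" V] assms 1 by simp
  moreover have "card (comps r (insert z V)) = Suc (card (comps r V))"
    using card_comps_closed_split[OF r cl] assms 1 card_comps_le[of "{z}" r]
      card_comps_conn[OF r, of "{z}"] by (simp add: conn_def)
  then have "graph_rank r (insert z V) = graph_rank r V"
    using assms by (simp add: graph_rank_def)
  ultimately show ?thesis by (simp add: graph_gamma_def)
qed

section \<open>A line of vertices with a graph attached at one of them\<close>

text \<open>
  A line \<open>Inr 0, Inr 1, \<dots>\<close> and a graph \<open>q\<close> on the vertices \<open>Inl a\<close>, of which those in \<open>N\<close> are adjacent to the
  line, namely to the hub \<open>Inr m\<close>.
\<close>

fun hub :: "('a \<Rightarrow> 'a \<Rightarrow> bool) \<Rightarrow> 'a set \<Rightarrow> nat \<Rightarrow> 'a + nat \<Rightarrow> 'a + nat \<Rightarrow> bool" where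
  "hub q N m (Inl a) (Inl b) \<longleftrightarrow> q a b"
| "hub q N m (Inl a) (Inr i) \<longleftrightarrow> a \<in> N \<and> i = m"
| "hub q N m (Inr i) (Inl a) \<longleftrightarrow> a \<in> N \<and> i = m"
| "hub q N m (Inr i) (Inr j) \<longleftrightarrow> i = Suc j \<or> j = Suc i"

text \<open>
  The condition for \<open>J\<close> together with the hub to be connected.
\<close>

definition attached :: "('a \<Rightarrow> 'a \<Rightarrow> bool) \<Rightarrow> 'a set \<Rightarrow> 'a set \<Rightarrow> bool" where
  "attached q N J \<longleftrightarrow> (\<forall>a\<in>J. \<exists>x\<in>N \<inter> J. reach q J a x)"

text \<open>
  When \<open>J\<close> is contracted together with the hub, the vertices of \<open>hub_nbrs q N J\<close> become adjacent to each
  other (\<open>hub_con\<close>) and to the next vertex of the line, which is the new hub.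
\<close>

definition hub_nbrs :: "('a \<Rightarrow> 'a \<Rightarrow> bool) \<Rightarrow> 'a set \<Rightarrow> 'a set \<Rightarrow> 'a set" where
  "hub_nbrs q N J = {a. a \<in> N \<or> (\<exists>j\<in>J. q a j)}"

definition hub_con :: "('a \<Rightarrow> 'a \<Rightarrow> bool) \<Rightarrow> 'a set \<Rightarrow> 'a set \<Rightarrow> 'a \<Rightarrow> 'a \<Rightarrow> bool" where
  "hub_con q N J = (\<lambda>a b. q a b \<or> (a \<in> hub_nbrs q N J \<and> b \<in> hub_nbrs q N J))"

definition line_gamma :: "('a \<Rightarrow> 'a \<Rightarrow> bool) \<Rightarrow> 'a set \<Rightarrow> 'a set \<Rightarrow> nat \<Rightarrow> nat \<Rightarrow> int poly" where
  "line_gamma q N A n m = graph_gamma (hub q N m) (A <+> {..<n})"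

text \<open>
  Any relation in which exactly neighbouring numbers are adjacent gives the path on \<open>n\<close> vertices.
\<close>

definition path_gamma :: "nat \<Rightarrow> int poly" where
  "path_gamma n = graph_gamma (\<lambda>i j. i = Suc j \<or> j = Suc i) {..<n}"

lemma symp_hub: "symp q \<Longrightarrow> symp (hub q N m)"
proof (rule sympI)
  fix x y assume "symp q" "hub q N m x y"
  then show "hub q N m y x" by (cases x; cases y) (auto dest: sympD)
qed

lemma symp_hub_con: "symp q \<Longrightarrow> symp (hub_con q N J)"
  by (auto simp: symp_def hub_con_def)

lemma bex_Plus: "(\<exists>x\<in>A <+> B. P x) \<longleftrightarrow> (\<exists>a\<in>A. P (Inl a)) \<or> (\<exists>b\<in>B. P (Inr b))"
  by (auto simp: Plus_def)

lemma Plus_eq_iff: "A <+> B = C <+> D \<longleftrightarrow> A = C \<and> B = D"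
  by (auto simp: set_eq_iff split_sum_all Plus_def image_iff)

lemma Plus_insert0: "A <+> {..<Suc n} = insert (Inr 0) (A <+> Suc ` {..<n})"
  by (auto simp: lessThan_Suc_eq_insert_0)

lemma line_gamma_path:
  assumes "symp q" shows "line_gamma q N {} n m = path_gamma n"
proof -
  have "({} :: 'a set) <+> {..<n} = Inr ` {..<n}" by auto
  moreover have "symp (\<lambda>i j. i = Suc j \<or> j = Suc i)" by (auto simp: symp_def)
  moreover have "graph_gamma (hub q N m) (Inr ` {..<n}) = graph_gamma (\<lambda>i j. i = Suc j \<or> j = Suc i) {..<n}"
    by (rule graph_gamma_image) (use assms calculation(2) in \<open>auto simp: embeds_def symp_hub\<close>)
  ultimately show ?thesis unfolding line_gamma_def path_gamma_def by simp
qed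

lemma line_gamma_reflect:
  assumes "symp q" "finite A" "m < n"
  shows "line_gamma q N A n (n - 1 - m) = line_gamma q N A n m"
proof -
  let ?\<phi> = "map_sum id (\<lambda>i. n - 1 - i) :: 'a + nat \<Rightarrow> 'a + nat"
  have "(\<lambda>i. n - 1 - i) ` {..<n} = {..<n}"
  proof (intro equalityI subsetI)
    fix i assume "i \<in> {..<n}"
    then show "i \<in> (\<lambda>i. n - 1 - i) ` {..<n}" by (intro image_eqI[of _ _ "n - 1 - i"]) auto
  qed auto
  moreover have "?\<phi> ` (A <+> {..<n}) = A <+> (\<lambda>i. n - 1 - i) ` {..<n}"
    by (auto simp: Plus_def image_Un image_image)
  ultimately have im: "?\<phi> ` (A <+> {..<n}) = A <+> {..<n}" by simp
  have "embeds (hub q N m) (A <+> {..<n}) (hub q N (n - 1 - m)) ?\<phi>"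
    unfolding embeds_def inj_on_def using assms by auto
  then have "graph_gamma (hub q N (n - 1 - m)) (?\<phi> ` (A <+> {..<n})) = graph_gamma (hub q N m) (A <+> {..<n})"
    using assms by (intro graph_gamma_image symp_hub) auto
  then show ?thesis unfolding im line_gamma_def .
qed

text \<open>
  Deleting the end edge isolates the end vertex, so only the shifted line with one vertex less counts.
\<close>

lemma line_gamma_del_edge:
  assumes "symp q" "finite A"
  shows "graph_gamma (del_edge (hub q N (Suc m)) (Inr 0) (Inr (Suc 0))) (A <+> {..<Suc n}) = line_gamma q N A n m"
proof -
  let ?r = "del_edge (hub q N (Suc m)) (Inr 0) (Inr (Suc 0))"
  let ?\<phi> = "map_sum id Suc :: 'a + nat \<Rightarrow> 'a + nat"
  have "?r (Inr 0) x = False" for x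
    by (cases x) (auto simp: del_edge_def)
  then have "graph_gamma ?r (A <+> {..<Suc n}) = graph_gamma ?r (A <+> Suc ` {..<n})"
    unfolding Plus_insert0 using assms by (intro graph_gamma_isolated symp_del_edge symp_hub) auto
  also have "A <+> Suc ` {..<n} = ?\<phi> ` (A <+> {..<n})"
    by (auto simp: Plus_def image_Un image_image)
  also have "graph_gamma ?r (?\<phi> ` (A <+> {..<n})) = graph_gamma (hub q N m) (A <+> {..<n})"
  proof (rule graph_gamma_image)
    show "embeds (hub q N m) (A <+> {..<n}) ?r ?\<phi>"
      unfolding embeds_def inj_on_def by (auto simp: del_edge_def doubleton_eq_iff)
  qed (use assms in \<open>auto intro!: symp_del_edge symp_hub\<close>)
  finally show ?thesis by (simp add: line_gamma_def)
qed

lemma shift_image: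
  assumes "k \<le> n"
  shows "map_sum id (\<lambda>i. i + Suc k) ` (A <+> {..<n - k}) = A <+> {Suc k..<Suc n}"
proof -
  have "(\<lambda>i. i + Suc k) ` {..<n - k} = {Suc k..<Suc n}"
  proof (intro equalityI subsetI)
    fix i assume "i \<in> {Suc k..<Suc n}"
    then show "i \<in> (\<lambda>i. i + Suc k) ` {..<n - k}" by (intro image_eqI[of _ _ "i - Suc k"]) auto
  qed auto
  moreover have "map_sum id (\<lambda>i. i + Suc k) ` (A <+> {..<n - k}) = A <+> (\<lambda>i. i + Suc k) ` {..<n - k}"
    by (auto simp: Plus_def image_Un image_image)
  ultimately show ?thesis by simp
qed

text \<open>
  A segment that does not contain the hub has one neighbour outside, so its contraction only shortens the
  line.
\<close>

lemma line_gamma_reconnect_path: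
  assumes "symp q" "finite A" "k \<le> m" "m < n"
  shows "graph_gamma (reconnect (hub q N (Suc m)) ({} <+> {..<Suc k})) ((A <+> {..<Suc n}) - ({} <+> {..<Suc k}))
    = line_gamma q N A (n - k) (m - k)"
proof -
  let ?r = "reconnect (hub q N (Suc m)) ({} <+> {..<Suc k})"
  let ?\<phi> = "map_sum id (\<lambda>i. i + Suc k) :: 'a + nat \<Rightarrow> 'a + nat"
  have nl: "(\<exists>i\<in>{} <+> {..<Suc k}. hub q N (Suc m) (Inl a) i) = False" for a using assms by auto
  have nr: "(\<exists>i\<in>{} <+> {..<Suc k}. hub q N (Suc m) (Inr (j + Suc k)) i) \<longleftrightarrow> j = 0" for j
    unfolding bex_Plus by (auto intro!: bexI[of _ k])
  have rel: "?r (Inl a) (Inl b) \<longleftrightarrow> q a b" "?r (Inl a) (Inr (j + Suc k)) \<longleftrightarrow> a \<in> N \<and> j = m - k"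
    "?r (Inr (j + Suc k)) (Inl a) \<longleftrightarrow> a \<in> N \<and> j = m - k"
    "i \<noteq> j \<Longrightarrow> ?r (Inr (i + Suc k)) (Inr (j + Suc k)) \<longleftrightarrow> i = Suc j \<or> j = Suc i" for a b i j
    unfolding reconnect_def nl nr using assms by auto
  have "(A <+> {..<Suc n}) - ({} <+> {..<Suc k}) = A <+> {Suc k..<Suc n}" by auto
  also have "\<dots> = ?\<phi> ` (A <+> {..<n - k})" using assms by (intro shift_image[symmetric]) auto
  also have "graph_gamma ?r (?\<phi> ` (A <+> {..<n - k})) = graph_gamma (hub q N (m - k)) (A <+> {..<n - k})"
  proof (rule graph_gamma_image)
    show "embeds (hub q N (m - k)) (A <+> {..<n - k}) ?r ?\<phi>"
      unfolding embeds_def inj_on_def by (auto simp: rel simp del: add_Suc_right)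
  qed (use assms in \<open>auto intro!: symp_reconnect symp_hub\<close>)
  finally show ?thesis by (simp add: line_gamma_def)
qed

lemma line_gamma_reconnect_hub:
  assumes "symp q" "finite A" "J \<subseteq> A" "m < k" "k \<le> n"
  shows "graph_gamma (reconnect (hub q N (Suc m)) (J <+> {..<Suc k})) ((A <+> {..<Suc n}) - (J <+> {..<Suc k}))
    = line_gamma (hub_con q N J) (hub_nbrs q N J) (A - J) (n - k) 0"
proof -
  let ?r = "reconnect (hub q N (Suc m)) (J <+> {..<Suc k})"
  let ?\<phi> = "map_sum id (\<lambda>i. i + Suc k) :: 'a + nat \<Rightarrow> 'a + nat"
  have nl: "(\<exists>i\<in>J <+> {..<Suc k}. hub q N (Suc m) (Inl a) i) \<longleftrightarrow> a \<in> hub_nbrs q N J" for a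
    unfolding bex_Plus using assms by (auto simp: hub_nbrs_def)
  have nr: "(\<exists>i\<in>J <+> {..<Suc k}. hub q N (Suc m) (Inr (j + Suc k)) i) \<longleftrightarrow> j = 0" for j
    unfolding bex_Plus using assms by (auto intro!: bexI[of _ k])
  have rel: "?r (Inl a) (Inl b) \<longleftrightarrow> hub_con q N J a b"
    "?r (Inl a) (Inr (j + Suc k)) \<longleftrightarrow> a \<in> hub_nbrs q N J \<and> j = 0"
    "?r (Inr (j + Suc k)) (Inl a) \<longleftrightarrow> a \<in> hub_nbrs q N J \<and> j = 0"
    "i \<noteq> j \<Longrightarrow> ?r (Inr (i + Suc k)) (Inr (j + Suc k)) \<longleftrightarrow> i = Suc j \<or> j = Suc i" for a b i j
    unfolding reconnect_def nl nr using assms by (auto simp: hub_con_def)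
  have rel0: "?r (Inl a) (Inr (Suc k)) \<longleftrightarrow> a \<in> hub_nbrs q N J" "?r (Inr (Suc k)) (Inl a) \<longleftrightarrow> a \<in> hub_nbrs q N J" for a
    using rel(2)[of a 0] rel(3)[of 0 a] by simp_all
  have "(A <+> {..<Suc n}) - (J <+> {..<Suc k}) = (A - J) <+> {Suc k..<Suc n}" by auto
  also have "\<dots> = ?\<phi> ` ((A - J) <+> {..<n - k})" using assms by (intro shift_image[symmetric]) auto
  also have "graph_gamma ?r (?\<phi> ` ((A - J) <+> {..<n - k})) = graph_gamma (hub (hub_con q N J) (hub_nbrs q N J) 0) ((A - J) <+> {..<n - k})"
  proof (rule graph_gamma_image)
    show "embeds (hub (hub_con q N J) (hub_nbrs q N J) 0) ((A - J) <+> {..<n - k}) ?r ?\<phi>"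
      unfolding embeds_def inj_on_def by (auto simp: rel rel0 simp del: add_Suc_right)
  qed (use assms in \<open>auto intro!: symp_reconnect symp_hub symp_hub_con\<close>)
  finally show ?thesis by (simp add: line_gamma_def)
qed

lemma connI_root:
  assumes "symp r" "z \<in> I" "\<And>x. x \<in> I \<Longrightarrow> reach r I z x"
  shows "conn r I"
  unfolding conn_def
proof (intro conjI ballI)
  fix x y assume "x \<in> I" "y \<in> I"
  then show "reach r I x y" using reach_trans[OF reach_sym[OF assms(1) assms(3)] assms(3)] by blast
qed (use assms(2) in auto)

lemma reach_line: "i < k \<Longrightarrow> reach (hub q N m) (J <+> {..<k}) (Inr 0) (Inr i)"
proof (induction i)
  case (Suc i)
  then have "reach (hub q N m) (J <+> {..<k}) (Inr 0) (Inr i)" by simp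
  then show ?case by (rule reach_step) (use Suc.prems in auto)
qed simp

text \<open>
  A connected set that contains the end \<open>Inr 0\<close> meets the line in an initial segment \<open>{..<k}\<close>. It can
  leave the line only through the hub \<open>Inr m\<close>.
\<close>

lemma conn_hub_iff:
  assumes q: "symp q" and I: "I \<subseteq> A <+> {..<n}" "Inr 0 \<in> I"
  shows "conn (hub q N m) I \<longleftrightarrow>
    (\<exists>k. I = {} <+> {..<k} \<and> k \<le> m) \<or> (\<exists>J k. I = J <+> {..<k} \<and> m < k \<and> attached q N J)"
proof
  assume "(\<exists>k. I = {} <+> {..<k} \<and> k \<le> m) \<or> (\<exists>J k. I = J <+> {..<k} \<and> m < k \<and> attached q N J)"
  then show "conn (hub q N m) I"
  proof (elim disjE exE conjE)
    fix k assume k: "I = {} <+> {..<k}" "k \<le> m"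
    then show ?thesis using I reach_line
      by (intro connI_root[OF symp_hub[OF q], of "Inr 0"]) auto
  next
    fix J k assume k: "I = J <+> {..<k}" "m < k" "attached q N J"
    show ?thesis
    proof (rule connI_root[OF symp_hub[OF q] I(2)])
      fix x assume "x \<in> I"
      then consider a where "x = Inl a" "a \<in> J" | i where "x = Inr i" "i < k" using k by auto
      then show "reach (hub q N m) I (Inr 0) x"
      proof cases
        case 1
        then obtain b where b: "b \<in> N" "b \<in> J" "reach q J a b" using k by (auto simp: attached_def)
        have "reach (hub q N m) (Inl ` J) (Inl a) (Inl b)"
          by (rule reach_image[OF _ b(3)]) auto
        then have "reach (hub q N m) I (Inl a) (Inl b)"
          by (rule reach_mono) (use k in auto)
        from reach_sym[OF symp_hub[OF q] this] have ba: "reach (hub q N m) I (Inl b) (Inl a)" .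
        have "reach (hub q N m) I (Inr 0) (Inr m)" using reach_line[of m k] k by simp
        then have "reach (hub q N m) I (Inr 0) (Inl b)"
          by (rule reach_step) (use b k in auto)
        from reach_trans[OF this ba] show ?thesis using 1 by simp
      qed (use reach_line k in auto)
    qed
  qed
next
  assume c: "conn (hub q N m) I"
  define J where "J = {a. Inl a \<in> I}"
  have "\<exists>k. Inr k \<notin> I" using I by (intro exI[of _ n]) auto
  define k where "k = (LEAST k. Inr k \<notin> I)"
  have k: "Inr k \<notin> I" unfolding k_def by (rule LeastI_ex) fact
  have kl: "Inr i \<in> I" if "i < k" for i using not_less_Least[of i] that by (auto simp: k_def)
  have k0: "0 < k" using k I(2) by (cases k) auto
  note sub = conn_subset_closed[OF c subset_refl _ I(2)]
  show "(\<exists>k. I = {} <+> {..<k} \<and> k \<le> m) \<or> (\<exists>J k. I = J <+> {..<k} \<and> m < k \<and> attached q N J)"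
  proof (cases "k \<le> m")
    case True
    have "closed_in (hub q N m) I ({} <+> {..<k})"
      unfolding closed_in_def
    proof (intro conjI ballI impI)
      fix x y assume "x \<in> {} <+> {..<k}" "y \<in> I" "hub q N m x y"
      then obtain i where i: "x = Inr i" "i < k" by auto
      then obtain j where "y = Inr j" "i = Suc j \<or> j = Suc i"
        using \<open>hub q N m x y\<close> True by (cases y) auto
      moreover have "j \<noteq> k" using calculation k \<open>y \<in> I\<close> by auto
      ultimately show "y \<in> {} <+> {..<k}" using i by auto
    qed (use kl in auto)
    then have "I \<subseteq> {} <+> {..<k}" by (rule sub) (use k0 in auto)
    then have "I = {} <+> {..<k}" using kl by auto
    then show ?thesis using True by blast
  next
    case False
    \<comment> \<open>the vertices of \<open>J\<close> attached to the hub; nothing else in \<open>I\<close> is adjacent to them or to the line\<close>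
    define D where "D = {a \<in> J. \<exists>x\<in>N \<inter> J. reach q J a x}"
    have "closed_in (hub q N m) I (D <+> {..<k})"
      unfolding closed_in_def
    proof (intro conjI ballI impI)
      fix x y assume x: "x \<in> D <+> {..<k}" and y: "y \<in> I" and e: "hub q N m x y"
      show "y \<in> D <+> {..<k}"
      proof (cases y)
        case (Inl b)
        then have bJ: "b \<in> J" using y by (simp add: J_def)
        show ?thesis
        proof (cases x)
          case (Inl a)
          then have a: "a \<in> D" "q b a" using x e \<open>y = Inl b\<close> q by (auto dest: sympD)
          then obtain z where z: "z \<in> N \<inter> J" "reach q J a z" "a \<in> J" by (auto simp: D_def)
          have "reach q J b z" by (rule reach_trans[OF reach_edge z(2)]) (use a z bJ in auto)
          then show ?thesis using \<open>y = Inl b\<close> bJ z by (auto simp: D_def)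
        next
          case (Inr i)
          then have "b \<in> N" using e \<open>y = Inl b\<close> by simp
          then show ?thesis using \<open>y = Inl b\<close> bJ by (auto simp: D_def intro: bexI[of _ b])
        qed
      next
        case (Inr j)
        then have "j \<noteq> k" using k y by auto
        then show ?thesis using x e Inr False by (cases x) auto
      qed
    qed (use kl in \<open>auto simp: D_def J_def\<close>)
    then have IsubD: "I \<subseteq> D <+> {..<k}" by (rule sub) (use k0 in auto)
    have "D \<subseteq> J" by (auto simp: D_def)
    moreover have "J \<subseteq> D" using IsubD by (auto simp: J_def)
    ultimately have DJ: "D = J" by simp
    then have "I = J <+> {..<k}" using IsubD kl by (auto simp: J_def)
    moreover have "attached q N J" using DJ by (auto simp: attached_def D_def)
    ultimately show ?thesis using False by (metis not_le)
  qed
qed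

text \<open>
  The edge deletion formula for the edge between the first two vertices of the line, with the sets \<open>I\<close>
  sorted by \<open>conn_hub_iff\<close>: the first sum belongs to the segments \<open>{..k}\<close> not containing the hub, the
  second one to the sets that consist of \<open>J\<close> and a segment \<open>{..k}\<close> containing the hub. The pair \<open>(A, n)\<close> is
  the whole graph, which is excluded.
\<close>

lemma line_gamma_leaf:
  assumes q: "symp q" and fin: "finite A" and "attached q N A" "m < n"
  shows "line_gamma q N A (Suc n) (Suc m) = line_gamma q N A n m + xp 1 *
    ((\<Sum>k\<in>{1..m}. path_gamma k * line_gamma q N A (n - k) (m - k)) +
     (\<Sum>(J, k)\<in>{J. J \<subseteq> A \<and> attached q N J} \<times> {m<..n} - {(A, n)}.
        line_gamma q N J k m * line_gamma (hub_con q N J) (hub_nbrs q N J) (A - J) (n - k) 0))"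
proof -
  let ?r = "hub q N (Suc m)" and ?a = "Inr 0 :: 'a + nat" and ?b = "Inr (Suc 0) :: 'a + nat"
  let ?V = "A <+> {..<Suc n}" and ?r' = "del_edge (hub q N (Suc m)) (Inr 0) (Inr (Suc 0))"
  define P where "P = {J. J \<subseteq> A \<and> attached q N J} \<times> {m<..n} - {(A, n)}"
  define f where "f = (\<lambda>k. ({} :: 'a set) <+> {..<Suc k})"
  define h where "h = (\<lambda>(J :: 'a set, k). J <+> {..<Suc k})"
  note r = symp_hub[OF q, of N "Suc m"]
  have "conn ?r ?V"
    using assms conn_hub_iff[OF q subset_refl, of A "Suc n" N "Suc m"] by auto
  then have cV: "comps ?r ?V = {?V}" by (rule conn_comps[OF r])
  have nc: "\<not> conn ?r' I" if "?a \<in> I" "?b \<in> I" for I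
  proof
    assume c: "conn ?r' I"
    have "?r' ?a x = False" for x by (cases x) (auto simp: del_edge_def)
    then have "closed_in ?r' I {?a}" using that by (auto simp: closed_in_def)
    then have "I \<subseteq> {?a}" by (rule conn_subset_closed[OF c subset_refl _ that(1)]) simp
    then show False using that by auto
  qed
  have set: "splits ?r ?a ?b ?V - comps ?r ?V = f ` {1..m} \<union> h ` P"
  proof (intro equalityI subsetI)
    fix I assume "I \<in> splits ?r ?a ?b ?V - comps ?r ?V"
    then have I: "I \<subseteq> ?V" "?a \<in> I" "?b \<in> I" "conn ?r I" "I \<noteq> ?V" by (auto simp: splits_def cV)
    from iffD1[OF conn_hub_iff[OF q I(1,2)] I(4)]
    consider k where "I = {} <+> {..<k}" "k \<le> Suc m"
      | J k where "I = J <+> {..<k}" "Suc m < k" "attached q N J"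
      by (elim disjE exE conjE)
    then show "I \<in> f ` {1..m} \<union> h ` P"
    proof cases
      case 1
      then have "I = f (k - 1)" "k - 1 \<in> {1..m}" using I(3) by (auto simp: f_def)
      then show ?thesis by blast
    next
      case 2
      have J: "J \<subseteq> A" using I(1) 2 by auto
      have "Inr (k - 1) \<in> I" using 2 by auto
      then have "k \<le> Suc n" using I(1) by auto
      moreover have "(J, k - 1) \<noteq> (A, n)" using I(5) 2 by auto
      ultimately have "(J, k - 1) \<in> P" using 2 J unfolding P_def by auto
      moreover have "I = h (J, k - 1)" using 2 by (auto simp: h_def)
      ultimately show ?thesis by blast
    qed
  next
    fix I assume "I \<in> f ` {1..m} \<union> h ` P"
    then consider k where "I = f k" "k \<in> {1..m}" | J k where "I = h (J, k)" "(J, k) \<in> P" by auto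
    then have "I \<subseteq> ?V \<and> ?a \<in> I \<and> ?b \<in> I \<and> conn ?r I \<and> I \<noteq> ?V"
    proof cases
      case 1
      have I: "I \<subseteq> ?V" "?a \<in> I" "?b \<in> I" using 1 assms by (auto simp: f_def)
      moreover have "conn ?r I" using conn_hub_iff[OF q I(1,2)] 1 by (auto simp: f_def)
      moreover have "I \<noteq> ?V" using 1 assms by (auto simp: f_def Plus_eq_iff)
      ultimately show ?thesis by blast
    next
      case 2
      have I: "I \<subseteq> ?V" "?a \<in> I" "?b \<in> I" using 2 assms by (auto simp: h_def P_def)
      moreover have "conn ?r I" unfolding conn_hub_iff[OF q I(1,2)]
        using 2 by (intro disjI2 exI[of _ J] exI[of _ "Suc k"]) (auto simp: h_def P_def)
      moreover have "I \<noteq> ?V" using 2 by (auto simp: h_def P_def Plus_eq_iff)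
      ultimately show ?thesis by blast
    qed
    then show "I \<in> splits ?r ?a ?b ?V - comps ?r ?V" using nc by (auto simp: splits_def cV)
  qed
  have inj_f: "inj_on f {1..m}" by (auto simp: f_def inj_on_def Plus_eq_iff)
  have inj_h: "inj_on h P"
  proof (rule inj_onI)
    fix p p' assume "h p = h p'"
    then show "p = p'" by (cases p; cases p') (simp add: h_def Plus_eq_iff)
  qed
  have "f k \<noteq> h p" if "k \<in> {1..m}" "p \<in> P" for k p
    using that by (cases p) (auto simp only: f_def h_def P_def Plus_eq_iff lessThan_eq_iff prod.case, auto)
  then have dj: "f ` {1..m} \<inter> h ` P = {}" by blast
  have finP: "finite P" unfolding P_def using fin by auto
  let ?t = "\<lambda>I. graph_gamma ?r' I * graph_gamma (reconnect ?r I) (?V - I)"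
  have "line_gamma q N A (Suc n) (Suc m) = graph_gamma ?r' ?V + xp 1 * (\<Sum>I\<in>splits ?r ?a ?b ?V - comps ?r ?V. ?t I)"
    unfolding line_gamma_def by (rule graph_gamma_del_edge[OF r]) (use fin assms(4) in auto)
  also have "graph_gamma ?r' ?V = line_gamma q N A n m" by (rule line_gamma_del_edge[OF q fin])
  also have "(\<Sum>I\<in>splits ?r ?a ?b ?V - comps ?r ?V. ?t I) = (\<Sum>k\<in>{1..m}. ?t (f k)) + (\<Sum>p\<in>P. ?t (h p))"
  proof -
    have "sum ?t (f ` {1..m} \<union> h ` P) = sum ?t (f ` {1..m}) + sum ?t (h ` P)"
      by (rule sum.union_disjoint) (use finP dj in auto)
    then show ?thesis unfolding set sum.reindex[OF inj_f] sum.reindex[OF inj_h] o_def .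
  qed
  also have "(\<Sum>k\<in>{1..m}. ?t (f k)) = (\<Sum>k\<in>{1..m}. path_gamma k * line_gamma q N A (n - k) (m - k))"
    using assms by (intro sum.cong refl) (simp add: f_def line_gamma_del_edge line_gamma_reconnect_path line_gamma_path)
  also have "(\<Sum>p\<in>P. ?t (h p)) =
      (\<Sum>(J, k)\<in>P. line_gamma q N J k m * line_gamma (hub_con q N J) (hub_nbrs q N J) (A - J) (n - k) 0)"
  proof (rule sum.cong[OF refl])
    fix p assume "p \<in> P"
    then obtain J k where p: "p = (J, k)" "J \<subseteq> A" "m < k" "k \<le> n" by (auto simp: P_def)
    have "finite J" using p fin finite_subset by blast
    then show "?t (h p) = (case p of (J, k) \<Rightarrow> line_gamma q N J k m * line_gamma (hub_con q N J) (hub_nbrs q N J) (A - J) (n - k) 0)"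
      using p assms by (simp add: h_def line_gamma_del_edge line_gamma_reconnect_hub)
  qed
  finally show ?thesis unfolding P_def .
qed

section \<open>The gamma polynomial grows as the hub moves to the middle\<close>

definition poly_le :: "int poly \<Rightarrow> int poly \<Rightarrow> bool" where
  "poly_le p q \<longleftrightarrow> (\<forall>i. coeff p i \<le> coeff q i)"

lemma poly_le_refl: "poly_le p p" by (simp add: poly_le_def)

lemma poly_le_trans: "poly_le p q \<Longrightarrow> poly_le q r \<Longrightarrow> poly_le p r"
  unfolding poly_le_def using order_trans by blast

lemma poly_le_add: "poly_le p q \<Longrightarrow> poly_le p' q' \<Longrightarrow> poly_le (p + p') (q + q')"
  by (simp add: poly_le_def add_mono)

lemma poly_le_sum: "(\<And>x. x \<in> A \<Longrightarrow> poly_le (f x) (g x)) \<Longrightarrow> poly_le (sum f A) (sum g A)"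
  by (simp add: poly_le_def coeff_sum sum_mono)

lemma poly_le_sum_subset:
  assumes "finite B" "A \<subseteq> B" "\<And>x. x \<in> B - A \<Longrightarrow> poly_le 0 (f x)"
  shows "poly_le (sum f A) (sum f B)"
  using assms unfolding poly_le_def by (auto simp: coeff_sum intro!: sum_mono2)

lemma poly_le_mult_right: "poly_le p q \<Longrightarrow> poly_le 0 r \<Longrightarrow> poly_le (p * r) (q * r)"
  by (simp add: poly_le_def coeff_mult sum_mono mult_right_mono)

lemma poly_le_shift: "poly_le p q \<Longrightarrow> poly_le (xp k * p) (xp k * q)"
  by (simp add: poly_le_def coeff_monom_mult)

lemma poly_le_mult_nonneg: "poly_le 0 p \<Longrightarrow> poly_le 0 q \<Longrightarrow> poly_le 0 (p * q)"
  using poly_le_mult_right[of 0 p q] by simp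

lemma line_gamma_nonneg:
  assumes "symp q" "finite A" shows "poly_le 0 (line_gamma q N A n m)"
  using graph_gamma_nonneg[OF symp_hub[OF assms(1)], of "A <+> {..<n}" N m] assms(2) by (simp add: poly_le_def line_gamma_def)

text \<open>
  For \<open>J = A\<close> the contraction is a path. These terms are separated because they will cancel.
\<close>

lemma line_gamma_leaf_grouped:
  assumes q: "symp q" and fin: "finite A" and A: "attached q N A" and mn: "m < n"
  defines "Q \<equiv> \<lambda>J k. line_gamma (hub_con q N J) (hub_nbrs q N J) (A - J) k 0"
  shows "line_gamma q N A (Suc n) (Suc m) = line_gamma q N A n m + xp 1 *
    ((\<Sum>k\<in>{1..m}. path_gamma k * line_gamma q N A (n - k) (m - k)) +
     (\<Sum>k\<in>{m<..<n}. line_gamma q N A k m * path_gamma (n - k)) +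
     (\<Sum>J | J \<subset> A \<and> attached q N J. line_gamma q N J n m * Q J 0 +
        (\<Sum>k\<in>{m<..<n}. line_gamma q N J k m * Q J (n - k))))"
proof -
  define F where "F = (\<lambda>J k. line_gamma q N J k m * Q J (n - k))"
  define P where "P = {J. J \<subset> A \<and> attached q N J}"
  have finP: "finite P" unfolding P_def by (rule finite_subset[of _ "Pow A"]) (use fin in auto)
  have k: "{m<..n} = insert n {m<..<n}" using mn by auto
  have "{J. J \<subseteq> A \<and> attached q N J} = insert A P" using A by (auto simp: P_def)
  then have s: "{J. J \<subseteq> A \<and> attached q N J} \<times> {m<..n} - {(A, n)} = Pair A ` {m<..<n} \<union> P \<times> {m<..n}"
    using mn by (auto simp: P_def)
  have "(\<Sum>(J, k)\<in>{J. J \<subseteq> A \<and> attached q N J} \<times> {m<..n} - {(A, n)}. F J k) =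
    (\<Sum>(J, k)\<in>Pair A ` {m<..<n}. F J k) + (\<Sum>(J, k)\<in>P \<times> {m<..n}. F J k)"
    unfolding s by (rule sum.union_disjoint) (use finP in \<open>auto simp: P_def\<close>)
  also have "(\<Sum>(J, k)\<in>Pair A ` {m<..<n}. F J k) = (\<Sum>k\<in>{m<..<n}. F A k)"
    by (subst sum.reindex) (auto simp: inj_on_def)
  also have "\<dots> = (\<Sum>k\<in>{m<..<n}. line_gamma q N A k m * path_gamma (n - k))"
    unfolding F_def Q_def using line_gamma_path[OF symp_hub_con[OF q]] by (simp add: Diff_cancel)
  also have "(\<Sum>(J, k)\<in>P \<times> {m<..n}. F J k) = (\<Sum>J\<in>P. \<Sum>k\<in>{m<..n}. F J k)"
    by (rule sum.cartesian_product[symmetric])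
  also have "\<dots> = (\<Sum>J\<in>P. F J n + (\<Sum>k\<in>{m<..<n}. F J k))"
    unfolding k by (intro sum.cong refl sum.insert) auto
  finally show ?thesis
    unfolding line_gamma_leaf[OF q fin A mn] F_def P_def Q_def by (simp add: add.assoc)
qed

text \<open>
  The left side comes from the segments in the formula for the hub at \<open>m' + 1\<close>, the right side from the
  sets containing all of \<open>A\<close> in the formula for the hub at \<open>m + 1\<close>. Reversing the line identifies them
  when \<open>m' + 1\<close> is the mirror image of \<open>m\<close>.
\<close>

lemma segment_sum:
  assumes "symp q" "finite A" "m + m' + 1 = n"
  shows "(\<Sum>k\<in>{1..m'}. path_gamma k * line_gamma q N A (n - k) (m' - k)) =
    (\<Sum>k\<in>{m<..<n}. line_gamma q N A k m * path_gamma (n - k))"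
proof (rule sum.reindex_bij_witness[where i = "\<lambda>k. n - k" and j = "\<lambda>k. n - k"])
  fix k assume k: "k \<in> {1..m'}"
  then have "line_gamma q N A (n - k) (n - k - 1 - m) = line_gamma q N A (n - k) m"
    using assms by (intro line_gamma_reflect) auto
  moreover have "n - k - 1 - m = m' - k" "n - (n - k) = k" using k assms by auto
  ultimately show "line_gamma q N A (n - k) m * path_gamma (n - (n - k)) = path_gamma k * line_gamma q N A (n - k) (m' - k)"
    by simp
qed (use assms in auto)

text \<open>
  It suffices to move the hub by one position, from \<open>m\<close> to \<open>m + 1\<close>, within the first half of the line; the
  second half is handled by reversing the line. Seen from the other end, the position \<open>m\<close> is \<open>m' + 1\<close> with
  \<open>m + m' + 1 = n\<close>, so both polynomials can be expanded by \<open>line_gamma_leaf_grouped\<close>. By \<open>segment_sum\<close> the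
  expansions differ only in the terms with \<open>J \<subset> A\<close>. There the hub sits at \<open>m'\<close> and at \<open>m\<close> on a shorter line
  of \<open>k < n\<close> vertices, and \<open>m'\<close> is farther from the middle than \<open>m\<close>.
\<close>

theorem line_gamma_mono:
  assumes q: "symp q" and "finite A" "attached q N A" "i \<le> j" "i + j < n"
  shows "poly_le (line_gamma q N A n i) (line_gamma q N A n j)"
  using assms(2-)
proof (induction n arbitrary: A i j rule: less_induct)
  case (less n0)
  note fin = \<open>finite A\<close>
  have step: "poly_le (line_gamma q N A n0 m) (line_gamma q N A n0 (Suc m))" if m: "2 * m + 2 < n0" for m
  proof -
    define n where "n = n0 - 1"
    define m' where "m' = n - 1 - m"
    have n0: "n0 = Suc n" and mn: "m < n" and m': "m + m' + 1 = n" "m' + m + 1 = n" "m' < n" "m \<le> m'"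
      using m by (auto simp: n_def m'_def)
    have "line_gamma q N A (Suc n) m = line_gamma q N A (Suc n) (Suc n - 1 - m)"
      using mn by (intro line_gamma_reflect[OF q fin, symmetric]) auto
    also have "Suc n - 1 - m = Suc m'" using m' by simp
    finally have r0: "line_gamma q N A (Suc n) m = line_gamma q N A (Suc n) (Suc m')" .
    have r1: "line_gamma q N J n m' = line_gamma q N J n m" if "finite J" for J
      using line_gamma_reflect[OF q that mn] by (simp add: m'_def)
    define Q where "Q = (\<lambda>J k. line_gamma (hub_con q N J) (hub_nbrs q N J) (A - J) k 0)"
    have Qn: "poly_le 0 (Q J k)" for J k unfolding Q_def using fin by (intro line_gamma_nonneg symp_hub_con q) auto
    have "poly_le (\<Sum>k\<in>{m'<..<n}. line_gamma q N J k m' * Q J (n - k)) (\<Sum>k\<in>{m<..<n}. line_gamma q N J k m * Q J (n - k))"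
      if J: "J \<subset> A" "attached q N J" for J
    proof -
      have finJ: "finite J" using J fin finite_subset by blast
      have "poly_le (\<Sum>k\<in>{m'<..<n}. line_gamma q N J k m' * Q J (n - k)) (\<Sum>k\<in>{m'<..<n}. line_gamma q N J k m * Q J (n - k))"
      proof (intro poly_le_sum poly_le_mult_right Qn)
        fix k assume k: "k \<in> {m'<..<n}"
        \<comment> \<open>reversed, the position \<open>m'\<close> becomes \<open>k - 1 - m' \<le> m\<close>, as \<open>k < n\<close>\<close>
        have "line_gamma q N J k (k - 1 - m') = line_gamma q N J k m'"
          using k by (intro line_gamma_reflect[OF q finJ]) auto
        moreover have "poly_le (line_gamma q N J k (k - 1 - m')) (line_gamma q N J k m)"
          using k m' n0 finJ J by (intro less.IH) auto
        ultimately show "poly_le (line_gamma q N J k m') (line_gamma q N J k m)" by simp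
      qed
      moreover have "poly_le (\<Sum>k\<in>{m'<..<n}. line_gamma q N J k m * Q J (n - k)) (\<Sum>k\<in>{m<..<n}. line_gamma q N J k m * Q J (n - k))"
        using m' by (intro poly_le_sum_subset poly_le_mult_nonneg Qn line_gamma_nonneg q finJ) auto
      ultimately show ?thesis by (rule poly_le_trans)
    qed
    then have main: "poly_le
      (\<Sum>J | J \<subset> A \<and> attached q N J. line_gamma q N J n m' * Q J 0 + (\<Sum>k\<in>{m'<..<n}. line_gamma q N J k m' * Q J (n - k)))
      (\<Sum>J | J \<subset> A \<and> attached q N J. line_gamma q N J n m * Q J 0 + (\<Sum>k\<in>{m<..<n}. line_gamma q N J k m * Q J (n - k)))"
      using r1 finite_subset[OF _ fin] by (intro poly_le_sum poly_le_add) (auto simp: psubset_eq poly_le_refl)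
    have swap: "poly_le (p + xp 1 * ((s + t) + R')) (p + xp 1 * ((t + s) + R))" if "poly_le R' R" for p s t R R'
      unfolding add.commute[of s t] using that by (intro poly_le_add poly_le_shift poly_le_refl)
    show ?thesis
      unfolding n0 r0 line_gamma_leaf_grouped[OF q fin \<open>attached q N A\<close> mn]
        line_gamma_leaf_grouped[OF q fin \<open>attached q N A\<close> m'(3)] r1[OF fin]
        segment_sum[OF q fin m'(1)] segment_sum[OF q fin m'(2)]
      by (rule swap[OF main[unfolded Q_def]])
  qed
  have chain: "poly_le (line_gamma q N A n0 i) (line_gamma q N A n0 j)" if "i \<le> j" "2 * j < n0" for i j
    using that
  proof (induction j)
    case (Suc j)
    show ?case
    proof (cases "i = Suc j")
      case False
      then have "poly_le (line_gamma q N A n0 i) (line_gamma q N A n0 j)" using Suc by auto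
      then show ?thesis by (rule poly_le_trans) (rule step, use Suc.prems in auto)
    qed (simp add: poly_le_refl)
  qed (simp add: poly_le_refl)
  show ?case
  proof (cases "2 * j < n0")
    case False
    have "line_gamma q N A n0 (n0 - 1 - j) = line_gamma q N A n0 j"
      using less.prems by (intro line_gamma_reflect[OF q fin]) auto
    moreover have "poly_le (line_gamma q N A n0 i) (line_gamma q N A n0 (n0 - 1 - j))"
      using False less.prems by (intro chain) auto
    ultimately show ?thesis by simp
  qed (use chain less.prems in auto)
qed

section \<open>Faces of a nestohedron\<close>

definition argmax :: "('a \<Rightarrow> real) \<Rightarrow> 'a set \<Rightarrow> 'a set" where
  "argmax y I = {i \<in> I. \<forall>j\<in>I. y j \<le> y i}"

lemma argmax_subset: "argmax y I \<subseteq> I"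
  by (auto simp: argmax_def)

lemma argmax_nonempty:
  assumes "finite I" "I \<noteq> {}" shows "argmax y I \<noteq> {}"
proof -
  have "Max (y ` I) \<in> y ` I" using assms by (intro Max_in) auto
  then obtain i where "i \<in> I" "y i = Max (y ` I)" by auto
  then have "i \<in> argmax y I" using assms by (auto simp: argmax_def)
  then show ?thesis by blast
qed

lemma argmax_eq_Max:
  assumes "finite I"  shows "argmax y I = {i \<in> I. y i = Max (y ` I)}"
proof (cases "I = {}")
  case False
  have "(\<forall>j\<in>I. y j \<le> y i) \<longleftrightarrow> y i = Max (y ` I)" if "i \<in> I" for i
    using assms that False by (auto simp: eq_Max_iff)
  then show ?thesis by (auto simp: argmax_def)
qed (simp add: argmax_def)

text \<open>
  In coordinates, the faces of a simplex are visible as vanishing conditions.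
\<close>

lemma std_simplex_iff:
  "x \<in> std_simplex I \<longleftrightarrow> (\<forall>i. 0 \<le> x $ i) \<and> (\<forall>i. i \<notin> I \<longrightarrow> x $ i = 0) \<and> sum (($) x) UNIV = 1"
proof
  define C :: "(real ^ 'a) set" where
    "C = {x. (\<forall>i. 0 \<le> x $ i) \<and> (\<forall>i. i \<notin> I \<longrightarrow> x $ i = 0) \<and> sum (($) x) UNIV = 1}"
  have "convex C"
    unfolding convex_def C_def by (auto simp: sum.distrib sum_distrib_left[symmetric])
  moreover have "(\<lambda>i. axis i 1) ` I \<subseteq> C"
    by (auto simp: C_def axis_def)
  ultimately have "std_simplex I \<subseteq> C" unfolding std_simplex_def by (rule hull_minimal[rotated])
  then show "x \<in> std_simplex I \<Longrightarrow> (\<forall>i. 0 \<le> x $ i) \<and> (\<forall>i. i \<notin> I \<longrightarrow> x $ i = 0) \<and> sum (($) x) UNIV = 1"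
    by (auto simp: C_def)
next
  assume x: "(\<forall>i. 0 \<le> x $ i) \<and> (\<forall>i. i \<notin> I \<longrightarrow> x $ i = 0) \<and> sum (($) x) UNIV = 1"
  have s: "sum f UNIV = sum f I" if "\<And>i. i \<notin> I \<Longrightarrow> f i = 0" for f :: "'a \<Rightarrow> 'b::comm_monoid_add"
    using that by (intro sum.mono_neutral_right) auto
  have "x = (\<Sum>i\<in>UNIV. x $ i *\<^sub>R axis i 1)"
    using basis_expansion[of x] by (simp add: scalar_mult_eq_scaleR)
  also have "\<dots> = (\<Sum>i\<in>I. x $ i *\<^sub>R axis i 1)" using x by (intro s) auto
  also have "\<dots> \<in> std_simplex I" unfolding std_simplex_def
    using x s[of "($) x"] by (intro convex_sum) (auto intro: hull_inc)
  finally show "x \<in> std_simplex I" .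
qed

lemma axis_in_std_simplex: "i \<in> I \<Longrightarrow> axis i 1 \<in> std_simplex I"
  unfolding std_simplex_def by (intro hull_inc) auto

lemma inner_axis_fun: "(\<chi> i. y i) \<bullet> (axis i 1 :: real ^ 'n) = y i"
  by (simp add: inner_axis)

text \<open>
  With \<open>M = Max (y ` I)\<close>, the difference \<open>M - y \<bullet> x\<close> is the sum of the nonnegative numbers \<open>(M - y i) x\<^sub>i\<close>.
\<close>

lemma std_simplex_inner:
  fixes y :: "'n::finite \<Rightarrow> real"
  assumes x: "x \<in> std_simplex I"
  shows "(\<chi> i. y i) \<bullet> x \<le> Max (y ` I)" "(\<chi> i. y i) \<bullet> x = Max (y ` I) \<longleftrightarrow> x \<in> std_simplex (argmax y I)"
proof -
  let ?M = "Max (y ` I)"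
  note x' = x[unfolded std_simplex_iff]
  have le: "y i * x $ i \<le> ?M * x $ i" for i
    using x' by (cases "i \<in> I") (auto intro: mult_right_mono)
  have M: "(\<Sum>i\<in>UNIV. ?M * x $ i) = ?M" using x' by (simp add: sum_distrib_left[symmetric])
  have in_sum: "(\<chi> i. y i) \<bullet> x = (\<Sum>i\<in>UNIV. y i * x $ i)" by (simp add: inner_vec_def)
  have "(\<Sum>i\<in>UNIV. y i * x $ i) \<le> (\<Sum>i\<in>UNIV. ?M * x $ i)" by (intro sum_mono le)
  then show "(\<chi> i. y i) \<bullet> x \<le> ?M" unfolding in_sum M .
  have "(\<chi> i. y i) \<bullet> x = ?M \<longleftrightarrow> (\<Sum>i\<in>UNIV. ?M * x $ i - y i * x $ i) = 0"
    unfolding in_sum using M by (auto simp: sum_subtractf)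
  also have "\<dots> \<longleftrightarrow> (\<forall>i. ?M * x $ i - y i * x $ i = 0)"
    using le by (subst sum_nonneg_eq_0_iff) auto
  also have "\<dots> \<longleftrightarrow> (\<forall>i. i \<notin> argmax y I \<longrightarrow> x $ i = 0)"
    using x' by (auto simp: argmax_eq_Max left_diff_distrib[symmetric]) metis
  also have "\<dots> \<longleftrightarrow> x \<in> std_simplex (argmax y I)" using x' by (auto simp: std_simplex_iff)
  finally show "(\<chi> i. y i) \<bullet> x = ?M \<longleftrightarrow> x \<in> std_simplex (argmax y I)" .
qed

lemma std_simplex_mono: "I \<subseteq> J \<Longrightarrow> std_simplex I \<subseteq> std_simplex J"
  unfolding std_simplex_def by (intro hull_mono) auto

text \<open>
  The face of the Minkowski sum in direction \<open>y\<close> is the sum of the faces of the summands in direction \<open>y\<close>.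
\<close>

definition nest_face :: "'n::finite set set \<Rightarrow> ('n \<Rightarrow> real) \<Rightarrow> (real ^ 'n) set" where
  "nest_face B y = (\<Sum>I\<in>B. std_simplex (argmax y I))"

lemma sum_std_simplex_iff:
  fixes B :: "'n::finite set set"
  shows "x \<in> (\<Sum>I\<in>B. std_simplex (S I)) \<longleftrightarrow> (\<exists>s. x = sum s B \<and> (\<forall>I\<in>B. s I \<in> std_simplex (S I)))"
  by (subst set_sum_alt) auto

lemma nest_face_support:
  fixes B :: "'n::finite set set"
  assumes B: "{} \<notin> B"
  defines "b \<equiv> \<lambda>y. \<Sum>I\<in>B. Max (y ` I)"
  shows "x \<in> nestohedron B \<Longrightarrow> (\<chi> i. y i) \<bullet> x \<le> b y"
    "nest_face B y = nestohedron B \<inter> {x. (\<chi> i. y i) \<bullet> x = b y}" "nest_face B y \<noteq> {}"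
proof -
  have in_sum: "(\<chi> i. y i) \<bullet> sum s B = (\<Sum>I\<in>B. (\<chi> i. y i) \<bullet> s I)" for s :: "'n set \<Rightarrow> real ^ 'n"
    by (simp add: inner_sum_right)
  have le: "(\<Sum>I\<in>B. (\<chi> i. y i) \<bullet> s I) \<le> b y" if "\<forall>I\<in>B. s I \<in> std_simplex I" for s
    unfolding b_def using that std_simplex_inner(1) by (intro sum_mono) blast
  show "x \<in> nestohedron B \<Longrightarrow> (\<chi> i. y i) \<bullet> x \<le> b y"
    unfolding nestohedron_def sum_std_simplex_iff using le in_sum by auto
  have eq: "(\<chi> i. y i) \<bullet> sum s B = b y \<longleftrightarrow> (\<forall>I\<in>B. s I \<in> std_simplex (argmax y I))"
    if s: "\<forall>I\<in>B. s I \<in> std_simplex I" for s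
  proof -
    have "(\<chi> i. y i) \<bullet> sum s B = b y \<longleftrightarrow> (\<Sum>I\<in>B. Max (y ` I) - (\<chi> i. y i) \<bullet> s I) = 0"
      unfolding in_sum b_def by (auto simp: sum_subtractf)
    also have "\<dots> \<longleftrightarrow> (\<forall>I\<in>B. Max (y ` I) - (\<chi> i. y i) \<bullet> s I = 0)"
      using s std_simplex_inner(1) by (subst sum_nonneg_eq_0_iff) auto
    also have "\<dots> \<longleftrightarrow> (\<forall>I\<in>B. s I \<in> std_simplex (argmax y I))"
      using s std_simplex_inner(2)[of _ _ y] by (intro ball_cong refl) fastforce
    finally show ?thesis .
  qed
  show "nest_face B y = nestohedron B \<inter> {x. (\<chi> i. y i) \<bullet> x = b y}"
  proof (intro equalityI subsetI)
    fix x assume "x \<in> nest_face B y"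
    then obtain s where s: "x = sum s B" "\<forall>I\<in>B. s I \<in> std_simplex (argmax y I)"
      unfolding nest_face_def sum_std_simplex_iff by blast
    then have "\<forall>I\<in>B. s I \<in> std_simplex I" using std_simplex_mono[OF argmax_subset] by blast
    then show "x \<in> nestohedron B \<inter> {x. (\<chi> i. y i) \<bullet> x = b y}"
      using s eq unfolding nestohedron_def by (auto simp: sum_std_simplex_iff)
  next
    fix x assume "x \<in> nestohedron B \<inter> {x. (\<chi> i. y i) \<bullet> x = b y}"
    then obtain s where s: "x = sum s B" "\<forall>I\<in>B. s I \<in> std_simplex I" "(\<chi> i. y i) \<bullet> x = b y"
      unfolding nestohedron_def by (auto simp: sum_std_simplex_iff)
    then show "x \<in> nest_face B y" using eq unfolding nest_face_def sum_std_simplex_iff by blast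
  qed
  have "\<forall>I\<in>B. \<exists>i. i \<in> argmax y I" using argmax_nonempty B by (metis finite all_not_in_conv)
  then obtain c where "\<forall>I\<in>B. c I \<in> argmax y I" by metis
  then have "(\<Sum>I\<in>B. axis (c I) 1) \<in> nest_face B y"
    unfolding nest_face_def sum_std_simplex_iff
    by (intro exI[of _ "\<lambda>I. axis (c I) 1"]) (auto intro: axis_in_std_simplex)
  then show "nest_face B y \<noteq> {}" by blast
qed

lemma polytope_nestohedron: "polytope (nestohedron B)"
proof -
  have "nestohedron B = convex hull (\<Sum>I\<in>B. (\<lambda>i. axis i 1) ` I)"
    unfolding nestohedron_def std_simplex_def by (rule convex_hull_set_sum[symmetric])
  moreover have "finite (\<Sum>I\<in>B'. (\<lambda>i. axis i 1 :: real ^ 'a) ` I)" for B' :: "'a set set"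
    by (induction B' rule: infinite_finite_induct) (auto intro: finite_set_plus)
  ultimately show ?thesis unfolding polytope_def by blast
qed

text \<open>
  Faces of polytopes are exposed, that is, they are cut out by a direction \<open>y\<close>.
\<close>

lemma faces_nestohedron:
  fixes B :: "'n::finite set set"
  assumes B: "{} \<notin> B"
  shows "{F. F face_of nestohedron B \<and> F \<noteq> {}} = range (nest_face B)"
proof (intro equalityI subsetI)
  fix F assume "F \<in> {F. F face_of nestohedron B \<and> F \<noteq> {}}"
  then have F: "F face_of nestohedron B" "F \<noteq> {}" by auto
  then have "F exposed_face_of nestohedron B"
    using exposed_face_of_polyhedron polytope_imp_polyhedron polytope_nestohedron by blast
  then obtain a b where ab: "nestohedron B \<subseteq> {x. a \<bullet> x \<le> b}" "F = nestohedron B \<inter> {x. a \<bullet> x = b}"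
    unfolding exposed_face_of_def by blast
  define y where "y i = a $ i" for i
  have a: "a = (\<chi> i. y i)" by (simp add: y_def vec_eq_iff)
  note sup = nest_face_support[OF B]
  obtain x where "x \<in> nest_face B y" using sup(3) by blast
  then have "x \<in> nestohedron B" "a \<bullet> x = (\<Sum>I\<in>B. Max (y ` I))" using sup(2)[of y] a by auto
  then have "(\<Sum>I\<in>B. Max (y ` I)) \<le> b" using ab(1) by auto
  moreover obtain x' where "x' \<in> F" using F by blast
  then have "b \<le> (\<Sum>I\<in>B. Max (y ` I))" using ab(2) sup(1)[of x' y] a by auto
  ultimately have "b = (\<Sum>I\<in>B. Max (y ` I))" by simp
  then have "F = nest_face B y" using ab(2) sup(2)[of y] a by simp
  then show "F \<in> range (nest_face B)" by blast
next
  fix F assume "F \<in> range (nest_face B)"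
  then obtain y where y: "F = nest_face B y" by blast
  have "convex (nestohedron B)" using polytope_nestohedron polytope_imp_convex by blast
  then have "F face_of nestohedron B"
    unfolding y nest_face_support(2)[OF B]
    using nest_face_support(1)[OF B] by (intro face_of_Int_supporting_hyperplane_le) auto
  then show "F \<in> {F. F face_of nestohedron B \<and> F \<noteq> {}}" using nest_face_support(3)[OF B] y by auto
qed

text \<open>
  A sum of vertices \<open>e\<^bsub>d J\<^esub>\<close> with \<open>d J \<in> argmax y J\<close> maximises \<open>z\<close> on the whole sum only if every summand
  does so on its simplex; the vertex chosen in \<open>argmax y I\<close> is arbitrary.
\<close>

lemma nest_face_subset_imp:
  fixes B :: "'n::finite set set"
  assumes B: "{} \<notin> B" and sub: "nest_face B y \<subseteq> nest_face B z" and I: "I \<in> B"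
  shows "argmax y I \<subseteq> argmax z I"
proof
  fix i assume i: "i \<in> argmax y I"
  have "\<forall>J\<in>B. \<exists>j. j \<in> argmax y J" using argmax_nonempty B by (metis finite all_not_in_conv)
  then obtain c where c: "\<forall>J\<in>B. c J \<in> argmax y J" by metis
  define d where "d = c(I := i)"
  have d: "d J \<in> argmax y J" if "J \<in> B" for J using c i that by (auto simp: d_def)
  have "(\<Sum>J\<in>B. axis (d J) 1) \<in> nest_face B y"
    unfolding nest_face_def sum_std_simplex_iff
    by (intro exI[of _ "\<lambda>J. axis (d J) 1"]) (auto intro: axis_in_std_simplex d)
  then have "(\<chi> i. z i) \<bullet> (\<Sum>J\<in>B. axis (d J) 1) = (\<Sum>J\<in>B. Max (z ` J))"
    using sub nest_face_support(2)[OF B, of z] by auto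
  then have "(\<Sum>J\<in>B. Max (z ` J) - z (d J)) = 0"
    by (simp add: inner_sum_right inner_axis_fun sum_subtractf)
  moreover have "z (d J) \<le> Max (z ` J)" if "J \<in> B" for J
    using d[OF that] argmax_subset[of y J] by (intro Max_ge) auto
  ultimately have "Max (z ` I) - z (d I) = 0"
    using I by (subst (asm) sum_nonneg_eq_0_iff) auto
  then show "i \<in> argmax z I" using i argmax_subset[of y I] by (auto simp: d_def argmax_eq_Max)
qed

lemma nest_face_eq_iff:
  fixes B :: "'n::finite set set"
  assumes B: "{} \<notin> B"
  shows "nest_face B y = nest_face B z \<longleftrightarrow> (\<forall>I\<in>B. argmax y I = argmax z I)"
  using nest_face_subset_imp[OF B, of y z] nest_face_subset_imp[OF B, of z y]
  by (auto simp: nest_face_def intro!: sum.cong)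

lemma nest_UNIV: "nest r UNIV y a = component r {b. y b \<le> y a} a"
  by (simp add: nest_def)

lemma conn_nest:
  assumes "symp r" shows "conn r (nest r UNIV y a)" "a \<in> argmax y (nest r UNIV y a)"
proof -
  show "conn r (nest r UNIV y a)" unfolding nest_UNIV by (intro conn_component_self assms) simp
  show "a \<in> argmax y (nest r UNIV y a)"
    by (auto simp: argmax_def nest_UNIV component_def)
qed

text \<open>
  The largest connected set in which \<open>y\<close> is maximal at \<open>a\<close> is \<open>nest r UNIV y a\<close>. Therefore the tubing and
  the family of the sets \<open>argmax y I\<close> determine each other.
\<close>

lemma argmax_nest:
  assumes "symp r" "conn r I" "a \<in> I"
  shows "a \<in> argmax y I \<longleftrightarrow> I \<subseteq> nest r UNIV y a"
proof
  assume "a \<in> argmax y I"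
  then have "I \<subseteq> {b. y b \<le> y a}" by (auto simp: argmax_def)
  then show "I \<subseteq> nest r UNIV y a"
    unfolding nest_UNIV
    by (rule conn_subset_closed[OF assms(2) _ closed_component assms(3)]) (simp add: component_def)
next
  assume "I \<subseteq> nest r UNIV y a"
  then show "a \<in> argmax y I" using assms by (auto simp: argmax_def nest_UNIV component_def)
qed

lemma nest_eq_iff_argmax:
  assumes r: "symp r"
  shows "nest r UNIV y = nest r UNIV z \<longleftrightarrow> (\<forall>I\<in>{I. conn r I}. argmax y I = argmax z I)"
proof
  assume eq: "nest r UNIV y = nest r UNIV z"
  have "a \<in> argmax y I \<longleftrightarrow> a \<in> argmax z I" if "conn r I" for a I
  proof (cases "a \<in> I")
    case True
    then show ?thesis using argmax_nest[OF r that True] eq by metis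
  qed (auto simp: argmax_def)
  then show "\<forall>I\<in>{I. conn r I}. argmax y I = argmax z I" by blast
next
  assume eq: "\<forall>I\<in>{I. conn r I}. argmax y I = argmax z I"
  have sub: "nest r UNIV y a \<subseteq> nest r UNIV z a"
    if "\<forall>I\<in>{I. conn r I}. argmax y I = argmax z I" for y z a
  proof -
    have "a \<in> argmax z (nest r UNIV y a)" using that conn_nest[OF r] by blast
    then show ?thesis using argmax_nest[OF r conn_nest(1)[OF r], of a y a z]
      by (simp add: nest_refl)
  qed
  show "nest r UNIV y = nest r UNIV z"
    using sub[of y z] sub[of z y] eq by (intro ext equalityI) auto
qed

text \<open>
  The relation on the left generates the directions of the face, and this shows that it is already an
  equivalence relation.
\<close>

lemma argmax_pair_iff:
  assumes r: "symp r"
  shows "(\<exists>I. conn r I \<and> a \<in> argmax y I \<and> b \<in> argmax y I) \<longleftrightarrow> nest r UNIV y a = nest r UNIV y b"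
proof
  assume "\<exists>I. conn r I \<and> a \<in> argmax y I \<and> b \<in> argmax y I"
  then obtain I where I: "conn r I" "a \<in> argmax y I" "b \<in> argmax y I" by blast
  then have y: "y a = y b" by (auto simp: argmax_def intro: antisym)
  have ab: "a \<in> I" "b \<in> I" using I argmax_subset[of y I] by auto
  have "b \<in> component r {b. y b \<le> y a} a"
    using argmax_nest[OF r I(1) ab(1), of y] I(2) ab by (auto simp: nest_UNIV)
  then have "component r {c. y c \<le> y a} b = component r {c. y c \<le> y a} a"
    by (intro conn_component[OF r conn_component_self[OF r] closed_component]) auto
  then show "nest r UNIV y a = nest r UNIV y b" by (simp add: nest_UNIV y)
next
  assume eq: "nest r UNIV y a = nest r UNIV y b"
  show "\<exists>I. conn r I \<and> a \<in> argmax y I \<and> b \<in> argmax y I"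
    using conn_nest[OF r, where y = y and a = a] conn_nest[OF r, where y = y and a = b] eq
    by (intro exI[of _ "nest r UNIV y a"]) auto
qed

text \<open>
  Choosing a representative of each class of the kernel of \<open>f\<close>, a basis is formed by the differences between
  the other elements and their representatives.
\<close>

lemma dim_partition:
  fixes f :: "'n::finite \<Rightarrow> 'b"
  shows "dim {axis a 1 - axis b (1::real) |a b. f a = f b} = CARD('n) - card (range f)"
proof -
  let ?D = "{axis a 1 - axis b (1::real) |a b. f a = f b}"
  define rep where "rep a = (SOME b. f b = f a)" for a
  have rep: "f (rep a) = f a" for a unfolding rep_def by (rule someI[of _ a]) simp
  have rep_eq: "rep a = rep b" if "f a = f b" for a b unfolding rep_def that ..
  define R where "R = {a. rep a \<noteq> a}"
  define e where "e a = axis a 1 - axis (rep a) (1::real)" for a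
  have rep_R: "rep a \<notin> R" for a using rep_eq[OF rep] by (simp add: R_def)
  have coord: "e a $ b = (if a = b then 1 else 0)" if "b \<in> R" for a b
    using rep_R[of a] that by (auto simp: e_def axis_def)
  have inj: "inj_on e R"
  proof (rule inj_onI)
    fix a b assume "a \<in> R" "b \<in> R" "e a = e b"
    then show "a = b" using coord[of b a] coord[of b b] by (auto split: if_splits)
  qed
  have ind: "independent (e ` R)"
  proof (rule independent_if_scalars_zero)
    fix g v assume s: "(\<Sum>x\<in>e ` R. g x *\<^sub>R x) = 0" and v: "v \<in> e ` R"
    then obtain b where b: "b \<in> R" "v = e b" by blast
    have "(\<Sum>a\<in>R. g (e a) *\<^sub>R e a) = 0" using s inj by (simp add: sum.reindex)
    then have "(\<Sum>a\<in>R. g (e a) *\<^sub>R e a) $ b = 0" by simp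
    then have "(\<Sum>a\<in>R. g (e a) * (if a = b then 1 else 0)) = 0"
      using coord[OF b(1)] by simp
    then show "g v = 0" using b by (simp add: if_distrib cong: if_cong)
  qed simp
  have e_span: "e a \<in> span (e ` R)" for a
  proof (cases "a \<in> R")
    case False
    then show ?thesis by (simp add: R_def e_def span_zero)
  qed (auto intro: span_base)
  have "dim ?D = card (e ` R)"
  proof (rule dim_unique[OF _ _ ind refl])
    show "e ` R \<subseteq> ?D" using rep by (auto simp: e_def) metis
    show "?D \<subseteq> span (e ` R)"
    proof
      fix x assume "x \<in> ?D"
      then obtain a b where ab: "x = axis a 1 - axis b 1" "f a = f b" by blast
      then have "x = e a - e b" using rep_eq[OF ab(2)] by (simp add: e_def)
      then show "x \<in> span (e ` R)" using e_span span_diff by metis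
    qed
  qed
  also have "\<dots> = card R" using inj by (rule card_image)
  also have "R = UNIV - range rep"
  proof -
    have "a \<in> range rep \<longleftrightarrow> rep a = a" for a using rep_eq[OF rep] by (metis rangeI rangeE)
    then show ?thesis by (auto simp: R_def)
  qed
  also have "card \<dots> = CARD('n) - card (range rep)" by (intro card_Diff_subset) auto
  also have "card (range rep) = card (range f)"
  proof (rule bij_betw_same_card[of f])
    show "bij_betw f (range rep) (range f)"
    proof (rule bij_betw_imageI)
      show "inj_on f (range rep)"
        by (rule inj_onI) (auto simp: rep intro: rep_eq)
      show "f ` range rep = range f" by (simp add: image_image rep)
    qed
  qed
  finally show ?thesis .
qed

lemma std_simplex_diff_span:
  fixes x :: "real ^ 'n::finite"
  assumes x: "x \<in> std_simplex I" and c: "c \<in> I" and S: "\<And>a. a \<in> I \<Longrightarrow> axis a 1 - axis c 1 \<in> span S"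
  shows "x - axis c 1 \<in> span S"
proof -
  note x' = x[unfolded std_simplex_iff]
  have "x = (\<Sum>i\<in>UNIV. x $ i *\<^sub>R axis i 1)"
    using basis_expansion[of x] by (simp add: scalar_mult_eq_scaleR)
  moreover have "axis c 1 = (\<Sum>i\<in>UNIV. x $ i *\<^sub>R axis c (1::real) :: real ^ 'n)"
    using x' by (simp add: scaleR_sum_left[symmetric])
  ultimately have "x - axis c 1 = (\<Sum>i\<in>UNIV. x $ i *\<^sub>R (axis i 1 - axis c 1))"
    by (simp add: sum_subtractf scaleR_diff_right)
  also have "\<dots> \<in> span S"
  proof (rule span_sum)
    fix i show "x $ i *\<^sub>R (axis i 1 - axis c 1) \<in> span S"
      using S[of i] x' by (cases "i \<in> I") (auto intro: span_scale simp: span_zero)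
  qed
  finally show ?thesis .
qed

text \<open>
  Replacing one summand \<open>e\<^bsub>c I\<^esub>\<close> of a point by another vertex of the same simplex moves the point by a
  difference of two unit vectors, and such differences span all directions of the face.
\<close>

lemma aff_dim_nest_face:
  fixes r :: "'n::finite \<Rightarrow> 'n \<Rightarrow> bool"
  assumes r: "symp r"
  shows "aff_dim (nest_face {I. conn r I} y) = int (CARD('n) - card (range (nest r UNIV y)))"
proof -
  let ?B = "{I. conn r I}" and ?f = "nest r UNIV y"
  let ?D = "{axis a 1 - axis b (1::real) |a b. ?f a = ?f b} :: (real ^ 'n) set"
  have "\<forall>I\<in>?B. \<exists>i. i \<in> argmax y I" using argmax_nonempty by (metis finite all_not_in_conv conn_def mem_Collect_eq)
  then obtain c where c: "\<And>I. conn r I \<Longrightarrow> c I \<in> argmax y I" by (metis mem_Collect_eq)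
  define x0 where "x0 = (\<Sum>I\<in>?B. axis (c I) (1::real))"
  have mem: "(\<Sum>I\<in>?B. axis (d I) 1) \<in> nest_face ?B y" if "\<And>I. conn r I \<Longrightarrow> d I \<in> argmax y I" for d
    unfolding nest_face_def sum_std_simplex_iff
    by (intro exI[of _ "\<lambda>J. axis (d J) 1"]) (auto intro: axis_in_std_simplex that)
  have x0: "x0 \<in> nest_face ?B y" unfolding x0_def by (rule mem[OF c])
  let ?T = "(+) (- x0) ` nest_face ?B y"
  have "?D \<subseteq> span ?T"
  proof
    fix v assume "v \<in> ?D"
    then obtain a b where v: "v = axis a 1 - axis b 1" and "?f a = ?f b" by blast
    then obtain I where I: "conn r I" "a \<in> argmax y I" "b \<in> argmax y I" using argmax_pair_iff[OF r] by blast
    have "axis i 1 - axis (c I) 1 \<in> span ?T" if "i \<in> argmax y I" for i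
    proof -
      have "(\<Sum>J\<in>?B. axis ((c(I := i)) J) 1) \<in> nest_face ?B y"
        by (rule mem) (use c that in auto)
      moreover have "- x0 + (\<Sum>J\<in>?B. axis ((c(I := i)) J) (1::real)) = axis i 1 - axis (c I) 1"
        unfolding x0_def using I(1)
        by (subst (1 2) sum.remove[of _ I]) (auto intro!: sum.cong)
      ultimately have "axis i 1 - axis (c I) 1 \<in> ?T" by (metis imageI)
      then show ?thesis by (rule span_base)
    qed
    from span_diff[OF this[OF I(2)] this[OF I(3)]] show "v \<in> span ?T" by (simp add: v)
  qed
  moreover have "?T \<subseteq> span ?D"
  proof
    fix v assume "v \<in> ?T"
    then obtain s where v: "v = sum s ?B - x0" and s: "\<forall>I\<in>?B. s I \<in> std_simplex (argmax y I)"
      unfolding nest_face_def by (auto simp: sum_std_simplex_iff)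
    have "v = (\<Sum>I\<in>?B. s I - axis (c I) 1)" unfolding v x0_def by (simp add: sum_subtractf)
    also have "\<dots> \<in> span ?D"
    proof (rule span_sum)
      fix I assume I: "I \<in> ?B"
      show "s I - axis (c I) 1 \<in> span ?D"
      proof (rule std_simplex_diff_span)
        show "s I \<in> std_simplex (argmax y I)" "c I \<in> argmax y I" using s c I by auto
        fix a assume "a \<in> argmax y I"
        then have "?f a = ?f (c I)" using argmax_pair_iff[OF r] c I by blast
        then show "axis a 1 - axis (c I) 1 \<in> span ?D" by (intro span_base) blast
      qed
    qed
    finally show "v \<in> span ?D" .
  qed
  ultimately have "span ?T = span ?D" by (intro equalityI span_minimal subspace_span)
  then have "dim (span ?T) = dim (span ?D)" by (rule arg_cong)
  then have "dim ?T = dim ?D" by (simp only: dim_span)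
  moreover have "aff_dim (nest_face ?B y) = int (dim ?T)"
    using x0 by (intro aff_dim_eq_dim hull_inc)
  ultimately show ?thesis using dim_partition[of ?f] by simp
qed

text \<open>
  Faces correspond to the functions \<open>nest r UNIV y\<close>. The direction \<open>0\<close> gives the polytope itself, whose only
  tube is the whole vertex set.
\<close>

theorem f_polynomial_nestohedron:
  fixes r :: "'n::finite \<Rightarrow> 'n \<Rightarrow> bool"
  assumes r: "symp r" and con: "conn r UNIV"
  shows "f_polynomial (nestohedron {I. conn r I}) = fpoly r UNIV"
    "pdim (nestohedron {I. conn r I}) = CARD('n) - 1"
proof -
  let ?B = "{I. conn r I}" and ?N = "range (nest r UNIV)"
  have B: "{} \<notin> ?B" by (simp add: conn_def)
  define dm where "dm N = CARD('n) - card (range N)" for N :: "'n \<Rightarrow> 'n set"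
  have iff: "nest_face ?B y = nest_face ?B z \<longleftrightarrow> nest r UNIV y = nest r UNIV z" for y z
    using nest_face_eq_iff[OF B] nest_eq_iff_argmax[OF r] by metis
  have "nest_face ?B (\<lambda>_. 0) = nestohedron ?B"
    by (simp add: nest_face_def nestohedron_def argmax_def)
  moreover have "nest r UNIV (\<lambda>_. 0) a = UNIV" for a
    unfolding nest_UNIV using con by (auto simp: component_def conn_def)
  then have "range (nest r UNIV (\<lambda>_. 0)) = {UNIV}" by auto
  ultimately show pd: "pdim (nestohedron ?B) = CARD('n) - 1"
    using aff_dim_nest_face[OF r, of "\<lambda>_. 0"] by (simp add: pdim_def)
  \<comment> \<open>the choice of the direction \<open>y\<close> for \<open>F\<close> is immaterial, as all of them have the same nest\<close>
  define pick where "pick F = nest r UNIV (SOME y. nest_face ?B y = F)" for F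
  have pick: "pick (nest_face ?B y) = nest r UNIV y" for y
  proof -
    have "nest_face ?B (SOME z. nest_face ?B z = nest_face ?B y) = nest_face ?B y"
      by (rule someI[of _ y]) simp
    then show ?thesis unfolding pick_def iff .
  qed
  have fn: "face_number (nestohedron ?B) i = card {N \<in> ?N. dm N = i}" for i
  proof -
    have "{F. F face_of nestohedron ?B \<and> aff_dim F = int i} = {F \<in> range (nest_face ?B). aff_dim F = int i}"
      unfolding faces_nestohedron[OF B, symmetric] by auto
    also have "bij_betw pick \<dots> {N \<in> ?N. dm N = i}"
    proof (rule bij_betw_imageI)
      show "inj_on pick {F \<in> range (nest_face ?B). aff_dim F = int i}"
        by (rule inj_onI) (use pick iff in force)
      have "aff_dim (nest_face ?B y) = int i \<longleftrightarrow> dm (nest r UNIV y) = i" for y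
        unfolding aff_dim_nest_face[OF r] dm_def by simp
      then have "{F \<in> range (nest_face ?B). aff_dim F = int i} = nest_face ?B ` {y. dm (nest r UNIV y) = i}"
        by auto
      then have "pick ` {F \<in> range (nest_face ?B). aff_dim F = int i} = nest r UNIV ` {y. dm (nest r UNIV y) = i}"
        by (simp only: image_image pick)
      then show "pick ` {F \<in> range (nest_face ?B). aff_dim F = int i} = {N \<in> ?N. dm N = i}"
        by auto
    qed
    finally show ?thesis unfolding face_number_def by (rule bij_betw_same_card)
  qed
  have finN: "finite ?N" by (rule finite_nests) simp
  have dm_le: "dm N \<le> pdim (nestohedron ?B)" for N
    unfolding pd dm_def by (intro diff_le_mono2) (simp add: Suc_le_eq card_gt_0_iff)
  have "f_polynomial (nestohedron ?B) = (\<Sum>i\<le>pdim (nestohedron ?B). \<Sum>N | N \<in> ?N \<and> dm N = i. monom 1 (dm N))"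
    unfolding f_polynomial_def fn
    by (intro sum.cong refl) (simp add: of_nat_poly smult_monom)
  also have "\<dots> = (\<Sum>N\<in>?N. monom 1 (dm N))"
    using finN dm_le by (intro sum.group) auto
  finally show "f_polynomial (nestohedron ?B) = fpoly r UNIV" by (simp add: fpoly_def dm_def)
qed

section \<open>Flossing moves\<close>

definition adj :: "'n set set \<Rightarrow> 'n \<Rightarrow> 'n \<Rightarrow> bool" where
  "adj E x y \<longleftrightarrow> {x, y} \<in> E"

lemma symp_adj: "symp (adj E)"
  by (auto simp: symp_def adj_def insert_commute)

lemma successively_reach:
  assumes "p \<noteq> []" "successively (\<lambda>x y. {x, y} \<in> induced_edges E I) p"
  shows "reach (adj E) I (hd p) (last p)"
  using assms
proof (induction p rule: induct_list012)
  case (3 x y p)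
  have "adj E x y" "x \<in> I" "y \<in> I" using 3 by (auto simp: induced_edges_def adj_def)
  then have "reach (adj E) I x y" by (rule reach_edge)
  moreover have "reach (adj E) I y (last (y # p))" using 3 by simp
  ultimately show ?case by (auto intro: reach_trans)
qed auto

text \<open>
  Paths have no repeated vertices, so when the walk returns to a vertex of the path, the loop is cut off.
\<close>

lemma reach_path:
  assumes "reach (adj E) I a b" "a \<in> I"
  shows "\<exists>p. path_between (induced_edges E I) a p b"
  using assms(1)
proof (induction rule: reach_induct)
  case refl
  then show ?case by (intro exI[of _ "[a]"]) (simp add: path_between_def)
next
  case (step x y)
  then obtain p where p: "path_between (induced_edges E I) a p x" by blast
  show ?case
  proof (cases "y \<in> set p")
    case True
    then obtain p1 p2 where "p = p1 @ y # p2" by (auto dest: split_list)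
    then have eq: "p = (p1 @ [y]) @ p2" by simp
    then have "hd (p1 @ [y]) = a" using p by (cases p1) (auto simp: path_between_def)
    moreover have "successively (\<lambda>x y. {x, y} \<in> induced_edges E I) ((p1 @ [y]) @ p2)" "distinct ((p1 @ [y]) @ p2)"
      using p unfolding eq path_between_def by blast+
    ultimately have "path_between (induced_edges E I) a (p1 @ [y]) y"
      unfolding successively_append_iff[of _ "p1 @ [y]" p2] by (auto simp: path_between_def)
    then show ?thesis by blast
  next
    case False
    have "{x, y} \<in> induced_edges E I" using step by (auto simp: adj_def induced_edges_def)
    then have "path_between (induced_edges E I) a (p @ [y]) y"
      using p False by (auto simp: path_between_def successively_append_iff)
    then show ?thesis by blast
  qed
qed

lemma graph_connected_iff: "graph_connected I (induced_edges E I) \<longleftrightarrow> (\<forall>a\<in>I. \<forall>b\<in>I. reach (adj E) I a b)"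
  unfolding graph_connected_def
proof (intro ball_cong refl iffI)
  fix a b
  assume "\<exists>p. path_between (induced_edges E I) a p b"
  then show "reach (adj E) I a b"
    using successively_reach by (auto simp: path_between_def)
qed (rule reach_path)

lemma building_set_eq: "building_set E = {I. conn (adj E) I}"
  by (auto simp: building_set_def graph_connected_iff conn_def)

lemma path_lipschitz:
  fixes f :: "'n \<Rightarrow> nat"
  assumes "p \<noteq> []" "successively (\<lambda>x y. {x, y} \<in> E) p" "\<And>x y. {x, y} \<in> E \<Longrightarrow> f y \<le> Suc (f x)"
  shows "f (last p) < f (hd p) + length p"
  using assms(1,2)
proof (induction p rule: induct_list012)
  case (3 x y p)
  then have "f (last (y # p)) < f y + length (y # p)" by simp
  moreover have "f y \<le> Suc (f x)" using 3 assms(3) by simp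
  ultimately show ?case by simp
qed auto

text \<open>
  As many edges at \<open>x\<close> as the degree permits are all the edges at \<open>x\<close>.
\<close>

lemma degree_neighbours:
  fixes E :: "'n::finite set set"
  assumes "vdegree E x \<le> card S" "S \<subseteq> {e \<in> E. x \<in> e}" "{x, y} \<in> E"
  shows "{x, y} \<in> S"
proof -
  have "S = {e \<in> E. x \<in> e}"
    using assms(1,2) by (intro card_seteq) (auto simp: vdegree_def)
  then show ?thesis using assms(3) by blast
qed

text \<open>
  The path between the flossed leaves is the line. By the degree conditions its vertices other than \<open>v\<close>
  have no neighbours off the path, and so the rest of the graph is attached to the hub \<open>v\<close> only. The move
  puts the leaf \<open>l\<close> from the beginning of the line to its end; all other vertices, including the hub,
  move down by one position.
\<close>

theorem flossing_move_hub:
  fixes E E' :: "'n::finite set set"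
  assumes sg: "simple_graph E" and con: "conn (adj E) UNIV" and fl: "flossing_move E E'"
  obtains q and N A :: "'n set" and L m :: nat and \<phi> \<phi>' :: "'n + nat \<Rightarrow> 'n" where "symp q" "attached q N A" "0 < m" "2 * m \<le> L"
    "embeds (hub q N m) (A <+> {..<Suc L}) (adj E) \<phi>" "\<phi> ` (A <+> {..<Suc L}) = (UNIV :: 'n set)"
    "embeds (hub q N (m - 1)) (A <+> {..<Suc L}) (adj E') \<phi>'" "\<phi>' ` (A <+> {..<Suc L}) = (UNIV :: 'n set)"
proof -
  obtain l l' v w where f: "floss E l l' v" and dist: "graph_dist E l v \<le> graph_dist E l' v"
    and lw: "{l, w} \<in> E" and E': "E' = insert {l', l} (E - {{l, w}})"
    using fl unfolding flossing_move_def by blast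
  obtain p where p: "shortest_path E l p l'" and degs: "{x \<in> set p. vdegree E x \<ge> 3} = {v}"
    using f unfolding floss_def by blast
  have leaf: "vdegree E l = 1" "vdegree E l' = 1" "l \<noteq> l'" using f by (auto simp: floss_def leaf_def)
  have pb: "p \<noteq> []" "hd p = l" "last p = l'" "distinct p" "successively (\<lambda>x y. {x, y} \<in> E) p"
    using p by (auto simp: shortest_path_def path_between_def)
  define z where "z i = p ! i" for i
  define L where "L = length p - 1"
  have len: "length p = Suc L" using pb(1) by (simp add: L_def)
  have z0: "z 0 = l" "z L = l'" using pb by (auto simp: z_def L_def hd_conv_nth last_conv_nth)
  have inj: "z i = z j \<longleftrightarrow> i = j" if "i \<le> L" "j \<le> L" for i j
    using that pb(4) len by (auto simp: z_def nth_eq_iff_index_eq)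
  have edge: "{z i, z (Suc i)} \<in> E" if "i < L" for i
    using successively_nth[OF pb(5)] that len by (auto simp: z_def)
  have setp: "set p = z ` {..L}" using len by (auto simp: z_def in_set_conv_nth image_iff less_Suc_eq_le)
  have no_loop: "x \<noteq> y" if "{x, y} \<in> E" for x y
    using sg that by (auto simp: simple_graph_def)
  have vp: "v \<in> set p" "vdegree E v \<ge> 3" using degs by auto
  then obtain m where m: "m \<le> L" "z m = v" using setp by auto
  have deg3: "i = m" if "i \<le> L" "vdegree E (z i) \<ge> 3" for i
    using degs setp that m inj by auto
  have "v \<noteq> l" "v \<noteq> l'" using vp leaf by auto
  then have mL: "0 < m" "m < L"
    using m z0 by (metis gr0I, metis le_neq_implies_less)
  have nb: "\<exists>j\<le>L. x = z j \<and> (j = Suc i \<or> i = Suc j)" if i: "i \<le> L" "i \<noteq> m" and x: "{z i, x} \<in> E" for i x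
  proof -
    consider "i = 0" | "i = L" | "0 < i" "i < L" using i by linarith
    then show ?thesis
    proof cases
      case 1
      have "{z 0, x} \<in> {{z 0, z 1}}"
      proof (rule degree_neighbours[where x = "z 0"])
        show "vdegree E (z 0) \<le> card {{z 0, z 1}}" using leaf(1) z0(1) by simp
        show "{{z 0, z 1}} \<subseteq> {e \<in> E. z 0 \<in> e}" using edge[of 0] mL by simp
        show "{z 0, x} \<in> E" using x 1 by simp
      qed
      then have "x = z 1" by (auto simp: doubleton_eq_iff)
      then show ?thesis using 1 mL by (intro exI[of _ 1]) auto
    next
      case 2
      have "{z L, x} \<in> {{z (L - 1), z L}}"
      proof (rule degree_neighbours[where x = "z L"])
        show "vdegree E (z L) \<le> card {{z (L - 1), z L}}" using leaf(2) z0(2) by simp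
        show "{{z (L - 1), z L}} \<subseteq> {e \<in> E. z L \<in> e}" using edge[of "L - 1"] mL by simp
        show "{z L, x} \<in> E" using x 2 by simp
      qed
      then have "x = z (L - 1)" by (auto simp: doubleton_eq_iff)
      then show ?thesis using 2 mL by (intro exI[of _ "L - 1"]) auto
    next
      case 3
      have ne: "{z (i - 1), z i} \<noteq> {z i, z (Suc i)}" using 3 inj by (auto simp: doubleton_eq_iff)
      have "{z i, x} \<in> {{z (i - 1), z i}, {z i, z (Suc i)}}"
      proof (rule degree_neighbours[where x = "z i"])
        have "vdegree E (z i) \<le> 2" using deg3[of i] i by linarith
        then show "vdegree E (z i) \<le> card {{z (i - 1), z i}, {z i, z (Suc i)}}" using ne by simp
        show "{{z (i - 1), z i}, {z i, z (Suc i)}} \<subseteq> {e \<in> E. z i \<in> e}"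
          using edge[of i] edge[of "i - 1"] 3 by simp
        show "{z i, x} \<in> E" by (rule x)
      qed
      then have "x = z (i - 1) \<or> x = z (Suc i)" by (auto simp: doubleton_eq_iff)
      then show ?thesis using 3
        by (elim disjE) (rule exI[of _ "i - 1"], simp, rule exI[of _ "Suc i"], simp)
    qed
  qed
  have wz: "w = z 1" using nb[of 0 w] lw mL z0 by auto
  have "graph_dist E l' v \<le> L - m"
    unfolding graph_dist_def
  proof (rule Least_le, intro exI conjI)
    let ?p = "rev (drop m p)"
    have "hd ?p = l'" "last ?p = v"
      using pb m len by (auto simp: hd_rev last_rev hd_drop_conv_nth z_def)
    moreover have "successively (\<lambda>x y. {x, y} \<in> E) (drop m p)"
      using pb(5) by (metis append_take_drop_id successively_append_iff)
    ultimately show "path_between E l' ?p v"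
      using pb len m by (auto simp: path_between_def successively_rev insert_commute)
    show "length ?p = Suc (L - m)" using len m by simp
  qed
  moreover have "m \<le> graph_dist E l v"
  proof -
    have "\<exists>k. \<exists>p. path_between E l p v \<and> length p = Suc k"
    proof -
      obtain p' where "path_between (induced_edges E UNIV) l p' v"
        using reach_path[of E UNIV l v] con by (auto simp: conn_def)
      then have p': "path_between E l p' v" by (simp add: induced_edges_def)
      then have "length p' = Suc (length p' - 1)" by (cases p') (auto simp: path_between_def)
      then show ?thesis using p' by blast
    qed
    from LeastI_ex[OF this] obtain p' where p': "path_between E l p' v" "length p' = Suc (graph_dist E l v)"
      unfolding graph_dist_def by blast
    \<comment> \<open>the position on the line, cut off at \<open>m\<close>: it changes by at most one along each edge, so a path from \<open>l\<close> to \<open>v\<close> has at least \<open>m\<close> edges\<close>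
    define f where "f x = (LEAST i. i = m \<or> x = z i)" for x
    have f_m: "f x \<le> m" for x unfolding f_def by (rule Least_le) simp
    have f_le: "f (z i) \<le> i" for i unfolding f_def by (rule Least_le) simp
    have f_eq: "f x = m \<or> x = z (f x)" for x unfolding f_def by (rule LeastI_ex) blast
    have "f v = m" using f_eq[of v] f_m[of v] m inj by auto
    have "f l = 0" using f_le[of 0] z0 by simp
    have lip: "f y \<le> Suc (f x)" if "{x, y} \<in> E" for x y
    proof (cases "f x = m")
      case True then show ?thesis using f_m[of y] by simp
    next
      case False
      then have "x = z (f x)" using f_eq by blast
      then have "{z (f x), y} \<in> E" using that by metis
      from nb[OF _ False this] obtain j where "y = z j" "j \<le> Suc (f x)"
        using f_m[of x] m by auto
      then show ?thesis using f_le[of j] by simp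
    qed
    have "f (last p') < f (hd p') + length p'"
      by (rule path_lipschitz[OF _ _ lip]) (use p' in \<open>auto simp: path_between_def\<close>)
    then show ?thesis using p' \<open>f v = m\<close> \<open>f l = 0\<close> by (auto simp: path_between_def)
  qed
  ultimately have m2: "2 * m \<le> L" using dist mL by linarith
  define A where "A = UNIV - set p"
  define N where "N = {a. {a, z m} \<in> E}"
  let ?q = "adj E"
  have zz: "{z i, z j} \<in> E \<longleftrightarrow> i = Suc j \<or> j = Suc i" if ij: "i \<le> L" "j \<le> L" for i j
  proof
    assume e: "{z i, z j} \<in> E"
    then have "i \<noteq> j" using no_loop by auto
    show "i = Suc j \<or> j = Suc i"
    proof (cases "i = m")
      case True
      then have "j \<noteq> m" using \<open>i \<noteq> j\<close> by simp
      moreover have "{z j, z i} \<in> E" using e by (simp add: insert_commute)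
      ultimately obtain k where "k \<le> L" "z i = z k" "k = Suc j \<or> j = Suc k" using nb[OF ij(2)] by blast
      then show ?thesis using inj[OF ij(1)] by auto
    next
      case False
      then obtain k where "k \<le> L" "z j = z k" "k = Suc i \<or> i = Suc k" using nb[OF ij(1) _ e] by blast
      then show ?thesis using inj[OF ij(2)] by auto
    qed
  next
    assume "i = Suc j \<or> j = Suc i"
    then show "{z i, z j} \<in> E" using edge[of i] edge[of j] ij by (auto simp: insert_commute)
  qed
  have Az: "{a, z j} \<in> E \<longleftrightarrow> a \<in> N \<and> j = m" "{z j, a} \<in> E \<longleftrightarrow> a \<in> N \<and> j = m" "a \<noteq> z j" "z j \<noteq> a"
    if "a \<in> A" "j \<le> L" for a j
  proof -
    have n: "a \<noteq> z j" if "j \<le> L" for j using \<open>a \<in> A\<close> that setp by (auto simp: A_def)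
    then show "a \<noteq> z j" "z j \<noteq> a" using that by auto
    have "j = m" if "{z j, a} \<in> E" using nb[OF \<open>j \<le> L\<close> _ that] n by blast
    then show "{a, z j} \<in> E \<longleftrightarrow> a \<in> N \<and> j = m" "{z j, a} \<in> E \<longleftrightarrow> a \<in> N \<and> j = m"
      by (auto simp: N_def insert_commute)
  qed
  have zA: "z j \<notin> A" if "j \<le> L" for j using that setp by (auto simp: A_def)
  let ?V = "A <+> {..<Suc L}"
  define \<phi> where "\<phi> = case_sum id z"
  define \<phi>' where "\<phi>' = case_sum id (\<lambda>i. if i = L then z 0 else z (Suc i))"
  have emb: "embeds (hub ?q N m) ?V (adj E) \<phi>"
    unfolding embeds_def inj_on_def \<phi>_def
    by (auto simp: adj_def zz Az inj less_Suc_eq_le)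
  have im: "\<phi> ` ?V = UNIV"
  proof -
    have "\<phi> ` ?V = A \<union> z ` {..L}" unfolding \<phi>_def Plus_def image_Un image_image
      by (simp add: lessThan_Suc_atMost)
    then show ?thesis using setp by (auto simp: A_def)
  qed
  have im': "\<phi>' ` ?V = UNIV"
  proof -
    have "z j \<in> (\<lambda>i. if i = L then z 0 else z (Suc i)) ` {..L}" if "j \<le> L" for j
    proof (cases j)
      case 0 then show ?thesis by (intro image_eqI[of _ _ L]) auto
    next
      case (Suc k) then show ?thesis using that by (intro image_eqI[of _ _ k]) auto
    qed
    then have "z ` {..L} \<subseteq> (\<lambda>i. if i = L then z 0 else z (Suc i)) ` {..L}" by auto
    moreover have "\<phi>' ` ?V = A \<union> (\<lambda>i. if i = L then z 0 else z (Suc i)) ` {..L}"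
      unfolding \<phi>'_def Plus_def image_Un image_image by (simp add: lessThan_Suc_atMost)
    ultimately show ?thesis using setp by (auto simp: A_def)
  qed
  have emb': "embeds (hub ?q N (m - 1)) ?V (adj E') \<phi>'"
  proof -
    have a': "adj E' x y \<longleftrightarrow> {x, y} = {z L, z 0} \<or> ({x, y} \<in> E \<and> {x, y} \<noteq> {z 0, z 1})" for x y
      by (auto simp: adj_def E' z0 wz)
    have r1: "adj E' a b \<longleftrightarrow> {a, b} \<in> E" if "a \<in> A" "b \<in> A" for a b
      using Az[OF that(1)] Az[OF that(2)] mL unfolding a' doubleton_eq_iff by auto
    have r2: "adj E' a (z (Suc j)) \<longleftrightarrow> a \<in> N \<and> Suc j = m" "adj E' (z (Suc j)) a \<longleftrightarrow> a \<in> N \<and> Suc j = m"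
      if "a \<in> A" "j < L" for a j
      using Az[OF that(1)] that(2) mL unfolding a' doubleton_eq_iff by auto
    have r2m: "adj E' a (z m)" "adj E' (z m) a" if "a \<in> A" "a \<in> N" for a
      using r2[OF that(1), of "m - 1"] that mL by simp_all
    have r3: "\<not> adj E' a (z 0)" "\<not> adj E' (z 0) a" if "a \<in> A" for a
      using Az[OF that(1)] mL unfolding a' doubleton_eq_iff by auto
    have r4: "adj E' (z (Suc i)) (z (Suc j)) \<longleftrightarrow> i = Suc j \<or> j = Suc i" if "i < L" "j < L" for i j
      using that unfolding a' doubleton_eq_iff by (auto simp: zz inj)
    have r5: "adj E' (z 0) (z (Suc j)) \<longleftrightarrow> L = Suc j" "adj E' (z (Suc j)) (z 0) \<longleftrightarrow> L = Suc j" if "j < L" for j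
      using that mL unfolding a' doubleton_eq_iff by (auto simp: zz inj)
    show ?thesis
      unfolding embeds_def
    proof (intro conjI ballI impI)
      show "inj_on \<phi>' ?V"
        unfolding inj_on_def \<phi>'_def by (auto simp: inj zA less_Suc_eq_le split: if_splits)
      fix x y assume xy: "x \<in> ?V" "y \<in> ?V" "x \<noteq> y"
      show "adj E' (\<phi>' x) (\<phi>' y) \<longleftrightarrow> hub ?q N (m - 1) x y"
        using xy mL unfolding \<phi>'_def
        by (auto simp: r1 r2 r2m r3 r4 r5 adj_def[of E] less_Suc_eq split: if_splits)
    qed
  qed
  have "conn (hub ?q N m) ?V" using conn_image[OF emb subset_refl] im con by simp
  then have "attached ?q N A"
    using conn_hub_iff[OF symp_adj[of E] subset_refl, where A = A and n = "Suc L" and N = N and m = m] mL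
    by (auto simp: Plus_eq_iff)
  then show ?thesis using that[OF symp_adj _ mL(1) m2 emb im emb' im'] by blast
qed

text \<open>
  For a connected graph the dimension of the polytope is the rank of the graph, so that both notions of a
  \<open>\<gamma>\<close>-polynomial refer to the same expansion.
\<close>

theorem gamma_polynomial_graph_associahedron:
  fixes E :: "'n::finite set set"
  assumes con: "conn (adj E) UNIV"
  shows "gamma_polynomial (graph_associahedron E) = graph_gamma (adj E) UNIV"
proof (rule gamma_polynomial_eqI)
  note f = f_polynomial_nestohedron[OF symp_adj con]
  have d: "pdim (graph_associahedron E) = graph_rank (adj E) UNIV"
    using f(2) card_comps_conn[OF symp_adj con] by (simp add: building_set_eq graph_rank_def)
  have "f_polynomial (graph_associahedron E) = fpoly (adj E) UNIV"
    using f(1) by (simp add: building_set_eq)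
  then have h: "h_polynomial (graph_associahedron E) = pcompose (fpoly (adj E) UNIV) [:-1, 1:]"
    unfolding pcompose_shift_iff[symmetric] h_polynomial .
  have "has_gamma (graph_rank (adj E) UNIV) (fpoly (adj E) UNIV) (graph_gamma (adj E) UNIV)"
    by (intro has_gamma_graph_gamma symp_adj) simp
  then show "degree (graph_gamma (adj E) UNIV) \<le> pdim (graph_associahedron E) div 2"
    "h_polynomial (graph_associahedron E) =
      gamma_expansion (pdim (graph_associahedron E)) (graph_gamma (adj E) UNIV)"
    unfolding d h by (simp_all add: has_gamma_def)
qed

theorem theorem5p1:
  fixes E E' :: "'n::finite set set"
  assumes "simple_graph E" and "graph_connected UNIV E"
    and "flossing_move E E'"
  shows "\<forall>i. coeff (gamma_polynomial (graph_associahedron E')) i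
           \<le> coeff (gamma_polynomial (graph_associahedron E)) i"
proof -
  have con: "conn (adj E) UNIV"
    using assms(2) graph_connected_iff[of UNIV E] by (simp add: induced_edges_def conn_def)
  obtain q and N A :: "'n set" and L m :: nat and \<phi> \<phi>' :: "'n + nat \<Rightarrow> 'n"
    where q: "symp q" and A: "attached q N A" and m: "0 < m" "2 * m \<le> L"
      and emb: "embeds (hub q N m) (A <+> {..<Suc L}) (adj E) \<phi>"
      and im: "\<phi> ` (A <+> {..<Suc L}) = UNIV"
      and emb': "embeds (hub q N (m - 1)) (A <+> {..<Suc L}) (adj E') \<phi>'"
      and im': "\<phi>' ` (A <+> {..<Suc L}) = UNIV"
    using flossing_move_hub[OF assms(1) con assms(3)] by metis
  have "conn (hub q N (m - 1)) (A <+> {..<Suc L})"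
  proof (subst conn_hub_iff[OF q subset_refl])
    show "(\<exists>k. A <+> {..<Suc L} = {} <+> {..<k} \<and> k \<le> m - 1) \<or>
      (\<exists>J k. A <+> {..<Suc L} = J <+> {..<k} \<and> m - 1 < k \<and> attached q N J)"
      using A m by (intro disjI2 exI[of _ A] exI[of _ "Suc L"]) auto
  qed auto
  then have con': "conn (adj E') UNIV"
    using conn_image[OF emb' subset_refl] im' by simp
  have "graph_gamma (adj E) UNIV = line_gamma q N A (Suc L) m"
    unfolding line_gamma_def im[symmetric] by (rule graph_gamma_image[OF symp_hub[OF q] symp_adj _ emb]) simp
  moreover have "graph_gamma (adj E') UNIV = line_gamma q N A (Suc L) (m - 1)"
    unfolding line_gamma_def im'[symmetric] by (rule graph_gamma_image[OF symp_hub[OF q] symp_adj _ emb']) simp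
  moreover have "poly_le (line_gamma q N A (Suc L) (m - 1)) (line_gamma q N A (Suc L) m)"
    using m by (intro line_gamma_mono[OF q _ A]) auto
  ultimately show ?thesis
    by (simp add: gamma_polynomial_graph_associahedron con con' poly_le_def)
qed

end
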